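(* Let $T_0>0$ and $\beta\in[0,2]$ be fixed, let $f(v)=v^3$, and for $\varepsilon\in(0,1]$ put $T_\varepsilon=T_0/\varepsilon^{\beta}$. Let $u=u(x,t)$ (depending on $\varepsilon$) be the exact solution of the nonlinear Klein-Gordon equation on $\Omega=(a,b)$ with periodic boundary conditions, $$\partial_{tt}u-\partial_{xx}u+u+\varepsilon^2u^3=0,\ x\in\Omega,\ t>0,\qquad u(x,0)=\phi(x),\quad \partial_tu(x,0)=\gamma(x),\ x\in\overline\Omega,$$ where the real-valued functions $\phi,\gamma$ do not depend on $\varepsilon$. Assume that there is an integer $m_0\ge 2$ such that $$u\in L^\infty([0,T_\varepsilon];H^{m_0}_p),\quad \partial_tu\in L^\infty([0,T_\varepsilon];W^{1,4}),\quad \partial_{tt}u\in L^\infty([0,T_\varepsilon];H^1),$$ $$\|u\|_{L^\infty([0,T_\varepsilon];H^{m_0}_p)}\lesssim 1,\quad \|\partial_tu\|_{L^\infty([0,T_\varepsilon];W^{1,4})}\lesssim 1,\quad \|\partial_{tt}u\|_{L^\infty([0,T_\varepsilon];H^1)}\lesssim 1 .$$ Set $$M_1:=\max_{\varepsilon\in(0,1]}\{\|u\|_{L^\infty([0,T_\varepsilon];L^\infty)}+\|\partial_tu\|_{L^\infty([0,T_\varepsilon];L^\infty)}\},\qquad M_2:=\sup_{v\ne0,\ |v|\le 1+M_1}|v|^2 .$$ Let $u^n_M(x)$ be the approximation produced by the EWI-FS scheme (defined in the context) with mesh size $h=(b-a)/M$ ($M$ an even positive integer) and time step $\tau>0$,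 $t_n=n\tau$. Assume the stability condition $$0<\tau\le\frac{2h}{\sqrt{\pi^2+h^2(1+\varepsilon^2\sigma_{\max})}}$$ (with $\sigma_{\max}$ as defined in the context) and $$\tau\le\min\Big\{\frac18,\ \frac{\pi h}{3\sqrt{\pi^2+h^2(1+\varepsilon^2M_2)}}\Big\}.$$ Then there exist constants $h_0>0$ and $\tau_0>0$, sufficiently small and independent of $\varepsilon$, such that for any $0<\varepsilon\le1$, whenever $0<h\le h_0$ and $0<\tau\le\tau_0$ (with $0<\tau\le\frac{2h}{\sqrt{\pi^2+h^2(1+\varepsilon^2\sigma_{\max})}}$ and $\tau\le\min\big\{\frac18,\ \frac{\pi h}{3\sqrt{\pi^2+h^2(1+\varepsilon^2M_2)}}\big\}$ satisfied), one has $$\|u(\cdot,t_n)-u^n_M\|_{\lambda}\lesssim h^{m_0-\lambda}+\varepsilon^{2-\beta}\tau^2,\quad \lambda=0,1,\qquad \|u^n_M\|_{L^\infty}\le 1+M_1,\qquad 0\le n\le \frac{T_0/\varepsilon^{\beta}}{\tau}.$$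
   Context: Notation $p\lesssim q$: there is a generic constant $C>0$ independent of $h$, $\tau$ and $\varepsilon$ such that $|p|\le Cq$. Sobolev spaces: for an integer $m\ge0$, $H^m(\Omega)$ carries the norm $\|z\|_m^2=\sum_{l\in\mathbb Z}(1+\mu_l^2)^m|\widehat z_l|^2$ for $z(x)=\sum_{l\in\mathbb Z}\widehat z_le^{i\mu_l(x-a)}$, where $\mu_l=\frac{2\pi l}{b-a}$; $m=0$ is $L^2(\Omega)$ (so $\|\cdot\|_0$ is the $L^2$ norm). $H^m_p(\Omega)$ is the subspace of $H^m(\Omega)$ of functions whose derivatives of order up to $m-1$ are $(b-a)$-periodic. $W^{1,4}$ is the usual Sobolev space on $\Omega$. Discretization notation: $M$ even positive integer, $h=(b-a)/M$, grid points $x_j=a+jh$ ($0\le j\le M$), $\mathcal T_M=\{-M/2,-M/2+1,\dots,M/2-1\}$. For a function $w$ on $\overline\Omega$, $\widehat w_l=\frac1{b-a}\int_a^b w(x)e^{-i\mu_l(x-a)}dx$; for a function or grid vector $w$ (with $w_j=w(x_j)$ for a function), $\widetilde w_l=\frac1M\sum_{j=0}^{M-1}w_je^{-i\mu_l(x_j-a)}$. $P_M$ is the $L^2$-projection: $(P_Mw)(x)=\sum_{l\in\mathcal T_M}\widehat w_le^{i\mu_l(x-a)}$. Put $\zeta_l=\sqrt{1+\mu_l^2}$ and $$p_l=\cos(\tau\zeta_l),\quad q_l=\frac{\sin(\tau\zeta_l)}{\zeta_l},\quad r_l=\frac{\varepsilon^2(\cos(\tau\zeta_l)-1)}{\zeta_l^2}.$$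 EWI-FS scheme (Gautschi-type exponential wave integrator Fourier spectral): $u^0_M=P_M\phi$ and, for $n\ge0$, $u^{n+1}_M(x)=\sum_{l\in\mathcal T_M}\widehat{(u^{n+1}_M)}_le^{i\mu_l(x-a)}$, where for $l\in\mathcal T_M$ $$\widehat{(u^1_M)}_l=p_l\widehat\phi_l+q_l\widehat\gamma_l+r_l\widehat{(f(\phi))}_l,\qquad \widehat{(u^{n+1}_M)}_l=-\widehat{(u^{n-1}_M)}_l+2p_l\widehat{(u^n_M)}_l+2r_l\widehat{(f(u^n_M))}_l\quad(n\ge1).$$ EWI-FP scheme (pseudospectral version): $u^0_j=\phi(x_j)$ and, for $n\ge 0$, $u^{n+1}_j=\sum_{l\in\mathcal T_M}\widetilde u^{n+1}_le^{i\mu_l(x_j-a)}$ ($0\le j\le M$), where for $l\in\mathcal T_M$ $$\widetilde u^1_l=p_l\widetilde\phi_l+q_l\widetilde\gamma_l+r_l\widetilde{(f(\phi))}_l,\qquad \widetilde u^{n+1}_l=-\widetilde u^{n-1}_l+2p_l\widetilde u^n_l+2r_l\widetilde{(f(u^n))}_l\quad(n\ge1).$$ The quantity in the stability condition is $\sigma_{\max}:=\max_{0\le n\le T_0\varepsilon^{-\beta}/\tau}\|u^n\|_{l^\infty}^2$, where $u^n=(u^n_0,\dots,u^n_M)$ is the EWI-FP numerical solution and $\|w\|_{l^\infty}=\max_{0\le j\le M-1}|w_j|$. *)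

theory Defs
  imports "HOL-Analysis.Analysis" "HOL-Probability.Essential_Supremum"
begin

section \<open>Fourier coefficients and function spaces on \<open>\<Omega> = (a, b)\<close>\<close>

text \<open>
  All spaces consist of complex-valued functions: the index set of the scheme below is not
  symmetric about \<open>0\<close>, so the numerical solution is complex-valued even for real data. Norms take
  values in \<^typ>\<open>ereal\<close>, with value \<open>\<infinity>\<close> outside the space.
\<close>

definition freq :: "real \<Rightarrow> real \<Rightarrow> int \<Rightarrow> real" where
  "freq a b l = 2 * pi * of_int l / (b - a)"

definition fmode :: "real \<Rightarrow> real \<Rightarrow> int \<Rightarrow> real \<Rightarrow> complex" where
  "fmode a b l x = exp (\<i> * of_real (freq a b l * (x - a)))"

definition fcoeff :: "real \<Rightarrow> real \<Rightarrow> (real \<Rightarrow> complex) \<Rightarrow> int \<Rightarrow> complex" where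
  "fcoeff a b w l =
     (LINT x|lebesgue_on {a<..<b}. w x * exp (- \<i> * of_real (freq a b l * (x - a)))) / of_real (b - a)"

definition in_Lp :: "real \<Rightarrow> real \<Rightarrow> nat \<Rightarrow> (real \<Rightarrow> complex) \<Rightarrow> bool" where
  "in_Lp a b p w \<longleftrightarrow>
     w \<in> borel_measurable (lebesgue_on {a<..<b}) \<and>
     integrable (lebesgue_on {a<..<b}) (\<lambda>x. cmod (w x) ^ p)"

definition Linf_norm :: "real \<Rightarrow> real \<Rightarrow> (real \<Rightarrow> complex) \<Rightarrow> ereal" where
  "Linf_norm a b w = esssup (lebesgue_on {a<..<b}) (\<lambda>x. ereal (cmod (w x)))"

text \<open>
  The norm \<open>\<parallel>z\<parallel>\<^sub>m\<close> of \<open>H\<^sup>m(\<Omega>)\<close> through Fourier coefficients. For \<open>m \<ge> 1\<close> its finiteness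
  already forces \<open>z\<close> to be periodic.
\<close>

definition H_norm :: "real \<Rightarrow> real \<Rightarrow> nat \<Rightarrow> (real \<Rightarrow> complex) \<Rightarrow> ereal" where
  "H_norm a b m z =
     (if in_Lp a b 2 z \<and>
         (\<lambda>l. (1 + (freq a b l)\<^sup>2) ^ m * (cmod (fcoeff a b z l))\<^sup>2) summable_on UNIV
      then ereal (sqrt (\<Sum>\<^sub>\<infinity>l. (1 + (freq a b l)\<^sup>2) ^ m * (cmod (fcoeff a b z l))\<^sup>2))
      else \<infinity>)"

definition H_space :: "real \<Rightarrow> real \<Rightarrow> nat \<Rightarrow> (real \<Rightarrow> complex) set" where
  "H_space a b m = {z. H_norm a b m z < \<infinity>}"

definition test_function :: "real \<Rightarrow> real \<Rightarrow> (real \<Rightarrow> real) \<Rightarrow> bool" where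
  "test_function a b \<psi> \<longleftrightarrow>
     (\<forall>k x. ((deriv ^^ k) \<psi>) field_differentiable (at x)) \<and>
     (\<exists>c d. a < c \<and> d < b \<and> (\<forall>x. x \<notin> {c..d} \<longrightarrow> \<psi> x = 0))"

definition is_weak_deriv ::
  "real \<Rightarrow> real \<Rightarrow> nat \<Rightarrow> (real \<Rightarrow> complex) \<Rightarrow> (real \<Rightarrow> complex) \<Rightarrow> bool" where
  "is_weak_deriv a b k w g \<longleftrightarrow>
     (\<forall>\<psi>. test_function a b \<psi> \<longrightarrow>
        (LINT x|lebesgue_on {a<..<b}. w x * of_real ((deriv ^^ k) \<psi> x)) =
        (-1) ^ k * (LINT x|lebesgue_on {a<..<b}. g x * of_real (\<psi> x)))"

text \<open>
  For \<open>z \<in> H\<^sup>m(\<Omega>)\<close> the derivatives of order below \<open>m\<close> have continuous representatives on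
  \<open>[a, b]\<close>; periodicity is a condition on these.
\<close>

definition Hp_space :: "real \<Rightarrow> real \<Rightarrow> nat \<Rightarrow> (real \<Rightarrow> complex) set" where
  "Hp_space a b m =
     {z \<in> H_space a b m.
        \<forall>k<m. \<exists>g. is_weak_deriv a b k z g \<and> continuous_on {a..b} g \<and> g a = g b}"

text \<open>Weak derivatives are unique up to null sets, so the choice of \<open>g\<close> does not matter.\<close>

definition W14_norm :: "real \<Rightarrow> real \<Rightarrow> (real \<Rightarrow> complex) \<Rightarrow> ereal" where
  "W14_norm a b w =
     (if in_Lp a b 4 w \<and> (\<exists>g. in_Lp a b 4 g \<and> is_weak_deriv a b 1 w g)
      then let g = (SOME g. in_Lp a b 4 g \<and> is_weak_deriv a b 1 w g) in
        ereal (root 4 ((LINT x|lebesgue_on {a<..<b}. cmod (w x) ^ 4) +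
                       (LINT x|lebesgue_on {a<..<b}. cmod (g x) ^ 4)))
      else \<infinity>)"

definition W14_space :: "real \<Rightarrow> real \<Rightarrow> (real \<Rightarrow> complex) set" where
  "W14_space a b = {w. W14_norm a b w < \<infinity>}"

text \<open>
  The space \<open>L\<^sup>\<infinity>([0, T]; X)\<close> for a space \<open>X\<close> with norm \<open>N\<close>; note that \<^const>\<open>esssup\<close>
  is \<open>\<infinity>\<close> if \<open>t \<mapsto> N (v t)\<close> is not measurable.
\<close>

definition Linf_time_norm ::
  "real \<Rightarrow> ((real \<Rightarrow> complex) \<Rightarrow> ereal) \<Rightarrow> (real \<Rightarrow> real \<Rightarrow> complex) \<Rightarrow> ereal" where
  "Linf_time_norm T N v = esssup (lebesgue_on {0..T}) (\<lambda>t. N (v t))"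

definition Linf_time ::
  "real \<Rightarrow> (real \<Rightarrow> complex) set \<Rightarrow> ((real \<Rightarrow> complex) \<Rightarrow> ereal) \<Rightarrow>
   (real \<Rightarrow> real \<Rightarrow> complex) set" where
  "Linf_time T X N =
     {v. (AE t in lebesgue_on {0..T}. v t \<in> X) \<and> Linf_time_norm T N v < \<infinity>}"


section \<open>The nonlinear Klein-Gordon equation\<close>

definition d_t :: "(real \<Rightarrow> real \<Rightarrow> real) \<Rightarrow> real \<Rightarrow> real \<Rightarrow> real" where
  "d_t w x t = vector_derivative (\<lambda>s. w x s) (at t within {0..})"

definition d_x :: "real \<Rightarrow> real \<Rightarrow> (real \<Rightarrow> real \<Rightarrow> real) \<Rightarrow> real \<Rightarrow> real \<Rightarrow> real" where
  "d_x a b w x t = vector_derivative (\<lambda>y. w y t) (at x within {a..b})"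

text \<open>
  Classical solutions: the derivatives in the equation exist and are continuous on
  \<open>\<Omega> \<times> (0, \<infinity>)\<close>, those in the initial and boundary conditions up to the boundary. In the
  regularity class \<open>u \<in> L\<^sup>\<infinity>(H\<^sup>2\<^sub>p)\<close>, \<open>u\<^sub>t\<^sub>t \<in> L\<^sup>\<infinity>(H\<^sup>1)\<close> this is no restriction: the
  equation gives \<open>u\<^sub>x\<^sub>x \<in> L\<^sup>\<infinity>(H\<^sup>1)\<close>, hence \<open>u \<in> L\<^sup>\<infinity>(H\<^sup>3) \<inter> C(H\<^sup>1)\<close>, and interpolation
  makes \<open>u\<^sub>x\<^sub>x\<close> and then \<open>u\<^sub>t\<^sub>t\<close> continuous (for a suitable representative).
\<close>

definition nkge_solution ::
  "real \<Rightarrow> real \<Rightarrow> real \<Rightarrow> (real \<Rightarrow> real) \<Rightarrow> (real \<Rightarrow> real) \<Rightarrow> (real \<Rightarrow> real \<Rightarrow> real) \<Rightarrow> bool" where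
  "nkge_solution a b \<epsilon> \<phi> \<gamma> u \<longleftrightarrow>
     (\<forall>x\<in>{a..b}. \<forall>t\<in>{0..}.
        (\<lambda>s. u x s) differentiable (at t within {0..}) \<and>
        (\<lambda>y. u y t) differentiable (at x within {a..b})) \<and>
     (\<forall>x\<in>{a<..<b}. \<forall>t\<in>{0<..}.
        (\<lambda>s. d_t u x s) differentiable (at t) \<and>
        (\<lambda>y. d_x a b u y t) differentiable (at x)) \<and>
     continuous_on ({a..b} \<times> {0..}) (\<lambda>(x, t). u x t) \<and>
     continuous_on ({a..b} \<times> {0..}) (\<lambda>(x, t). d_t u x t) \<and>
     continuous_on ({a..b} \<times> {0..}) (\<lambda>(x, t). d_x a b u x t) \<and>
     continuous_on ({a<..<b} \<times> {0<..}) (\<lambda>(x, t). d_t (d_t u) x t) \<and>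
     continuous_on ({a<..<b} \<times> {0<..}) (\<lambda>(x, t). d_x a b (d_x a b u) x t) \<and>
     (\<forall>x\<in>{a<..<b}. \<forall>t\<in>{0<..}.
        d_t (d_t u) x t - d_x a b (d_x a b u) x t + u x t + \<epsilon>\<^sup>2 * (u x t) ^ 3 = 0) \<and>
     (\<forall>t\<in>{0..}. u a t = u b t \<and> d_x a b u a t = d_x a b u b t) \<and>
     (\<forall>x\<in>{a..b}. u x 0 = \<phi> x \<and> d_t u x 0 = \<gamma> x)"

text \<open>A function of \<open>(x, t)\<close> as a map from times to complex-valued functions of \<open>x\<close>.\<close>

definition in_time :: "(real \<Rightarrow> real \<Rightarrow> real) \<Rightarrow> real \<Rightarrow> real \<Rightarrow> complex" where
  "in_time w t = (\<lambda>x. of_real (w x t))"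

definition T_eps :: "real \<Rightarrow> real \<Rightarrow> real \<Rightarrow> real" where
  "T_eps T0 \<beta> \<epsilon> = T0 / \<epsilon> powr \<beta>"

text \<open>
  The ``maximum'' over \<open>\<epsilon>\<close> is a supremum; it is finite under the uniform bounds on \<open>u\<close>.
\<close>

definition M1_const ::
  "real \<Rightarrow> real \<Rightarrow> real \<Rightarrow> real \<Rightarrow> (real \<Rightarrow> real \<Rightarrow> real \<Rightarrow> real) \<Rightarrow> real" where
  "M1_const a b T0 \<beta> u =
     real_of_ereal (SUP \<epsilon>\<in>{0<..1}.
       Linf_time_norm (T_eps T0 \<beta> \<epsilon>) (Linf_norm a b) (in_time (u \<epsilon>)) +
       Linf_time_norm (T_eps T0 \<beta> \<epsilon>) (Linf_norm a b) (in_time (d_t (u \<epsilon>))))"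

definition M2_const :: "real \<Rightarrow> real" where
  "M2_const M1 = (SUP v\<in>{v::real. v \<noteq> 0 \<and> \<bar>v\<bar> \<le> 1 + M1}. \<bar>v\<bar>\<^sup>2)"


section \<open>The exponential wave integrators\<close>

definition modes :: "nat \<Rightarrow> int set" where
  "modes M = {- (int M div 2)..int M div 2 - 1}"

definition trig_sum :: "real \<Rightarrow> real \<Rightarrow> nat \<Rightarrow> (int \<Rightarrow> complex) \<Rightarrow> real \<Rightarrow> complex" where
  "trig_sum a b M c x = (\<Sum>l\<in>modes M. c l * fmode a b l x)"

definition proj :: "real \<Rightarrow> real \<Rightarrow> nat \<Rightarrow> (real \<Rightarrow> complex) \<Rightarrow> real \<Rightarrow> complex" where
  "proj a b M w = trig_sum a b M (fcoeff a b w)"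

definition grid :: "real \<Rightarrow> real \<Rightarrow> nat \<Rightarrow> nat \<Rightarrow> real" where
  "grid a b M j = a + real j * ((b - a) / real M)"

definition dcoeff :: "real \<Rightarrow> real \<Rightarrow> nat \<Rightarrow> (nat \<Rightarrow> complex) \<Rightarrow> int \<Rightarrow> complex" where
  "dcoeff a b M w l =
     (\<Sum>j<M. w j * exp (- \<i> * of_real (freq a b l * (grid a b M j - a)))) / of_nat M"

definition zeta :: "real \<Rightarrow> real \<Rightarrow> int \<Rightarrow> real" where
  "zeta a b l = sqrt (1 + (freq a b l)\<^sup>2)"

definition p_coef :: "real \<Rightarrow> real \<Rightarrow> real \<Rightarrow> int \<Rightarrow> complex" where
  "p_coef a b \<tau> l = of_real (cos (\<tau> * zeta a b l))"

definition q_coef :: "real \<Rightarrow> real \<Rightarrow> real \<Rightarrow> int \<Rightarrow> complex" where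
  "q_coef a b \<tau> l = of_real (sin (\<tau> * zeta a b l) / zeta a b l)"

definition r_coef :: "real \<Rightarrow> real \<Rightarrow> real \<Rightarrow> real \<Rightarrow> int \<Rightarrow> complex" where
  "r_coef a b \<epsilon> \<tau> l = of_real (\<epsilon>\<^sup>2 * (cos (\<tau> * zeta a b l) - 1) / (zeta a b l)\<^sup>2)"

fun ewi_fs :: "real \<Rightarrow> real \<Rightarrow> real \<Rightarrow> real \<Rightarrow> nat \<Rightarrow> (real \<Rightarrow> real) \<Rightarrow> (real \<Rightarrow> real) \<Rightarrow>
    nat \<Rightarrow> real \<Rightarrow> complex" where
  "ewi_fs a b \<epsilon> \<tau> M \<phi> \<gamma> 0 = proj a b M (\<lambda>x. of_real (\<phi> x))"
| "ewi_fs a b \<epsilon> \<tau> M \<phi> \<gamma> (Suc 0) =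
     trig_sum a b M (\<lambda>l. p_coef a b \<tau> l * fcoeff a b (\<lambda>x. of_real (\<phi> x)) l
                       + q_coef a b \<tau> l * fcoeff a b (\<lambda>x. of_real (\<gamma> x)) l
                       + r_coef a b \<epsilon> \<tau> l * fcoeff a b (\<lambda>x. of_real (\<phi> x) ^ 3) l)"
| "ewi_fs a b \<epsilon> \<tau> M \<phi> \<gamma> (Suc (Suc n)) =
     trig_sum a b M (\<lambda>l. - fcoeff a b (ewi_fs a b \<epsilon> \<tau> M \<phi> \<gamma> n) l
                       + 2 * p_coef a b \<tau> l * fcoeff a b (ewi_fs a b \<epsilon> \<tau> M \<phi> \<gamma> (Suc n)) l
                       + 2 * r_coef a b \<epsilon> \<tau> l *
                           fcoeff a b (\<lambda>x. (ewi_fs a b \<epsilon> \<tau> M \<phi> \<gamma> (Suc n) x) ^ 3) l)"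

fun ewi_fp :: "real \<Rightarrow> real \<Rightarrow> real \<Rightarrow> real \<Rightarrow> nat \<Rightarrow> (real \<Rightarrow> real) \<Rightarrow> (real \<Rightarrow> real) \<Rightarrow>
    nat \<Rightarrow> nat \<Rightarrow> complex" where
  "ewi_fp a b \<epsilon> \<tau> M \<phi> \<gamma> 0 = (\<lambda>j. of_real (\<phi> (grid a b M j)))"
| "ewi_fp a b \<epsilon> \<tau> M \<phi> \<gamma> (Suc 0) =
     (\<lambda>j. trig_sum a b M
        (\<lambda>l. p_coef a b \<tau> l * dcoeff a b M (\<lambda>j. of_real (\<phi> (grid a b M j))) l
           + q_coef a b \<tau> l * dcoeff a b M (\<lambda>j. of_real (\<gamma> (grid a b M j))) l
           + r_coef a b \<epsilon> \<tau> l * dcoeff a b M (\<lambda>j. of_real (\<phi> (grid a b M j)) ^ 3) l)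
        (grid a b M j))"
| "ewi_fp a b \<epsilon> \<tau> M \<phi> \<gamma> (Suc (Suc n)) =
     (\<lambda>j. trig_sum a b M
        (\<lambda>l. - dcoeff a b M (ewi_fp a b \<epsilon> \<tau> M \<phi> \<gamma> n) l
           + 2 * p_coef a b \<tau> l * dcoeff a b M (ewi_fp a b \<epsilon> \<tau> M \<phi> \<gamma> (Suc n)) l
           + 2 * r_coef a b \<epsilon> \<tau> l *
               dcoeff a b M (\<lambda>i. (ewi_fp a b \<epsilon> \<tau> M \<phi> \<gamma> (Suc n) i) ^ 3) l)
        (grid a b M j))"

definition linf_grid :: "nat \<Rightarrow> (nat \<Rightarrow> complex) \<Rightarrow> real" where
  "linf_grid M w = Max ((\<lambda>j. cmod (w j)) ` {..<M})"

definition sigma_max :: "real \<Rightarrow> real \<Rightarrow> real \<Rightarrow> real \<Rightarrow> real \<Rightarrow> real \<Rightarrow> nat \<Rightarrow>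
    (real \<Rightarrow> real) \<Rightarrow> (real \<Rightarrow> real) \<Rightarrow> real" where
  "sigma_max a b T0 \<beta> \<epsilon> \<tau> M \<phi> \<gamma> =
     Max ((\<lambda>n. (linf_grid M (ewi_fp a b \<epsilon> \<tau> M \<phi> \<gamma> n))\<^sup>2) `
            {n. real n \<le> T0 * \<epsilon> powr (- \<beta>) / \<tau>})"

end

theory Submission
  imports Defs
begin

text \<open>
  Each Fourier coefficient of the exact solution is a harmonic oscillator of frequency
  \<open>\<zeta>\<^sub>l\<close>, forced by \<open>- \<epsilon>\<^sup>2\<close> times the coefficient of \<open>u\<^sup>3\<close>. The integrator is the
  variation of constants formula for that oscillator, symmetrised in time, with the forcing frozen at
  the current time. The defect of one step therefore consists of second differences in time of the
  coefficients of \<open>u\<^sup>3\<close>. By Bessel's inequality their \<open>\<ell>\<^sup>2\<close> norm is at most an \<open>L\<^sup>2\<close> norm of a second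
  difference of \<open>u\<^sup>3\<close>, which the algebra of cubes reduces to the second difference of \<open>u\<close> and to the
  Lipschitz bound of \<open>u\<close> in time. The defect is thus of size \<open>\<epsilon>\<^sup>2 \<tau>\<^sup>4\<close> (\<open>step_defect_le\<close>), and that of
  the first, unsymmetric step is of size \<open>\<epsilon>\<^sup>2 \<tau>\<^sup>3\<close> (\<open>initial_defect_le\<close>).

  The error \<open>e\<^sub>n\<close> of a single mode satisfies \<open>e\<^sub>n\<^sub>+\<^sub>1 - 2 cos \<theta> e\<^sub>n + e\<^sub>n\<^sub>-\<^sub>1 = \<eta>\<^sub>n\<close> with \<open>\<theta> = \<tau> \<zeta>\<^sub>l\<close>, so it
  is the sum of the \<open>sin ((n - k) \<theta>) / sin \<theta> \<cdot> \<eta>\<^sub>k\<close>. The restriction on the time step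
  says \<open>\<theta> \<le> \<pi> / 3\<close>, whence \<open>sin \<theta> \<ge> \<theta> / 2\<close> and \<open>\<zeta>\<^sub>l |e\<^sub>n| \<le> (2 / \<tau>) \<Sum> |\<eta>\<^sub>k|\<close>: dividing by the sine
  gains the factor \<open>\<zeta>\<^sub>l\<close>, and \<open>L\<^sup>2\<close> bounds of the defects become \<open>H\<^sup>1\<close> bounds of the error. There are
  about \<open>T\<^sub>0 \<epsilon>\<^sup>-\<^sup>\<beta> / \<tau>\<close> steps, which turns the factor \<open>\<epsilon>\<^sup>2\<close> of the nonlinearity into \<open>\<epsilon>\<^sup>2\<^sup>-\<^sup>\<beta> \<le> 1\<close>; hence the
  constant in Gronwall's inequality does not depend on \<open>\<epsilon>\<close> (\<open>energy_bound\<close>). The cube is Lipschitz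
  only on bounded sets, so the bound \<open>1 + M\<^sub>1\<close> of the numerical solution is carried along by induction
  over the time steps: a small \<open>H\<^sup>1\<close> error is a small sup-norm error by Sobolev's inequality
  (\<open>scheme_error\<close>).

  The function spaces are used through finite sums of weighted Fourier coefficients. A bound of a
  Sobolev norm for almost every time bounds such a sum for almost every time, and then for every time
  by continuity of the coefficients. The norm of \<open>u\<^sub>t\<close> in \<open>H\<^sup>1\<close> is bounded by interpolation between \<open>u\<close> and
  \<open>u\<^sub>t\<^sub>t\<close> (\<open>ut_H1\<close>). To return from coefficients to functions one needs pointwise convergence of
  Fourier series at points of differentiability (\<open>fourier_converges\<close>); it gives
  Sobolev's inequality (\<open>sobolev_sup_bound\<close>) and Parseval's upper bound (\<open>mean_sq_le_fourier\<close>).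
\<close>

section \<open>Fourier series on an interval\<close>

lemma fmode_eq_cis: "fmode a b l x = cis (freq a b l * (x - a))"
  by (simp add: fmode_def cis_conv_exp)

lemma norm_fmode [simp]: "cmod (fmode a b l x) = 1"
  by (simp add: fmode_eq_cis)

lemma cnj_fmode: "cnj (fmode a b l x) = fmode a b (- l) x"
  by (simp add: fmode_eq_cis cis_cnj freq_def)

lemma fmode_add: "fmode a b (k + l) x = fmode a b k x * fmode a b l x"
  by (simp add: fmode_eq_cis cis_mult freq_def field_simps add_divide_distrib)

lemma fmode_0 [simp]: "fmode a b 0 x = 1"
  by (simp add: fmode_def freq_def)

lemma fmode_left [simp]: "fmode a b l a = 1"
  by (simp add: fmode_def)

lemma fmode_right [simp]: "a < b \<Longrightarrow> fmode a b l b = 1"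
  by (simp add: fmode_eq_cis freq_def)

lemma has_vector_derivative_fmode:
  "(fmode a b l has_vector_derivative \<i> * of_real (freq a b l) * fmode a b l x) (at x within S)"
proof -
  have "((\<lambda>z. exp (\<i> * of_real (freq a b l) * (z - of_real a))) has_field_derivative
          \<i> * of_real (freq a b l) * exp (\<i> * of_real (freq a b l) * (of_real x - of_real a))) (at (of_real x))"
    by (auto intro!: derivative_eq_intros)
  from has_vector_derivative_real_field[OF this] show ?thesis
    by (simp add: fmode_def[abs_def] mult.assoc)
qed

lemma has_vector_derivative_imp_quotient_tendsto:
  fixes f :: "real \<Rightarrow> 'a::real_normed_vector"
  assumes "(f has_vector_derivative d) (at x)"
  shows "((\<lambda>y. (f y - f x) /\<^sub>R (y - x)) \<longlongrightarrow> d) (at x)"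
proof -
  have lim: "((\<lambda>y. (1 / norm (y - x)) *\<^sub>R (f y - (f x + (y - x) *\<^sub>R d))) \<longlongrightarrow> 0) (at x)"
    using assms by (simp add: has_vector_derivative_def has_derivative_within)
  have "norm ((f y - f x) /\<^sub>R (y - x) - d) = norm ((1 / norm (y - x)) *\<^sub>R (f y - (f x + (y - x) *\<^sub>R d)))"
    if "y \<noteq> x" for y
  proof -
    have "(f y - f x) /\<^sub>R (y - x) - d = (1 / (y - x)) *\<^sub>R (f y - (f x + (y - x) *\<^sub>R d))"
      using that by (simp add: diff_diff_eq[symmetric] scaleR_diff_right divide_inverse)
    then show ?thesis by simp
  qed
  then have "((\<lambda>y. norm ((f y - f x) /\<^sub>R (y - x) - d)) \<longlongrightarrow> 0) (at x)"
    using tendsto_norm_zero[OF lim]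
    by (rule_tac Lim_transform_eventually[rotated]) (auto simp: eventually_at_filter)
  then show ?thesis
    by (simp add: tendsto_norm_zero_iff LIM_zero_iff)
qed

lemma continuous_on_fmode [continuous_intros]: "continuous_on S (fmode a b l)"
  by (rule continuous_on_vector_derivative[OF has_vector_derivative_fmode])

definition mean_inner :: "real \<Rightarrow> real \<Rightarrow> (real \<Rightarrow> complex) \<Rightarrow> (real \<Rightarrow> complex) \<Rightarrow> complex" where
  "mean_inner a b f g = integral {a..b} (\<lambda>x. f x * cnj (g x)) / of_real (b - a)"

definition mean_sq :: "real \<Rightarrow> real \<Rightarrow> (real \<Rightarrow> complex) \<Rightarrow> real" where
  "mean_sq a b w = integral {a..b} (\<lambda>x. (cmod (w x))\<^sup>2) / (b - a)"

lemma integrable_lebesgue_on_Ioo: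
  fixes w :: "real \<Rightarrow> 'a::euclidean_space"
  assumes "continuous_on {a..b} w"
  shows "integrable (lebesgue_on {a<..<b}) w"
proof -
  have "w absolutely_integrable_on {a<..<b}"
    using absolutely_integrable_continuous_real[OF assms]
    by (rule set_integrable_subset) auto
  then show ?thesis
    by (simp add: integrable_restrict_space set_integrable_def)
qed

lemma lebesgue_integral_Ioo:
  fixes w :: "real \<Rightarrow> 'a::euclidean_space"
  assumes "continuous_on {a..b} w"
  shows "(LINT x|lebesgue_on {a<..<b}. w x) = integral {a..b} w"
  using lebesgue_integral_eq_integral[OF integrable_lebesgue_on_Ioo[OF assms]]
  by (simp add: integral_open_interval_real)

lemma fcoeff_cong: "(\<And>x. x \<in> {a<..<b} \<Longrightarrow> v x = w x) \<Longrightarrow> fcoeff a b v l = fcoeff a b w l"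
  unfolding fcoeff_def by (auto intro!: arg_cong2[where f="(/)"] Bochner_Integration.integral_cong)

lemma fcoeff_eq_integrand: "w x * exp (- \<i> * of_real (freq a b l * (x - a))) = w x * cnj (fmode a b l x)"
  by (simp add: fmode_def exp_cnj)

lemma fcoeff_eq_mean_inner:
  assumes "continuous_on {a..b} w"
  shows "fcoeff a b w l = mean_inner a b w (fmode a b l)"
proof -
  have "continuous_on {a..b} (\<lambda>x. w x * cnj (fmode a b l x))"
    by (intro continuous_intros assms)
  from lebesgue_integral_Ioo[OF this] show ?thesis
    unfolding fcoeff_def fcoeff_eq_integrand mean_inner_def by simp
qed

text \<open>
  The algebra of one summand of the telescoping sum in \<open>fourier_converges\<close>; \<open>d\<close> is the Kronecker symbol
  of the zero mode, on which the factor \<open>F\<close> is \<open>1\<close>.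
\<close>

lemma multiply_shift_identity:
  fixes F :: complex
  assumes "F1 = F * c" "W = w0 * d + (c * G1 - G2)" "d * F = d"
  shows "W * F - w0 * d = F1 * G1 - F * G2"
proof -
  have "W * F - w0 * d = w0 * (d * F) - w0 * d + (F * c) * G1 - F * G2"
    unfolding assms(2) by (simp add: distrib_left distrib_right left_diff_distrib right_diff_distrib mult_ac)
  then show ?thesis by (simp add: assms(1,3))
qed

lemma add_diff_cancel_telescope: "(p - q) + ((r - s) + (q - r)) = p - (s :: complex)"
  by simp

lemma sum_telescope_int:
  fixes t :: "int \<Rightarrow> complex"
  shows "(\<Sum>l\<in>{-int N..int N}. t (l - 1) - t l) = t (- int N - 1) - t (int N)"
proof (induction N)
  case (Suc N)
  have "{- int (Suc N)..int (Suc N)} = insert (- int (Suc N)) (insert (int (Suc N)) {-int N..int N})"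
    by auto
  then have S: "(\<Sum>l\<in>{- int (Suc N)..int (Suc N)}. t (l - 1) - t l)
      = (t (- int (Suc N) - 1) - t (- int (Suc N))) + ((t (int (Suc N) - 1) - t (int (Suc N)))
        + (\<Sum>l\<in>{-int N..int N}. t (l - 1) - t l))"
    by simp
  have e: "t (- int (Suc N)) = t (- int N - 1)" "t (int (Suc N) - 1) = t (int N)"
    by (rule arg_cong[of _ _ t], simp)+
  show ?case unfolding S Suc e by (rule add_diff_cancel_telescope)
qed simp

locale real_interval =
  fixes a b :: real
  assumes ab: "a < b"
begin

lemma inner_integrable:
  assumes "continuous_on {a..b} f" "continuous_on {a..b} g"
  shows "(\<lambda>x. f x * cnj (g x)) integrable_on {a..b}"
  by (intro integrable_continuous_real continuous_intros assms)

lemma mean_inner_diff_left: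
  assumes "continuous_on {a..b} f" "continuous_on {a..b} g" "continuous_on {a..b} k"
  shows "mean_inner a b (\<lambda>x. f x - g x) k = mean_inner a b f k - mean_inner a b g k"
  using Henstock_Kurzweil_Integration.integral_diff[OF inner_integrable[OF assms(1,3)] inner_integrable[OF assms(2,3)]]
  by (simp add: mean_inner_def diff_divide_distrib left_diff_distrib)

lemma mean_inner_sum_left:
  assumes "finite F" "\<And>i. i \<in> F \<Longrightarrow> continuous_on {a..b} (f i)" "continuous_on {a..b} g"
  shows "mean_inner a b (\<lambda>x. \<Sum>i\<in>F. c i * f i x) g = (\<Sum>i\<in>F. c i * mean_inner a b (f i) g)"
proof -
  have "integral {a..b} (\<lambda>x. \<Sum>i\<in>F. c i * (f i x * cnj (g x)))
      = (\<Sum>i\<in>F. integral {a..b} (\<lambda>x. c i * (f i x * cnj (g x))))"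
    by (intro integral_sum assms integrable_continuous_real continuous_intros)
  then show ?thesis
    by (simp add: mean_inner_def sum_divide_distrib sum_distrib_right mult.assoc)
qed

lemma cnj_mean_inner: "cnj (mean_inner a b f g) = mean_inner a b g f"
  by (simp add: mean_inner_def integral_cnj mult.commute)

lemma mean_inner_self:
  assumes "continuous_on {a..b} w"
  shows "mean_inner a b w w = of_real (mean_sq a b w)"
proof -
  have "((\<lambda>x. (cmod (w x))\<^sup>2) has_integral integral {a..b} (\<lambda>x. (cmod (w x))\<^sup>2)) {a..b}"
    by (intro integrable_integral integrable_continuous_real continuous_intros assms)
  from has_integral_of_real[OF this]
  have "integral {a..b} (\<lambda>x. w x * cnj (w x)) = of_real (integral {a..b} (\<lambda>x. (cmod (w x))\<^sup>2))"
    by (auto simp: complex_norm_square[symmetric] o_def dest!: integral_unique)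
  then show ?thesis
    by (simp add: mean_inner_def mean_sq_def)
qed

lemma mean_sq_nonneg: "0 \<le> mean_sq a b w"
  using ab
  by (cases "(\<lambda>x. (cmod (w x))\<^sup>2) integrable_on {a..b}")
     (auto simp: mean_sq_def not_integrable_integral intro!: divide_nonneg_pos Henstock_Kurzweil_Integration.integral_nonneg)

text \<open>
  The additive constant may be compared directly because \<^const>\<open>mean_sq\<close> is normalised by the length
  of the interval. Only interior points are tested, since pointwise bounds obtained from Fourier
  series hold there.
\<close>

lemma mean_sq_mono:
  assumes "continuous_on {a..b} v" "continuous_on {a..b} w"
    and "\<And>x. x \<in> {a<..<b} \<Longrightarrow> (cmod (v x))\<^sup>2 \<le> C * (cmod (w x))\<^sup>2 + D"
  shows "mean_sq a b v \<le> C * mean_sq a b w + D"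
proof -
  have "integral {a..b} (\<lambda>x. (cmod (v x))\<^sup>2) \<le> integral {a..b} (\<lambda>x. C * (cmod (w x))\<^sup>2 + D)"
    unfolding integral_open_interval_real
    by (intro integral_le assms(3))
       (auto simp: integrable_on_open_interval_real intro!: integrable_continuous_real continuous_intros assms(1,2))
  also have "\<dots> = C * integral {a..b} (\<lambda>x. (cmod (w x))\<^sup>2) + D * (b - a)"
    using ab by (subst Henstock_Kurzweil_Integration.integral_add)
       (auto intro!: integrable_continuous_real continuous_intros assms)
  finally have "integral {a..b} (\<lambda>x. (cmod (v x))\<^sup>2) / (b - a)
      \<le> (C * integral {a..b} (\<lambda>x. (cmod (w x))\<^sup>2) + D * (b - a)) / (b - a)"
    using ab by (intro divide_right_mono) auto
  then show ?thesis
    using ab by (simp add: mean_sq_def add_divide_distrib)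
qed

lemma mean_inner_fmode:
  "mean_inner a b (fmode a b k) (fmode a b l) = (if k = l then 1 else 0)"
proof (cases "k = l")
  case True
  then show ?thesis
    using ab by (simp add: mean_inner_def complex_norm_square[symmetric] scaleR_conv_of_real)
next
  case False
  define c where "c = \<i> * of_real (freq a b (k - l))"
  have c: "c \<noteq> 0"
    using False ab by (simp add: c_def freq_def)
  have "((\<lambda>x. c * fmode a b (k - l) x) has_integral (fmode a b (k - l) b - fmode a b (k - l) a)) {a..b}"
    unfolding c_def using ab
    by (intro fundamental_theorem_of_calculus has_vector_derivative_fmode) auto
  from has_integral_mult_right[OF this, of "1 / c"] c ab
  have "(fmode a b (k - l) has_integral 0) {a..b}" by simp
  then have "integral {a..b} (\<lambda>x. fmode a b k x * cnj (fmode a b l x)) = 0"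
    by (simp add: cnj_fmode integral_unique flip: fmode_add)
  with False show ?thesis by (simp add: mean_inner_def)
qed

lemma fcoeff_diff:
  assumes "continuous_on {a..b} v" "continuous_on {a..b} w"
  shows "fcoeff a b (\<lambda>x. v x - w x) l = fcoeff a b v l - fcoeff a b w l"
  using assms by (simp add: fcoeff_eq_mean_inner mean_inner_diff_left continuous_intros)

lemma fcoeff_sum:
  assumes "finite F" "\<And>i. i \<in> F \<Longrightarrow> continuous_on {a..b} (f i)"
  shows "fcoeff a b (\<lambda>x. \<Sum>i\<in>F. c i * f i x) l = (\<Sum>i\<in>F. c i * fcoeff a b (f i) l)"
  using assms by (simp add: fcoeff_eq_mean_inner mean_inner_sum_left continuous_intros)

lemma fcoeff_fmode_sum:
  assumes "finite F"
  shows "fcoeff a b (\<lambda>x. \<Sum>k\<in>F. c k * fmode a b k x) l = (if l \<in> F then c l else 0)"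
  using assms
  by (simp add: fcoeff_sum continuous_on_fmode)
     (simp add: continuous_on_fmode fcoeff_eq_mean_inner mean_inner_fmode if_distrib cong: if_cong)

text \<open>
  Expand the mean square of \<open>w - P\<close>, where \<open>P\<close> is the partial sum over \<open>F\<close>: each of the three
  mixed or quadratic terms in \<open>P\<close> equals the sum of squares.
\<close>

lemma bessel:
  assumes w: "continuous_on {a..b} w" and F: "finite F"
  shows "(\<Sum>l\<in>F. (cmod (fcoeff a b w l))\<^sup>2) \<le> mean_sq a b w"
proof -
  define c where "c = fcoeff a b w"
  define P where "P = (\<lambda>x. \<Sum>l\<in>F. c l * fmode a b l x)"
  have P: "continuous_on {a..b} P"
    unfolding P_def by (intro continuous_intros)
  have wm: "mean_inner a b w (fmode a b l) = c l" for l
    using w by (simp add: c_def fcoeff_eq_mean_inner)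
  have Pm: "mean_inner a b P (fmode a b l) = (if l \<in> F then c l else 0)" for l
    using fcoeff_fmode_sum[OF F, of c l] P by (simp add: P_def[symmetric] fcoeff_eq_mean_inner)
  have Pv: "mean_inner a b P v = (\<Sum>l\<in>F. c l * cnj (mean_inner a b v (fmode a b l)))"
    if "continuous_on {a..b} v" for v
    unfolding P_def using mean_inner_sum_left[OF F _ that, of "fmode a b" c] cnj_mean_inner
    by (simp add: continuous_intros)
  have PP: "mean_inner a b P P = of_real (\<Sum>l\<in>F. (cmod (c l))\<^sup>2)"
    unfolding Pv[OF P] of_real_sum by (intro sum.cong) (simp_all add: Pm complex_norm_square[symmetric])
  have Pw: "mean_inner a b P w = of_real (\<Sum>l\<in>F. (cmod (c l))\<^sup>2)"
    unfolding Pv[OF w] of_real_sum by (intro sum.cong) (simp_all add: wm complex_norm_square[symmetric])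
  have wP: "mean_inner a b w P = of_real (\<Sum>l\<in>F. (cmod (c l))\<^sup>2)"
    using cnj_mean_inner[of P w] by (simp add: Pw flip: of_real_sum)
  define v where "v = (\<lambda>x. w x - P x)"
  have v: "continuous_on {a..b} v" unfolding v_def by (intro continuous_intros w P)
  have "mean_inner a b v v = mean_inner a b w v - mean_inner a b P v"
    unfolding v_def[of] using mean_inner_diff_left[OF w P v] by (simp add: v_def)
  also have "mean_inner a b w v = cnj (mean_inner a b v w)" by (simp add: cnj_mean_inner)
  also have "mean_inner a b v w = mean_inner a b w w - mean_inner a b P w"
    using mean_inner_diff_left[OF w P w] by (simp add: v_def)
  also have "mean_inner a b P v = cnj (mean_inner a b v P)" by (simp add: cnj_mean_inner)
  also have "mean_inner a b v P = mean_inner a b w P - mean_inner a b P P"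
    using mean_inner_diff_left[OF w P P] by (simp add: v_def)
  finally have "complex_of_real (mean_sq a b v) = of_real (mean_sq a b w - (\<Sum>l\<in>F. (cmod (c l))\<^sup>2))"
    using w v by (simp add: mean_inner_self PP Pw wP)
  then have "mean_sq a b v = mean_sq a b w - (\<Sum>l\<in>F. (cmod (c l))\<^sup>2)"
    by (simp only: of_real_eq_iff)
  with mean_sq_nonneg[of v] show ?thesis by (simp add: c_def)
qed

lemma fcoeff_tendsto_0:
  assumes w: "continuous_on {a..b} w" and inj: "inj (s :: nat \<Rightarrow> int)"
  shows "(\<lambda>n. fcoeff a b w (s n)) \<longlonglongrightarrow> 0"
proof -
  have "summable (\<lambda>n. (cmod (fcoeff a b w (s n)))\<^sup>2)"
  proof (rule summableI_nonneg_bounded)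
    fix N
    have "(\<Sum>n<N. (cmod (fcoeff a b w (s n)))\<^sup>2) = (\<Sum>l\<in>s ` {..<N}. (cmod (fcoeff a b w l))\<^sup>2)"
      using inj by (subst sum.reindex) (auto simp: inj_on_def)
    also have "\<dots> \<le> mean_sq a b w" by (rule bessel[OF w]) auto
    finally show "(\<Sum>n<N. (cmod (fcoeff a b w (s n)))\<^sup>2) \<le> mean_sq a b w" .
  qed auto
  then have "(\<lambda>n. (cmod (fcoeff a b w (s n)))\<^sup>2) \<longlonglongrightarrow> 0"
    by (rule summable_LIMSEQ_zero)
  then have "(\<lambda>n. sqrt ((cmod (fcoeff a b w (s n)))\<^sup>2)) \<longlonglongrightarrow> sqrt 0"
    by (rule tendsto_real_sqrt)
  then show ?thesis by (simp add: tendsto_norm_zero_iff)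
qed

text \<open>
  Injectivity fails for the two endpoints of the interval, which is why \<open>x0\<close> is an interior point.
\<close>

lemma fmode_1_eq_iff:
  assumes "x0 \<in> {a<..<b}" "x \<in> {a..b}"
  shows "fmode a b 1 x = fmode a b 1 x0 \<longleftrightarrow> x = x0"
proof
  assume "fmode a b 1 x = fmode a b 1 x0"
  then obtain n :: int where "\<i> * complex_of_real (freq a b 1 * (x - a))
      = \<i> * of_real (freq a b 1 * (x0 - a)) + of_int (2 * n) * of_real pi * \<i>"
    by (auto simp: fmode_def exp_eq)
  from arg_cong[OF this, of Im] have "freq a b 1 * (x - a) = freq a b 1 * (x0 - a) + 2 * of_int n * pi"
    by simp
  then have "2 * pi * (x - x0) = 2 * pi * (of_int n * (b - a))"
    using ab by (simp add: freq_def field_simps)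
  then have n: "x - x0 = of_int n * (b - a)"
    by (subst (asm) mult_cancel_left) auto
  moreover have "\<bar>x - x0\<bar> < b - a" using assms by auto
  ultimately have "\<bar>real_of_int n\<bar> * (b - a) < 1 * (b - a)" using ab by (simp add: abs_mult)
  then have "\<bar>real_of_int n\<bar> < 1" using ab by (simp only: mult_less_cancel_right_pos diff_gt_0_iff_gt)
  then have "n = 0" by linarith
  with n show "x = x0" by simp
qed simp

text \<open>
  Chernoff's argument. With \<open>c = fmode a b 1 x\<^sub>0\<close> the quotient
  \<open>G x = (w x - w x\<^sub>0) / (fmode a b 1 x \<cdot> cnj c - 1)\<close> extends continuously to \<open>x\<^sub>0\<close>, because \<open>w\<close> is differentiable
  there and the denominator has a simple zero. The coefficients of \<open>w - w x\<^sub>0\<close> are then differences of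
  consecutive coefficients of \<open>G\<close>, so the partial sum at \<open>x\<^sub>0\<close> telescopes, and the two remaining
  coefficients of \<open>G\<close> tend to zero by Bessel's inequality.
\<close>

lemma fourier_converges:
  assumes w: "continuous_on {a..b} w" and x0: "x0 \<in> {a<..<b}"
    and d: "(w has_vector_derivative w') (at x0)"
  shows "(\<lambda>N. \<Sum>l\<in>{-int N..int N}. fcoeff a b w l * fmode a b l x0) \<longlonglongrightarrow> w x0"
proof -
  define c where "c = fmode a b 1 x0"
  define z where "z = (\<lambda>x. fmode a b 1 x * cnj c - 1)"
  define G where "G = (\<lambda>x. if x = x0 then w' / (\<i> * of_real (freq a b 1)) else (w x - w x0) / z x)"
  have cc: "c * cnj c = 1" by (simp add: c_def complex_norm_square[symmetric])
  have z0: "z x = 0 \<longleftrightarrow> x = x0" if "x \<in> {a..b}" for x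
  proof -
    have "z x = 0 \<longleftrightarrow> fmode a b 1 x = c"
      using cc unfolding z_def by (metis (no_types, lifting) cnj_fmode complex_cnj_cnj eq_iff_diff_eq_0 mult.assoc mult.commute mult.right_neutral)
    then show ?thesis using fmode_1_eq_iff[OF x0 that] by (simp add: c_def)
  qed
  have zd: "(z has_vector_derivative \<i> * of_real (freq a b 1)) (at x0)"
  proof -
    have "(z has_vector_derivative \<i> * of_real (freq a b 1) * fmode a b 1 x0 * cnj c - 0) (at x0)"
      unfolding z_def
      by (intro has_vector_derivative_diff has_vector_derivative_const has_vector_derivative_mult_left has_vector_derivative_fmode)
    then show ?thesis using cc by (simp add: c_def mult.assoc)
  qed
  have zx0: "z x0 = 0" using z0 x0 by simp
  have "((\<lambda>x. ((w x - w x0) /\<^sub>R (x - x0)) / ((z x - z x0) /\<^sub>R (x - x0)))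
      \<longlongrightarrow> w' / (\<i> * of_real (freq a b 1))) (at x0)"
  proof (rule tendsto_divide)
    show "((\<lambda>x. (w x - w x0) /\<^sub>R (x - x0)) \<longlongrightarrow> w') (at x0)"
      by (rule has_vector_derivative_imp_quotient_tendsto[OF d])
    show "((\<lambda>x. (z x - z x0) /\<^sub>R (x - x0)) \<longlongrightarrow> \<i> * of_real (freq a b 1)) (at x0)"
      by (rule has_vector_derivative_imp_quotient_tendsto[OF zd])
    show "\<i> * complex_of_real (freq a b 1) \<noteq> 0" using ab by (simp add: freq_def)
  qed
  \<comment> \<open>A quotient of difference quotients, so its limit is the value chosen for \<open>G\<close> at \<open>x0\<close>.\<close>
  then have "(G \<longlongrightarrow> w' / (\<i> * of_real (freq a b 1))) (at x0)"
    by (rule Lim_transform_eventually)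
       (auto simp: G_def zx0 eventually_at_filter scaleR_conv_of_real)
  then have "(G \<longlongrightarrow> G x0) (at x0)"
    by (simp add: G_def)
  then have Gx0: "continuous (at x0 within {a..b}) G"
    by (auto simp: continuous_within intro: tendsto_within_subset)
  have Gx: "continuous (at x within {a..b}) G" if "x \<in> {a..b}" "x \<noteq> x0" for x
  proof -
    have "continuous (at x within {a..b}) (\<lambda>x. (w x - w x0) / z x)"
      using w that z0[OF that(1)] unfolding z_def
      by (intro continuous_intros) (auto simp: continuous_on_eq_continuous_within
         intro!: continuous_on_fmode[unfolded continuous_on_eq_continuous_within, rule_format])
    moreover have "\<forall>\<^sub>F y in at x within {a..b}. (w y - w x0) / z y = G y"
      using that(2) by (auto simp: G_def eventually_at intro!: exI[of _ "dist x x0"] simp: dist_commute)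
    ultimately show ?thesis
      using that unfolding continuous_within by (auto simp: G_def elim: Lim_transform_eventually)
  qed
  have G: "continuous_on {a..b} G"
    using Gx0 Gx unfolding continuous_on_eq_continuous_within by blast
  have wG: "w x - w x0 = G x * z x" if "x \<in> {a..b}" for x
    using z0[OF that] by (auto simp: G_def)
  have rec: "fcoeff a b w l * fmode a b l x0 - (if l = 0 then w x0 else 0)
      = fmode a b (l - 1) x0 * fcoeff a b G (l - 1) - fmode a b l x0 * fcoeff a b G l" for l
  proof -
    have shift: "fcoeff a b (\<lambda>x. G x * fmode a b 1 x) l = fcoeff a b G (l - 1)"
    proof -
      have "G x * fmode a b 1 x * cnj (fmode a b l x) = G x * cnj (fmode a b (l - 1) x)" for x
        using fmode_add[of a b 1 "- l" x] by (simp add: cnj_fmode mult.assoc)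
      note eq = this
      have c: "continuous_on {a..b} (\<lambda>x. G x * fmode a b 1 x)"
        by (intro continuous_intros G)
      show ?thesis
        by (simp only: fcoeff_eq_mean_inner[OF c] fcoeff_eq_mean_inner[OF G] mean_inner_def eq)
    qed
    have "fcoeff a b w l - w x0 * (if l = 0 then 1 else 0) = fcoeff a b (\<lambda>x. w x - w x0 * fmode a b 0 x) l"
      using fcoeff_sum[of "{0::int}" "fmode a b" "\<lambda>_. w x0" l] w
      by (subst fcoeff_diff) (auto intro!: continuous_intros simp: fcoeff_eq_mean_inner[OF continuous_on_fmode] mean_inner_fmode)
    also have "\<dots> = fcoeff a b (\<lambda>x. cnj c * (G x * fmode a b 1 x) - G x) l"
      by (rule fcoeff_cong) (use wG in \<open>auto simp: z_def algebra_simps\<close>)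
    also have "\<dots> = cnj c * fcoeff a b G (l - 1) - fcoeff a b G l"
      using fcoeff_sum[of "{0::int}" "\<lambda>_ x. G x * fmode a b 1 x" "\<lambda>_. cnj c" l] G
      by (subst fcoeff_diff) (auto intro!: continuous_intros simp: shift)
    finally have *: "fcoeff a b w l - w x0 * (if l = 0 then 1 else 0) = cnj c * fcoeff a b G (l - 1) - fcoeff a b G l" .
    have "fmode a b (l - 1) x0 = fmode a b l x0 * cnj c"
      using fmode_add[of a b l "- 1" x0] by (simp add: c_def cnj_fmode)
    moreover have "fcoeff a b w l = w x0 * (if l = 0 then 1 else 0) + (cnj c * fcoeff a b G (l - 1) - fcoeff a b G l)"
      unfolding *[symmetric] by simp
    ultimately have "fcoeff a b w l * fmode a b l x0 - w x0 * (if l = 0 then 1 else 0)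
        = fmode a b (l - 1) x0 * fcoeff a b G (l - 1) - fmode a b l x0 * fcoeff a b G l"
      by (rule multiply_shift_identity) simp
    moreover have "w x0 * (if l = 0 then 1 else 0) = (if l = 0 then w x0 else 0)" by simp
    ultimately show ?thesis by (simp only:)
  qed
  define t where "t = (\<lambda>l. fmode a b l x0 * fcoeff a b G l)"
  have S: "(\<Sum>l\<in>{-int N..int N}. fcoeff a b w l * fmode a b l x0) = w x0 + (t (- int N - 1) - t (int N))" for N
  proof -
    have "(\<Sum>l\<in>{-int N..int N}. fcoeff a b w l * fmode a b l x0) - (\<Sum>l\<in>{-int N..int N}. if l = 0 then w x0 else 0)
       = (\<Sum>l\<in>{-int N..int N}. t (l - 1) - t l)"
      unfolding sum_subtractf[symmetric] rec t_def ..
    also have "\<dots> = t (- int N - 1) - t (int N)" by (rule sum_telescope_int)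
    finally show ?thesis by (simp add: algebra_simps)
  qed
  have t0: "(\<lambda>n. t (s n)) \<longlonglongrightarrow> 0" if "inj s" for s :: "nat \<Rightarrow> int"
    using tendsto_norm_zero[OF fcoeff_tendsto_0[OF G that]]
    by - (rule tendsto_norm_zero_cancel, simp add: t_def norm_mult)
  have "(\<lambda>N. w x0 + (t (- int N - 1) - t (int N))) \<longlonglongrightarrow> w x0 + (0 - 0)"
    by (intro tendsto_intros t0) (auto simp: inj_on_def)
  then show ?thesis by (simp add: S)
qed

end

lemma zeta_sq: "(zeta a b l)\<^sup>2 = 1 + (freq a b l)\<^sup>2"
  by (simp add: zeta_def)

lemma zeta_ge_1: "1 \<le> zeta a b l"
  by (simp add: zeta_def)

lemma zeta_pos: "0 < zeta a b l"
  using zeta_ge_1[of a b l] by linarith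

context real_interval
begin

lemma sum_inverse_zeta_sq_bounded:
  "\<exists>K. \<forall>F. finite F \<longrightarrow> (\<Sum>l\<in>F. 1 / (zeta a b l)\<^sup>2) \<le> K"
proof -
  let ?f = "\<lambda>l. 1 / (zeta a b l)\<^sup>2"
  define c where "c = (2 * pi / (b - a))\<^sup>2"
  have c: "c > 0" using ab by (simp add: c_def)
  have sym: "?f (- l) = ?f l" for l by (simp add: zeta_sq freq_def)
  have summable: "summable (\<lambda>k. ?f (int k))"
  proof (rule summable_comparison_test')
    show "summable (\<lambda>k. inverse c * inverse (real k ^ 2))"
      by (intro summable_mult inverse_power_summable) simp
    fix k :: nat assume k: "1 \<le> k"
    have "c * (real k)\<^sup>2 \<le> (zeta a b (int k))\<^sup>2"
      by (simp add: zeta_sq c_def freq_def power_mult_distrib power_divide)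
    moreover have "0 < c * (real k)\<^sup>2" using c k by simp
    ultimately have "inverse ((zeta a b (int k))\<^sup>2) \<le> inverse (c * (real k)\<^sup>2)"
      by (rule le_imp_inverse_le)
    then show "norm (?f (int k)) \<le> inverse c * inverse (real k ^ 2)"
      by (simp add: inverse_eq_divide)
  qed
  have "sum ?f F \<le> 2 * (\<Sum>k. ?f (int k))" if F: "finite F" for F
  proof -
    define N where "N = Max (insert 0 ((\<lambda>l. nat \<bar>l\<bar>) ` F))"
    let ?A = "int ` {..N}" and ?B = "(\<lambda>k. - int k) ` {..N}"
    have "F \<subseteq> ?A \<union> ?B"
    proof
      fix l assume "l \<in> F"
      then have "nat \<bar>l\<bar> \<le> N" unfolding N_def using F by (intro Max_ge) auto
      then show "l \<in> ?A \<union> ?B"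
        by (cases "0 \<le> l") (auto intro!: image_eqI[of _ _ "nat \<bar>l\<bar>"])
    qed
    then have "sum ?f F \<le> sum ?f (?A \<union> ?B)" by (intro sum_mono2) auto
    also have "\<dots> \<le> sum ?f ?A + sum ?f ?B"
      by (subst sum.union_inter[symmetric]) (auto intro!: sum_nonneg)
    also have "\<dots> = 2 * (\<Sum>k\<le>N. ?f (int k))"
      by (simp add: sum.reindex inj_on_def sym)
    also have "(\<Sum>k\<le>N. ?f (int k)) \<le> (\<Sum>k. ?f (int k))"
      by (rule sum_le_suminf[OF summable]) auto
    finally show ?thesis by simp
  qed
  then show ?thesis by blast
qed

text \<open>
  The square of the norm of the embedding of \<open>H\<^sup>1\<close>, normed through Fourier coefficients, into the
  bounded functions.
\<close>

definition sobolev_const :: real where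
  "sobolev_const = (\<Sum>\<^sub>\<infinity>l. 1 / (zeta a b l)\<^sup>2)"

lemma sum_inverse_zeta_sq_le: 
  assumes "finite F" shows "(\<Sum>l\<in>F. 1 / (zeta a b l)\<^sup>2) \<le> sobolev_const"
  unfolding sobolev_const_def
proof (rule finite_sum_le_infsum)
  show "(\<lambda>l. 1 / (zeta a b l)\<^sup>2) summable_on UNIV"
    using sum_inverse_zeta_sq_bounded by (intro nonneg_bdd_above_summable_on) (auto simp: bdd_above_def)
qed (use assms in auto)

lemma sobolev_const_nonneg: "0 \<le> sobolev_const"
  using sum_inverse_zeta_sq_le[of "{}"] by simp

lemma sum_norm_sq_le_sobolev:
  assumes "finite F"
  shows "(\<Sum>l\<in>F. cmod (c l))\<^sup>2 \<le> sobolev_const * (\<Sum>l\<in>F. (zeta a b l)\<^sup>2 * (cmod (c l))\<^sup>2)"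
proof -
  have "(\<Sum>l\<in>F. cmod (c l)) = (\<Sum>l\<in>F. (1 / zeta a b l) * (zeta a b l * cmod (c l)))"
    using zeta_pos[of a b] by (intro sum.cong) (auto simp: less_imp_neq[symmetric])
  also have "\<dots>\<^sup>2 \<le> (\<Sum>l\<in>F. (1 / zeta a b l)\<^sup>2) * (\<Sum>l\<in>F. (zeta a b l * cmod (c l))\<^sup>2)"
    by (rule Cauchy_Schwarz_ineq_sum)
  also have "\<dots> \<le> sobolev_const * (\<Sum>l\<in>F. (zeta a b l * cmod (c l))\<^sup>2)"
    using sum_inverse_zeta_sq_le[OF assms]
    by (intro mult_right_mono) (auto simp: power_divide intro!: sum_nonneg)
  finally show ?thesis by (simp add: power_mult_distrib)
qed

lemma fourier_partial_sum_le:
  assumes "finite F" and "(\<Sum>l\<in>F. (zeta a b l)\<^sup>2 * (cmod (c l))\<^sup>2) \<le> Q"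
  shows "(cmod (\<Sum>l\<in>F. c l * fmode a b l x))\<^sup>2 \<le> sobolev_const * Q"
proof -
  have "cmod (\<Sum>l\<in>F. c l * fmode a b l x) \<le> (\<Sum>l\<in>F. cmod (c l))"
    by (rule order_trans[OF norm_sum]) (simp add: norm_mult)
  then have "(cmod (\<Sum>l\<in>F. c l * fmode a b l x))\<^sup>2 \<le> (\<Sum>l\<in>F. cmod (c l))\<^sup>2"
    by (intro power_mono) auto
  also note sum_norm_sq_le_sobolev[OF assms(1)]
  also have "sobolev_const * (\<Sum>l\<in>F. (zeta a b l)\<^sup>2 * (cmod (c l))\<^sup>2) \<le> sobolev_const * Q"
    by (intro mult_left_mono assms sobolev_const_nonneg)
  finally show ?thesis .
qed

text \<open>
  The Cauchy-Schwarz inequality bounds all partial sums of the Fourier series at \<open>x\<close>, and these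
  converge to \<open>w x\<close>.
\<close>

lemma sobolev_sup_bound:
  assumes w: "continuous_on {a..b} w" and x: "x \<in> {a<..<b}" and d: "w differentiable (at x)"
    and Q: "\<And>F. finite F \<Longrightarrow> (\<Sum>l\<in>F. (zeta a b l)\<^sup>2 * (cmod (fcoeff a b w l))\<^sup>2) \<le> Q"
  shows "(cmod (w x))\<^sup>2 \<le> sobolev_const * Q"
proof (rule tendsto_upperbound)
  show "(\<lambda>N. (cmod (\<Sum>l\<in>{-int N..int N}. fcoeff a b w l * fmode a b l x))\<^sup>2) \<longlonglongrightarrow> (cmod (w x))\<^sup>2"
    using d by (intro tendsto_intros fourier_converges[OF w x]) (auto simp: vector_derivative_works)
  show "\<forall>\<^sub>F N in sequentially. (cmod (\<Sum>l\<in>{-int N..int N}. fcoeff a b w l * fmode a b l x))\<^sup>2 \<le> sobolev_const * Q"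
    by (intro always_eventually allI fourier_partial_sum_le Q finite_atLeastAtMost_int)
qed simp

text \<open>
  Parseval's upper bound. The partial sums converge pointwise to \<open>w\<close> on the open interval and are uniformly
  bounded by the \<open>H\<^sup>1\<close> hypothesis. Dominated convergence therefore applies to the inner products
  of the partial sums with \<open>w\<close>, which are the partial sums of the squared coefficients.
\<close>

lemma mean_sq_le_fourier:
  assumes w: "continuous_on {a..b} w" and d: "\<And>x. x \<in> {a<..<b} \<Longrightarrow> w differentiable (at x)"
    and Q0: "\<And>F. finite F \<Longrightarrow> (\<Sum>l\<in>F. (cmod (fcoeff a b w l))\<^sup>2) \<le> Q0"
    and Q1: "\<And>F. finite F \<Longrightarrow> (\<Sum>l\<in>F. (zeta a b l)\<^sup>2 * (cmod (fcoeff a b w l))\<^sup>2) \<le> Q1"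
  shows "mean_sq a b w \<le> Q0"
proof -
  define c where "c = fcoeff a b w"
  define P where "P = (\<lambda>N x. \<Sum>l\<in>{-int N..int N}. c l * fmode a b l x)"
  have P: "continuous_on {a..b} (P N)" for N
    unfolding P_def by (intro continuous_intros)
  have Pw: "mean_inner a b (P N) w = of_real (\<Sum>l\<in>{-int N..int N}. (cmod (c l))\<^sup>2)" for N
  proof -
    have cl: "mean_inner a b (fmode a b l) w = cnj (c l)" for l
      using w by (simp add: c_def fcoeff_eq_mean_inner cnj_mean_inner)
    have "mean_inner a b (P N) w = (\<Sum>l\<in>{-int N..int N}. c l * mean_inner a b (fmode a b l) w)"
      unfolding P_def by (intro mean_inner_sum_left w continuous_intros) auto
    then show ?thesis unfolding cl by (simp add: complex_norm_square[symmetric])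
  qed
  have "(\<lambda>N. integral {a<..<b} (\<lambda>x. P N x * cnj (w x))) \<longlonglongrightarrow> integral {a<..<b} (\<lambda>x. w x * cnj (w x))"
  proof (rule dominated_convergence(2))
    show "(\<lambda>x. P N x * cnj (w x)) integrable_on {a<..<b}" for N
      unfolding integrable_on_open_interval_real by (intro inner_integrable P w)
    show "(\<lambda>x. sqrt (sobolev_const * Q1) * cmod (w x)) integrable_on {a<..<b}"
      unfolding integrable_on_open_interval_real by (intro integrable_continuous_real continuous_intros w)
    show "norm (P N x * cnj (w x)) \<le> sqrt (sobolev_const * Q1) * cmod (w x)" for N x
      using fourier_partial_sum_le[OF _ Q1, of "{-int N..int N}" x]
      by (auto simp: norm_mult P_def c_def intro!: mult_right_mono real_le_rsqrt)
    show "(\<lambda>N. P N x * cnj (w x)) \<longlonglongrightarrow> w x * cnj (w x)" if "x \<in> {a<..<b}" for x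
      unfolding P_def c_def using d[OF that]
      by (intro tendsto_intros fourier_converges[OF w that]) (auto simp: vector_derivative_works)
  qed
  then have "(\<lambda>N. mean_inner a b (P N) w) \<longlonglongrightarrow> mean_inner a b w w"
    unfolding mean_inner_def integral_open_interval_real using ab by (intro tendsto_intros) auto
  then have "(\<lambda>N. \<Sum>l\<in>{-int N..int N}. (cmod (c l))\<^sup>2) \<longlonglongrightarrow> mean_sq a b w"
    unfolding Pw mean_inner_self[OF w] by (simp only: tendsto_of_real_iff)
  then show ?thesis
    by (rule tendsto_upperbound) (simp_all add: c_def Q0 always_eventually)
qed

end

section \<open>Fourier coefficients of a classical solution\<close>

lemma integral_exhaustion:
  fixes f :: "real \<Rightarrow> complex"
  assumes f: "f integrable_on {a..b}" and ab: "a < b"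
    and c: "c \<longlonglongrightarrow> a" and d: "d \<longlonglongrightarrow> b"
    and cd: "\<And>n. a \<le> c n" "\<And>n. c n \<le> d n" "\<And>n. d n \<le> b"
  shows "(\<lambda>n. integral {c n..d n} f) \<longlonglongrightarrow> integral {a..b} f"
proof -
  let ?I = "\<lambda>x. integral {a..x} f"
  have cont: "continuous_on {a..b} ?I"
    by (rule indefinite_integral_continuous_1[OF f])
  have "(\<lambda>n. ?I (d n) - ?I (c n)) \<longlonglongrightarrow> ?I b - ?I a"
    by (intro tendsto_diff continuous_on_tendsto_compose[OF cont] c d)
       (use cd ab in \<open>auto intro!: always_eventually intro: order_trans less_imp_le\<close>)
  moreover have "?I (d n) - ?I (c n) = integral {c n..d n} f" for n
  proof -
    have "f integrable_on {a..d n}"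
      using cd(3)[of n] by (intro integrable_subinterval_real[OF f]) auto
    from Henstock_Kurzweil_Integration.integral_combine[OF cd(1,2) this] show ?thesis by (simp add: algebra_simps)
  qed
  ultimately show ?thesis by simp
qed

lemma continuous_on_swap_args:
  assumes "continuous_on (A \<times> B) (\<lambda>(x, t). w x t)"
  shows "continuous_on (B \<times> A) (\<lambda>(t, x). w x t)"
proof -
  have "continuous_on (B \<times> A) (\<lambda>p. (\<lambda>(x, t). w x t) (prod.swap p))"
    by (rule continuous_on_compose2[OF assms continuous_on_swap]) auto
  then show ?thesis by (simp add: case_prod_unfold)
qed

lemma continuous_on_slice:
  assumes "continuous_on (A \<times> B) (\<lambda>(x, t). w x t)" "t \<in> B"
  shows "continuous_on A (\<lambda>x. w x t)"
proof -
  have "continuous_on A (\<lambda>x. (\<lambda>(x, t). w x t) (x, t))"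
    by (rule continuous_on_compose2[OF assms(1)]) (use assms(2) in \<open>auto intro!: continuous_intros\<close>)
  then show ?thesis by simp
qed

context real_interval
begin

lemma continuous_on_fcoeff_param:
  assumes w: "continuous_on ({a..b} \<times> S) (\<lambda>(x, t). w x t)"
  shows "continuous_on S (\<lambda>t. fcoeff a b (\<lambda>x. w x t) l)"
proof -
  have "continuous_on (S \<times> cbox a b) (\<lambda>(t, x). w x t * cnj (fmode a b l x))"
    using continuous_on_swap_args[OF w] unfolding case_prod_unfold box_real
    by (intro continuous_intros continuous_on_compose2[OF continuous_on_fmode[of UNIV]]) auto
  from integral_continuous_on_param[OF this]
  have "continuous_on S (\<lambda>t. integral {a..b} (\<lambda>x. w x t * cnj (fmode a b l x)) / of_real (b - a))"
    using ab unfolding box_real by (intro continuous_intros) auto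
  then show ?thesis
    by (rule continuous_on_cong[THEN iffD1, rotated -1])
       (auto simp: fcoeff_eq_mean_inner[OF continuous_on_slice[OF w]] mean_inner_def)
qed

end

locale kg_solution = real_interval +
  fixes \<epsilon> :: real and \<phi> \<gamma> :: "real \<Rightarrow> real" and u :: "real \<Rightarrow> real \<Rightarrow> real"
  assumes sol: "nkge_solution a b \<epsilon> \<phi> \<gamma> u"
begin

definition u_hat :: "int \<Rightarrow> real \<Rightarrow> complex" where
  "u_hat l t = fcoeff a b (in_time u t) l"

definition ut_hat :: "int \<Rightarrow> real \<Rightarrow> complex" where
  "ut_hat l t = fcoeff a b (in_time (d_t u) t) l"

definition cube_hat :: "int \<Rightarrow> real \<Rightarrow> complex" where
  "cube_hat l t = fcoeff a b (\<lambda>x. in_time u t x ^ 3) l"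

definition utt_hat :: "int \<Rightarrow> real \<Rightarrow> complex" where
  "utt_hat l t = - (of_real ((zeta a b l)\<^sup>2) * u_hat l t + of_real (\<epsilon>\<^sup>2) * cube_hat l t)"

lemma cont_u: "continuous_on ({a..b} \<times> {0..}) (\<lambda>(x, t). u x t)"
  and cont_ut: "continuous_on ({a..b} \<times> {0..}) (\<lambda>(x, t). d_t u x t)"
  and cont_ux: "continuous_on ({a..b} \<times> {0..}) (\<lambda>(x, t). d_x a b u x t)"
  and cont_utt: "continuous_on ({a<..<b} \<times> {0<..}) (\<lambda>(x, t). d_t (d_t u) x t)"
  and cont_uxx: "continuous_on ({a<..<b} \<times> {0<..}) (\<lambda>(x, t). d_x a b (d_x a b u) x t)"
  using sol by (simp_all add: nkge_solution_def)

lemma u_periodic: "t \<ge> 0 \<Longrightarrow> u a t = u b t"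
  and ux_periodic: "t \<ge> 0 \<Longrightarrow> d_x a b u a t = d_x a b u b t"
  and u_init: "x \<in> {a..b} \<Longrightarrow> u x 0 = \<phi> x"
  and ut_init: "x \<in> {a..b} \<Longrightarrow> d_t u x 0 = \<gamma> x"
  using sol unfolding nkge_solution_def by blast+

lemma kg_equation:
  "x \<in> {a<..<b} \<Longrightarrow> t > 0 \<Longrightarrow>
    d_t (d_t u) x t = d_x a b (d_x a b u) x t - u x t - \<epsilon>\<^sup>2 * (u x t) ^ 3"
  using sol unfolding nkge_solution_def by (auto simp: algebra_simps)

lemma deriv_u_t:
  assumes "x \<in> {a..b}" "t \<ge> 0"
  shows "((\<lambda>s. u x s) has_vector_derivative d_t u x t) (at t within {0..})"
  using sol assms unfolding nkge_solution_def d_t_def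
  by (auto simp flip: vector_derivative_works)

lemma deriv_u_x:
  assumes "x \<in> {a..b}" "t \<ge> 0"
  shows "((\<lambda>y. u y t) has_vector_derivative d_x a b u x t) (at x within {a..b})"
  using sol assms unfolding nkge_solution_def d_x_def
  by (auto simp flip: vector_derivative_works)

lemma deriv_ut_t:
  assumes "x \<in> {a<..<b}" "t > 0"
  shows "((\<lambda>s. d_t u x s) has_vector_derivative d_t (d_t u) x t) (at t)"
proof -
  have "(\<lambda>s. d_t u x s) differentiable (at t)"
    using sol assms unfolding nkge_solution_def by blast
  moreover have "at t within {0..} = at t"
    using assms(2) by (intro at_within_interior) auto
  ultimately show ?thesis
    by (simp add: d_t_def[of "d_t u"] vector_derivative_works)
qed

lemma deriv_ux_x:
  assumes "x \<in> {a<..<b}" "t > 0"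
  shows "((\<lambda>y. d_x a b u y t) has_vector_derivative d_x a b (d_x a b u) x t) (at x)"
proof -
  have "(\<lambda>y. d_x a b u y t) differentiable (at x)"
    using sol assms unfolding nkge_solution_def by blast
  moreover have "at x within {a..b} = at x"
    using assms(1) by (intro at_within_interior) auto
  ultimately show ?thesis
    by (simp add: d_x_def[of a b "d_x a b u"] vector_derivative_works)
qed

lemma cont_in_time:
  "t \<ge> 0 \<Longrightarrow> continuous_on {a..b} (in_time u t)"
  "t \<ge> 0 \<Longrightarrow> continuous_on {a..b} (in_time (d_t u) t)"
  using continuous_on_slice[OF cont_u, of t] continuous_on_slice[OF cont_ut, of t]
  by (auto simp: in_time_def intro!: continuous_intros)

lemma continuous_on_u_hat: "continuous_on {0..} (u_hat l)"
  and continuous_on_ut_hat: "continuous_on {0..} (ut_hat l)"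
  and continuous_on_cube_hat: "continuous_on {0..} (cube_hat l)"
proof -
  show "continuous_on {0..} (u_hat l)"
    unfolding u_hat_def[abs_def] in_time_def
    by (intro continuous_on_fcoeff_param) (use cont_u in \<open>auto simp: case_prod_unfold intro!: continuous_intros\<close>)
  show "continuous_on {0..} (ut_hat l)"
    unfolding ut_hat_def[abs_def] in_time_def
    by (intro continuous_on_fcoeff_param) (use cont_ut in \<open>auto simp: case_prod_unfold intro!: continuous_intros\<close>)
  show "continuous_on {0..} (cube_hat l)"
    unfolding cube_hat_def[abs_def] in_time_def
    by (intro continuous_on_fcoeff_param) (use cont_u in \<open>auto simp: case_prod_unfold intro!: continuous_intros\<close>)
qed

lemma continuous_on_utt_hat: "continuous_on {0..} (utt_hat l)"
  unfolding utt_hat_def[abs_def]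
  by (intro continuous_intros continuous_on_u_hat continuous_on_cube_hat)

lemma u_hat_eq:
  "t \<ge> 0 \<Longrightarrow> u_hat l t = integral {a..b} (\<lambda>x. of_real (u x t) * cnj (fmode a b l x)) / of_real (b - a)"
  using fcoeff_eq_mean_inner[OF cont_in_time(1), of t l]
  by (simp add: u_hat_def mean_inner_def in_time_def)

lemma ut_hat_eq:
  "t \<ge> 0 \<Longrightarrow> ut_hat l t = integral {a..b} (\<lambda>x. of_real (d_t u x t) * cnj (fmode a b l x)) / of_real (b - a)"
  using fcoeff_eq_mean_inner[OF cont_in_time(2), of t l]
  by (simp add: ut_hat_def mean_inner_def in_time_def)

lemma cube_hat_eq:
  assumes "t \<ge> 0"
  shows "cube_hat l t = integral {a..b} (\<lambda>x. of_real (u x t) ^ 3 * cnj (fmode a b l x)) / of_real (b - a)"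
proof -
  have "continuous_on {a..b} (\<lambda>x. in_time u t x ^ 3)"
    by (intro continuous_intros cont_in_time assms)
  then show ?thesis
    by (simp add: cube_hat_def fcoeff_eq_mean_inner mean_inner_def in_time_def)
qed

lemma has_vector_derivative_u_hat:
  assumes "t > 0"
  shows "(u_hat l has_vector_derivative ut_hat l t) (at t)"
proof -
  let ?f = "\<lambda>t x. of_real (u x t) * cnj (fmode a b l x)"
  let ?f' = "\<lambda>t x. of_real (d_t u x t) * cnj (fmode a b l x)"
  have "((\<lambda>t. integral (cbox a b) (?f t)) has_vector_derivative integral (cbox a b) (?f' t)) (at t within {0..})"
  proof (rule leibniz_rule_vector_derivative)
    show "((\<lambda>t. ?f t x) has_vector_derivative ?f' t x) (at t within {0..})"
      if "t \<in> {0..}" "x \<in> cbox a b" for t x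
      using that deriv_u_t[of x t]
      by (intro has_vector_derivative_mult_left has_vector_derivative_of_real)
         (auto simp: has_real_derivative_iff_has_vector_derivative)
    show "?f t integrable_on cbox a b" if "t \<in> {0..}" for t
      using that continuous_on_slice[OF cont_u, of t] unfolding box_real
      by (intro integrable_continuous_real continuous_intros) auto
    show "continuous_on ({0..} \<times> cbox a b) (\<lambda>(t, x). ?f' t x)"
      using continuous_on_swap_args[OF cont_ut] unfolding case_prod_unfold box_real
      by (intro continuous_intros continuous_on_compose2[OF continuous_on_fmode[of UNIV]]) auto
  qed (use assms in auto)
  moreover have "at t within {0..} = at t"
    using assms by (intro at_within_interior) auto
  ultimately have "((\<lambda>t. integral {a..b} (?f t) / of_real (b - a)) has_vector_derivative
      integral {a..b} (?f' t) / of_real (b - a)) (at t)"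
    unfolding box_real by (intro has_vector_derivative_divide) auto
  then have "((\<lambda>t. integral {a..b} (?f t) / of_real (b - a)) has_vector_derivative ut_hat l t) (at t)"
    using assms by (simp add: ut_hat_eq)
  then show ?thesis
    by (rule has_vector_derivative_transform_within[where d=t])
       (use assms in \<open>auto simp: dist_real_def u_hat_eq\<close>)
qed

text \<open>
  The second derivatives of a classical solution are continuous only in the interior, and need not
  be integrable up to the boundary. Integrals over these shrinking inner intervals stand in for
  integrals over the whole interval.
\<close>

definition inner_left :: "nat \<Rightarrow> real" where "inner_left n = a + (b - a) / real (n + 3)"
definition inner_right :: "nat \<Rightarrow> real" where "inner_right n = b - (b - a) / real (n + 3)"

lemma inner_endpoints: "a < inner_left n" "inner_left n < inner_right n" "inner_right n < b"
proof -
  have "(b - a) / real (n + 3) \<le> (b - a) / 3"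
    using ab by (intro divide_left_mono) auto
  moreover have "(b - a) / real (n + 3) > 0" using ab by auto
  ultimately show "a < inner_left n" "inner_left n < inner_right n" "inner_right n < b"
    using ab unfolding inner_left_def inner_right_def by argo+
qed

lemma inner_endpoints_mem: "inner_left n \<in> {a..b}" "inner_right n \<in> {a..b}"
  using inner_endpoints[of n] by auto

lemma inner_endpoints_tendsto: "inner_left \<longlonglongrightarrow> a" "inner_right \<longlonglongrightarrow> b"
proof -
  have "(\<lambda>n. (b - a) / real n) \<longlonglongrightarrow> 0" by (rule lim_const_over_n)
  then have "(\<lambda>n. (b - a) / real (n + 3)) \<longlonglongrightarrow> 0" by (rule LIMSEQ_ignore_initial_segment)
  from tendsto_add[OF tendsto_const this, of a] tendsto_diff[OF tendsto_const this, of b]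
  show "inner_left \<longlonglongrightarrow> a" "inner_right \<longlonglongrightarrow> b"
    by (simp_all add: inner_left_def[abs_def] inner_right_def[abs_def])
qed

lemma inner_exhaustion:
  fixes f :: "real \<Rightarrow> complex"
  assumes "f integrable_on {a..b}"
  shows "(\<lambda>n. integral {inner_left n..inner_right n} f) \<longlonglongrightarrow> integral {a..b} f"
  by (rule integral_exhaustion[OF assms ab inner_endpoints_tendsto])
     (use inner_endpoints in \<open>auto intro: less_imp_le\<close>)

text \<open>
  The boundary term of two integrations by parts of \<open>u\<^sub>x\<^sub>x\<close> against a conjugate Fourier mode.
\<close>

definition flux :: "int \<Rightarrow> real \<Rightarrow> real \<Rightarrow> complex" where
  "flux l x t = of_real (d_x a b u x t) * cnj (fmode a b l x)
     + \<i> * of_real (freq a b l) * (of_real (u x t) * cnj (fmode a b l x))"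

definition lower_order :: "int \<Rightarrow> real \<Rightarrow> real \<Rightarrow> complex" where
  "lower_order l x t = (of_real ((zeta a b l)\<^sup>2) * of_real (u x t) + of_real (\<epsilon>\<^sup>2) * of_real (u x t) ^ 3) * cnj (fmode a b l x)"

definition inner_utt :: "int \<Rightarrow> nat \<Rightarrow> real \<Rightarrow> complex" where
  "inner_utt l n t = integral {inner_left n..inner_right n} (\<lambda>x. of_real (d_t (d_t u) x t) * cnj (fmode a b l x))"

lemma cont_flux: "continuous_on ({a..b} \<times> {0..}) (\<lambda>(x, t). flux l x t)"
  using cont_u cont_ux unfolding flux_def case_prod_unfold
  by (intro continuous_intros continuous_on_compose2[OF continuous_on_fmode[of UNIV]]) auto

lemma cont_lower_order: "continuous_on ({a..b} \<times> {0..}) (\<lambda>(x, t). lower_order l x t)"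
  using cont_u unfolding lower_order_def case_prod_unfold
  by (intro continuous_intros continuous_on_compose2[OF continuous_on_fmode[of UNIV]]) auto

lemma flux_periodic: "t \<ge> 0 \<Longrightarrow> flux l a t = flux l b t"
  using ab by (simp add: flux_def u_periodic ux_periodic)

lemma has_vector_derivative_cnj_fmode:
  "((\<lambda>x. cnj (fmode a b l x)) has_vector_derivative - (\<i> * of_real (freq a b l)) * cnj (fmode a b l x)) (at x within S)"
  using has_vector_derivative_cnj[OF has_vector_derivative_fmode[of a b l x S]] by simp

text \<open>
  The \<open>x\<close>-derivative of the flux is \<open>u\<^sub>x\<^sub>x + \<mu>\<^sup>2 u\<close> times the conjugate mode, and the equation turns this
  into \<open>u\<^sub>t\<^sub>t\<close> plus terms without derivatives.
\<close>

lemma inner_utt_eq: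
  assumes t: "t > 0"
  shows "inner_utt l n t = flux l (inner_right n) t - flux l (inner_left n) t
           - integral {inner_left n..inner_right n} (\<lambda>x. lower_order l x t)"
proof -
  let ?S = "{inner_left n..inner_right n}"
  have S: "?S \<subseteq> {a<..<b}" using inner_endpoints[of n] by auto
  have "((\<lambda>x. of_real (d_t (d_t u) x t) * cnj (fmode a b l x) + lower_order l x t) has_integral
      (flux l (inner_right n) t - flux l (inner_left n) t)) ?S"
  proof (rule fundamental_theorem_of_calculus)
    fix x assume "x \<in> ?S"
    then have x: "x \<in> {a<..<b}" using S by auto
    let ?e = "cnj (fmode a b l x)" and ?m = "\<i> * complex_of_real (freq a b l)"
    have ux: "((\<lambda>y. u y t) has_real_derivative d_x a b u x t) (at x)"
      using deriv_u_x[of x t] x t at_within_interior[of x "{a..b}"]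
      by (auto simp: has_real_derivative_iff_has_vector_derivative)
    have uxx: "((\<lambda>y. d_x a b u y t) has_real_derivative d_x a b (d_x a b u) x t) (at x)"
      using deriv_ux_x[OF x t] by (simp add: has_real_derivative_iff_has_vector_derivative)
    have "((\<lambda>x. flux l x t) has_vector_derivative
       ((of_real (d_x a b u x t) * (- ?m * ?e) + of_real (d_x a b (d_x a b u) x t) * ?e)
         + ?m * (of_real (u x t) * (- ?m * ?e) + of_real (d_x a b u x t) * ?e))) (at x)"
      unfolding flux_def
      by (intro has_vector_derivative_add has_vector_derivative_mult has_vector_derivative_mult_right
            has_vector_derivative_of_real has_vector_derivative_cnj_fmode ux uxx)
    also have "(of_real (d_x a b u x t) * (- ?m * ?e) + of_real (d_x a b (d_x a b u) x t) * ?e)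
         + ?m * (of_real (u x t) * (- ?m * ?e) + of_real (d_x a b u x t) * ?e)
        = of_real (d_t (d_t u) x t) * ?e + lower_order l x t"
    proof -
      have z: "complex_of_real ((zeta a b l)\<^sup>2) = 1 + of_real (freq a b l) * of_real (freq a b l)"
        unfolding zeta_sq by (simp add: power2_eq_square)
      show ?thesis
        unfolding kg_equation[OF x t] lower_order_def z
        by (simp add: algebra_simps)
    qed
    finally show "((\<lambda>x. flux l x t) has_vector_derivative
        of_real (d_t (d_t u) x t) * ?e + lower_order l x t) (at x within ?S)"
      by (rule has_vector_derivative_at_within)
  qed (use inner_endpoints[of n] in auto)
  moreover have "((\<lambda>x. lower_order l x t) has_integral integral ?S (\<lambda>x. lower_order l x t)) ?S"
    using inner_endpoints[of n] t
    by (intro integrable_integral integrable_continuous_real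
          continuous_on_subset[OF continuous_on_slice[OF cont_lower_order]]) auto
  ultimately have "((\<lambda>x. (of_real (d_t (d_t u) x t) * cnj (fmode a b l x) + lower_order l x t) - lower_order l x t) has_integral
      (flux l (inner_right n) t - flux l (inner_left n) t - integral ?S (\<lambda>x. lower_order l x t))) ?S"
    by (rule has_integral_diff)
  then show ?thesis
    unfolding inner_utt_def by (simp add: integral_unique)
qed

lemma integral_lower_order:
  assumes t: "t \<ge> 0"
  shows "integral {a..b} (\<lambda>x. lower_order l x t) = - of_real (b - a) * utt_hat l t"
proof -
  let ?e = "\<lambda>x. cnj (fmode a b l x)"
  have c: "continuous_on {a..b} (\<lambda>x. u x t)"
    using continuous_on_slice[OF cont_u, of t] t by auto
  have "integral {a..b} (\<lambda>x. lower_order l x t)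
     = integral {a..b} (\<lambda>x. of_real ((zeta a b l)\<^sup>2) * (of_real (u x t) * ?e x)
         + of_real (\<epsilon>\<^sup>2) * (of_real (u x t) ^ 3 * ?e x))"
    unfolding lower_order_def by (intro arg_cong[of _ _ "integral {a..b}"] ext) (simp add: algebra_simps)
  also have "\<dots> = of_real ((zeta a b l)\<^sup>2) * integral {a..b} (\<lambda>x. of_real (u x t) * ?e x)
      + of_real (\<epsilon>\<^sup>2) * integral {a..b} (\<lambda>x. of_real (u x t) ^ 3 * ?e x)"
    by (subst Henstock_Kurzweil_Integration.integral_add)
       (auto intro!: integrable_continuous_real continuous_intros c)
  also have "\<dots> = of_real ((zeta a b l)\<^sup>2) * (of_real (b - a) * u_hat l t)
      + of_real (\<epsilon>\<^sup>2) * (of_real (b - a) * cube_hat l t)"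
    using ab by (simp add: u_hat_eq[OF t] cube_hat_eq[OF t] del: of_real_diff)
  also have "\<dots> = - of_real (b - a) * utt_hat l t"
    by (simp only: utt_hat_def distrib_left mult_minus_left mult_minus_right minus_add_distrib minus_minus mult_ac)
  finally show ?thesis .
qed

text \<open>
  In the limit the boundary terms cancel by periodicity of \<open>u\<close> and \<open>u\<^sub>x\<close>, which are continuous up to the
  boundary.
\<close>

lemma inner_utt_tendsto:
  assumes t: "t > 0"
  shows "(\<lambda>n. inner_utt l n t) \<longlonglongrightarrow> of_real (b - a) * utt_hat l t"
proof -
  have c: "continuous_on {a..b} (\<lambda>x. flux l x t)" "continuous_on {a..b} (\<lambda>x. lower_order l x t)"
    using continuous_on_slice[OF cont_flux, of t] continuous_on_slice[OF cont_lower_order, of t] t by auto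
  have "(\<lambda>n. flux l (inner_right n) t - flux l (inner_left n) t
           - integral {inner_left n..inner_right n} (\<lambda>x. lower_order l x t))
      \<longlonglongrightarrow> flux l b t - flux l a t - integral {a..b} (\<lambda>x. lower_order l x t)"
    using ab inner_endpoints_mem
    by (intro tendsto_diff continuous_on_tendsto_compose[OF c(1)] inner_endpoints_tendsto
          inner_exhaustion integrable_continuous_real c(2))
       (auto intro!: always_eventually)
  then show ?thesis
    using t by (simp add: inner_utt_eq flux_periodic integral_lower_order del: of_real_diff)
qed

definition inner_ut :: "int \<Rightarrow> nat \<Rightarrow> real \<Rightarrow> complex" where
  "inner_ut l n t = integral {inner_left n..inner_right n} (\<lambda>x. of_real (d_t u x t) * cnj (fmode a b l x))"

lemma inner_ut_tendsto:
  assumes t: "t \<ge> 0"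
  shows "(\<lambda>n. inner_ut l n t) \<longlonglongrightarrow> of_real (b - a) * ut_hat l t"
proof -
  have "continuous_on {a..b} (\<lambda>x. d_t u x t)"
    using continuous_on_slice[OF cont_ut, of t] t by auto
  then have "(\<lambda>x. complex_of_real (d_t u x t) * cnj (fmode a b l x)) integrable_on {a..b}"
    by (intro integrable_continuous_real continuous_intros)
  from inner_exhaustion[OF this] show ?thesis
    using ab by (simp add: inner_ut_def ut_hat_eq[OF t] del: of_real_diff)
qed

lemma has_vector_derivative_inner_ut:
  assumes t: "t > 0"
  shows "(inner_ut l n has_vector_derivative inner_utt l n t) (at t)"
proof -
  let ?S = "{inner_left n..inner_right n}"
  have S: "?S \<subseteq> {a<..<b}" using inner_endpoints[of n] by auto
  let ?f = "\<lambda>t x. of_real (d_t u x t) * cnj (fmode a b l x)"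
  let ?f' = "\<lambda>t x. of_real (d_t (d_t u) x t) * cnj (fmode a b l x)"
  have "((\<lambda>t. integral (cbox (inner_left n) (inner_right n)) (?f t)) has_vector_derivative
      integral (cbox (inner_left n) (inner_right n)) (?f' t)) (at t within {0<..})"
  proof (rule leibniz_rule_vector_derivative)
    show "((\<lambda>t. ?f t x) has_vector_derivative ?f' t x) (at t within {0<..})"
      if "t \<in> {0<..}" "x \<in> cbox (inner_left n) (inner_right n)" for t x
    proof -
      have "x \<in> {a<..<b}" "t > 0" using that S by (auto simp: subset_eq)
      from has_vector_derivative_at_within[OF deriv_ut_t[OF this], of "{0<..}"] show ?thesis
        by (intro has_vector_derivative_mult_left has_vector_derivative_of_real)
           (simp add: has_real_derivative_iff_has_vector_derivative)
    qed
    show "?f t integrable_on cbox (inner_left n) (inner_right n)" if "t \<in> {0<..}" for t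
    proof -
      have "continuous_on ?S (\<lambda>x. d_t u x t)"
        by (rule continuous_on_subset[OF continuous_on_slice[OF cont_ut]])
           (use inner_endpoints[of n] that in auto)
      then show ?thesis
        unfolding box_real by (intro integrable_continuous_real continuous_intros)
    qed
    have "continuous_on (?S \<times> {0<..}) (\<lambda>(x, t). d_t (d_t u) x t)"
      by (rule continuous_on_subset[OF cont_utt]) (use S in auto)
    from continuous_on_swap_args[OF this]
    show "continuous_on ({0<..} \<times> cbox (inner_left n) (inner_right n)) (\<lambda>(t, x). ?f' t x)"
      unfolding case_prod_unfold box_real
      by (intro continuous_intros continuous_on_compose2[OF continuous_on_fmode[of UNIV]]) auto
  qed (use t in auto)
  moreover have "at t within {0<..} = at t"
    using t by (intro at_within_open) auto
  ultimately show ?thesis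
    unfolding box_real by (simp add: inner_ut_def[abs_def] inner_utt_def)
qed

lemma inner_utt_bounded:
  assumes "0 < t1"
  shows "\<exists>K. \<forall>n. \<forall>t\<in>{t1..t2}. cmod (inner_utt l n t) \<le> K"
proof -
  have bdd: "\<exists>K. \<forall>x\<in>{a..b}. \<forall>t\<in>{t1..t2}. cmod (w x t) \<le> K"
    if "continuous_on ({a..b} \<times> {0..}) (\<lambda>(x, t). w x t)" for w :: "real \<Rightarrow> real \<Rightarrow> complex"
  proof -
    have "compact ((\<lambda>(x, t). w x t) ` ({a..b} \<times> {t1..t2}))"
      by (intro compact_continuous_image continuous_on_subset[OF that] compact_Times) (use assms in auto)
    then have "bounded ((\<lambda>(x, t). w x t) ` ({a..b} \<times> {t1..t2}))" by (rule compact_imp_bounded)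
    then show ?thesis by (auto simp: bounded_iff)
  qed
  obtain K1 where K1: "\<And>x t. x \<in> {a..b} \<Longrightarrow> t \<in> {t1..t2} \<Longrightarrow> cmod (flux l x t) \<le> K1"
    using bdd[OF cont_flux] by blast
  obtain K2 where K2: "\<And>x t. x \<in> {a..b} \<Longrightarrow> t \<in> {t1..t2} \<Longrightarrow> cmod (lower_order l x t) \<le> K2"
    using bdd[OF cont_lower_order] by blast
  have "cmod (inner_utt l n t) \<le> K1 + K1 + K2 * (b - a)" if t: "t \<in> {t1..t2}" for n t
  proof -
    let ?S = "{inner_left n..inner_right n}"
    have t0: "t > 0" using t assms by auto
    have "continuous_on {a..b} (\<lambda>x. lower_order l x t)"
      using continuous_on_slice[OF cont_lower_order, of t] t0 by auto
    then have c: "continuous_on ?S (\<lambda>x. lower_order l x t)"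
      by (rule continuous_on_subset) (use inner_endpoints[of n] in auto)
    have K20: "0 \<le> K2" using K2[of a t] ab t norm_ge_zero[of "lower_order l a t"] by (simp del: norm_ge_zero)
    have "cmod (integral ?S (\<lambda>x. lower_order l x t)) \<le> K2 * (inner_right n - inner_left n)"
      using inner_endpoints[of n] t by (intro integral_bound c K2) auto
    also have "\<dots> \<le> K2 * (b - a)"
      using inner_endpoints[of n] K20 by (intro mult_left_mono) auto
    finally show ?thesis
      unfolding inner_utt_eq[OF t0]
      using K1[OF inner_endpoints_mem(1) t, of n] K1[OF inner_endpoints_mem(2) t, of n]
        norm_triangle_ineq4[of "flux l (inner_right n) t" "flux l (inner_left n) t"]
        norm_triangle_ineq4[of "flux l (inner_right n) t - flux l (inner_left n) t" "integral ?S (\<lambda>x. lower_order l x t)"]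
      by linarith
  qed
  then show ?thesis by blast
qed

text \<open>
  Integrate over time before the inner intervals exhaust \<open>(a, b)\<close>: the bound of
  \<open>inner_utt_bounded\<close> is uniform in \<open>n\<close>, so dominated convergence applies.
\<close>

lemma ut_hat_diff:
  assumes "0 < t1" "t1 \<le> t2"
  shows "ut_hat l t2 - ut_hat l t1 = integral {t1..t2} (utt_hat l)"
proof -
  have I: "(inner_utt l n has_integral (inner_ut l n t2 - inner_ut l n t1)) {t1..t2}" for n
    using assms
    by (intro fundamental_theorem_of_calculus has_vector_derivative_at_within[OF has_vector_derivative_inner_ut]) auto
  obtain K where K: "\<And>n t. t \<in> {t1..t2} \<Longrightarrow> cmod (inner_utt l n t) \<le> K"
    using inner_utt_bounded[OF assms(1), of t2 l] by blast
  have "(\<lambda>n. integral {t1..t2} (inner_utt l n)) \<longlonglongrightarrow> integral {t1..t2} (\<lambda>t. of_real (b - a) * utt_hat l t)"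
  proof (rule dominated_convergence(2)[where h="\<lambda>_. K"])
    show "inner_utt l n integrable_on {t1..t2}" for n using I by blast
    show "(\<lambda>n. inner_utt l n t) \<longlonglongrightarrow> of_real (b - a) * utt_hat l t" if "t \<in> {t1..t2}" for t
      using that assms by (intro inner_utt_tendsto) auto
  qed (use K in auto)
  then have "(\<lambda>n. inner_ut l n t2 - inner_ut l n t1) \<longlonglongrightarrow> integral {t1..t2} (\<lambda>t. of_real (b - a) * utt_hat l t)"
    unfolding integral_unique[OF I] .
  moreover have "(\<lambda>n. inner_ut l n t2 - inner_ut l n t1) \<longlonglongrightarrow> of_real (b - a) * ut_hat l t2 - of_real (b - a) * ut_hat l t1"
    using assms by (intro tendsto_diff inner_ut_tendsto) auto
  ultimately have "integral {t1..t2} (\<lambda>t. of_real (b - a) * utt_hat l t) = of_real (b - a) * ut_hat l t2 - of_real (b - a) * ut_hat l t1"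
    by (rule LIMSEQ_unique)
  then have "of_real (b - a) * integral {t1..t2} (utt_hat l) = of_real (b - a) * (ut_hat l t2 - ut_hat l t1)"
    by (simp only: right_diff_distrib Henstock_Kurzweil_Integration.integral_mult_right)
  then show ?thesis using ab by (subst (asm) mult_cancel_left) auto
qed

text \<open>
  With this every Fourier coefficient is a forced harmonic oscillator in the classical sense, for all
  positive times.
\<close>

lemma has_vector_derivative_ut_hat:
  assumes t: "t > 0"
  shows "(ut_hat l has_vector_derivative utt_hat l t) (at t)"
proof -
  let ?I = "{t / 2..2 * t}"
  have "continuous_on ?I (utt_hat l)"
    by (rule continuous_on_subset[OF continuous_on_utt_hat]) (use t in auto)
  from integral_has_vector_derivative[OF this, of t]
  have "((\<lambda>s. integral {t / 2..s} (utt_hat l)) has_vector_derivative utt_hat l t) (at t within ?I)"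
    using t by auto
  moreover have "at t within ?I = at t"
    using t by (intro at_within_interior) auto
  ultimately have "((\<lambda>s. ut_hat l (t / 2) + integral {t / 2..s} (utt_hat l)) has_vector_derivative 0 + utt_hat l t) (at t)"
    by (intro has_vector_derivative_add has_vector_derivative_const) auto
  then have "((\<lambda>s. ut_hat l (t / 2) + integral {t / 2..s} (utt_hat l)) has_vector_derivative utt_hat l t) (at t)"
    by simp
  then show ?thesis
  proof (rule has_vector_derivative_transform_within)
    show "ut_hat l (t / 2) + integral {t / 2..s} (utt_hat l) = ut_hat l s" if "dist s t < t / 2" for s
    proof -
      have "t / 2 \<le> s" using that by (auto simp: dist_real_def abs_if split: if_splits)
      from ut_hat_diff[OF _ this, of l] t show ?thesis by (simp add: algebra_simps)
    qed
  qed (use t in auto)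
qed

text \<open>
  Identifies the coefficient of \<open>u\<^sub>t\<^sub>t\<close>, which the Sobolev bound on \<open>u\<^sub>t\<^sub>t\<close> is about, with the
  right-hand side of the oscillator equation.
\<close>

lemma fcoeff_utt:
  assumes t: "t > 0" and int: "integrable (lebesgue_on {a<..<b}) (in_time (d_t (d_t u)) t)"
  shows "fcoeff a b (in_time (d_t (d_t u)) t) l = utt_hat l t"
proof -
  let ?f = "\<lambda>x. complex_of_real (d_t (d_t u) x t) * cnj (fmode a b l x)"
  have f: "integrable (lebesgue_on {a<..<b}) ?f"
  proof (rule Bochner_Integration.integrable_bound[OF int])
    have "(\<lambda>x. cnj (fmode a b l x)) \<in> borel_measurable (lebesgue_on {a<..<b})"
      by (intro continuous_imp_measurable_on_sets_lebesgue continuous_intros) auto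
    moreover have "(\<lambda>x. complex_of_real (d_t (d_t u) x t)) \<in> borel_measurable (lebesgue_on {a<..<b})"
      using borel_measurable_integrable[OF int] by (simp add: in_time_def)
    ultimately show "?f \<in> borel_measurable (lebesgue_on {a<..<b})"
      by (rule borel_measurable_times[rotated])
  qed (auto simp: in_time_def norm_mult)
  have hi: "(?f has_integral (LINT x|lebesgue_on {a<..<b}. ?f x)) {a..b}"
    using has_integral_integral_lebesgue_on[OF f] by (simp add: has_integral_Icc_iff_Ioo)
  then have "?f integrable_on {a..b}" by blast
  from inner_exhaustion[OF this]
  have "(\<lambda>n. inner_utt l n t) \<longlonglongrightarrow> integral {a..b} ?f"
    by (simp add: inner_utt_def)
  from LIMSEQ_unique[OF this inner_utt_tendsto[OF t]]
  have "(LINT x|lebesgue_on {a<..<b}. ?f x) = of_real (b - a) * utt_hat l t"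
    using integral_unique[OF hi] by simp
  then show ?thesis
    using ab unfolding fcoeff_def fcoeff_eq_integrand unfolding in_time_def by simp
qed

end

section \<open>Variation of constants for families of modes\<close>

text \<open>
  The mean value inequality for curves in \<open>\<ell>\<^sup>2\<close>: apply the scalar mean value theorem to the inner product
  of the curve with its total increment. It replaces every estimate of a time integral below.
\<close>

lemma sum_sq_increment_le:
  fixes H :: "'i \<Rightarrow> real \<Rightarrow> complex"
  assumes pq: "p \<le> q" and B: "0 \<le> B"
    and cont: "\<And>l. l \<in> F \<Longrightarrow> continuous_on {p..q} (H l)"
    and der: "\<And>l s. l \<in> F \<Longrightarrow> s \<in> {p<..<q} \<Longrightarrow> (H l has_vector_derivative H' l s) (at s)"
    and bound: "\<And>s. s \<in> {p<..<q} \<Longrightarrow> (\<Sum>l\<in>F. (cmod (H' l s))\<^sup>2) \<le> B\<^sup>2"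
  shows "(\<Sum>l\<in>F. (cmod (H l q - H l p))\<^sup>2) \<le> ((q - p) * B)\<^sup>2"
proof (cases "p = q")
  case False
  define D where "D = (\<lambda>l. H l q - H l p)"
  define N where "N = (\<Sum>l\<in>F. (cmod (D l))\<^sup>2)"
  define h where "h = (\<lambda>s. \<Sum>l\<in>F. cnj (D l) * H l s)"
  define h' where "h' = (\<lambda>s. \<Sum>l\<in>F. cnj (D l) * H' l s)"
  have N0: "0 \<le> N" by (simp add: N_def sum_nonneg)
  have "\<exists>s\<in>{p<..<q}. norm (h q - h p) \<le> norm ((\<lambda>x. x *\<^sub>R h' s) (q - p))"
  proof (rule mvt_general)
    show "continuous_on {p..q} h"
      unfolding h_def by (intro continuous_intros cont)
    show "(h has_derivative (\<lambda>x. x *\<^sub>R h' s)) (at s)" if "p < s" "s < q" for s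
    proof -
      have "(h has_vector_derivative h' s) (at s)"
        unfolding h_def h'_def using that
        by (intro has_vector_derivative_sum has_vector_derivative_mult_right der) auto
      then show ?thesis by (simp add: has_vector_derivative_def)
    qed
  qed (use False pq in auto)
  then obtain s where s: "s \<in> {p<..<q}" and le: "norm (h q - h p) \<le> (q - p) * norm (h' s)"
    using pq by auto
  have "h q - h p = of_real N"
    unfolding h_def N_def of_real_sum complex_norm_square sum_subtractf[symmetric]
    by (intro sum.cong refl) (simp add: D_def algebra_simps)
  with le N0 have N1: "N \<le> (q - p) * norm (h' s)" by simp
  have "norm (h' s) \<le> (\<Sum>l\<in>F. cmod (D l) * cmod (H' l s))"
    unfolding h'_def by (rule order_trans[OF norm_sum]) (simp add: norm_mult)
  then have "(norm (h' s))\<^sup>2 \<le> (\<Sum>l\<in>F. cmod (D l) * cmod (H' l s))\<^sup>2"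
    by (intro power_mono) auto
  also have "\<dots> \<le> N * (\<Sum>l\<in>F. (cmod (H' l s))\<^sup>2)"
    unfolding N_def by (rule Cauchy_Schwarz_ineq_sum)
  also have "\<dots> \<le> N * B\<^sup>2"
    by (intro mult_left_mono bound s N0)
  finally have h': "(norm (h' s))\<^sup>2 \<le> N * B\<^sup>2" .
  \<comment> \<open>Both sides of the mean value inequality contain \<open>N\<close>, the sum to be bounded; it is divided out.\<close>
  have "N * N \<le> ((q - p) * norm (h' s))\<^sup>2"
    using power_mono[OF N1 N0, of 2] by (simp add: power2_eq_square)
  also have "\<dots> \<le> (q - p)\<^sup>2 * (N * B\<^sup>2)"
    unfolding power_mult_distrib by (intro mult_left_mono h') auto
  finally have "N * N \<le> N * ((q - p) * B)\<^sup>2"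
    by (simp add: power_mult_distrib mult_ac)
  then have "N \<le> ((q - p) * B)\<^sup>2"
    using N0 by (cases "N = 0") (simp_all add: mult_le_cancel_left)
  then show ?thesis by (simp add: N_def D_def)
qed simp

lemma abs_sin_div_le:
  assumes "z > 0" "r \<ge> 0"
  shows "\<bar>sin (z * r) / z\<bar> \<le> (r::real)"
proof -
  have "\<bar>sin (z * r)\<bar> \<le> z * r" using abs_sin_x_le_abs_x[of "z * r"] assms by simp
  then show ?thesis using assms by (simp add: divide_le_eq mult.commute)
qed

context real_interval
begin

text \<open>
  The curve \<open>sin (\<zeta> (\<tau> - s)) / \<zeta> \<cdot> y' s + cos (\<zeta> (\<tau> - s)) \<cdot> (y s + k)\<close> interpolates between the two sides of
  the variation of constants formula. Its derivative is the forcing times a sine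
  kernel of size at most \<open>\<tau>\<close>. Shifting \<open>y\<close> by the constant \<open>k = \<epsilon>\<^sup>2 c / \<zeta>\<^sup>2\<close> subtracts the frozen value \<open>c\<close> from
  the forcing and produces the coefficient \<open>r\<close> of the scheme.
\<close>

lemma duhamel_l2:
  fixes y y' g :: "int \<Rightarrow> real \<Rightarrow> complex"
  assumes \<tau>: "\<tau> > 0" and D: "0 \<le> D"
    and cont: "\<And>l. continuous_on {0..\<tau>} (y l)" "\<And>l. continuous_on {0..\<tau>} (y' l)"
    and der: "\<And>l s. s \<in> {0<..<\<tau>} \<Longrightarrow> (y l has_vector_derivative y' l s) (at s)"
    and der': "\<And>l s. s \<in> {0<..<\<tau>} \<Longrightarrow> (y' l has_vector_derivative
       - (of_real ((zeta a b l)\<^sup>2) * y l s + of_real (\<epsilon>\<^sup>2) * g l s)) (at s)"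
    and bound: "\<And>s. s \<in> {0<..<\<tau>} \<Longrightarrow> (\<Sum>l\<in>F. (cmod (g l s - c l))\<^sup>2) \<le> D\<^sup>2"
  shows "(\<Sum>l\<in>F. (cmod (y l \<tau> - p_coef a b \<tau> l * y l 0 - q_coef a b \<tau> l * y' l 0
            - r_coef a b \<epsilon> \<tau> l * c l))\<^sup>2) \<le> (\<tau> * (\<tau> * \<epsilon>\<^sup>2 * D))\<^sup>2"
proof -
  define S where "S = (\<lambda>l s. complex_of_real (sin (zeta a b l * (\<tau> - s)) / zeta a b l))"
  define C where "C = (\<lambda>l s. complex_of_real (cos (zeta a b l * (\<tau> - s))))"
  define k where "k = (\<lambda>l. complex_of_real (\<epsilon>\<^sup>2 / (zeta a b l)\<^sup>2) * c l)"
  define H where "H = (\<lambda>l s. S l s * y' l s + C l s * (y l s + k l))"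
  define H' where "H' = (\<lambda>l s. - (S l s * (of_real (\<epsilon>\<^sup>2) * (g l s - c l))))"
  have z: "zeta a b l > 0" for l by (rule zeta_pos)
  have dS: "(S l has_vector_derivative - C l s) (at s)" for l s
  proof -
    have "((\<lambda>s. sin (zeta a b l * (\<tau> - s)) / zeta a b l) has_real_derivative - cos (zeta a b l * (\<tau> - s))) (at s)"
      using z[of l] by (auto intro!: derivative_eq_intros)
    then show ?thesis
      unfolding S_def C_def of_real_minus[symmetric] by (rule has_vector_derivative_of_real)
  qed
  have dC: "(C l has_vector_derivative of_real ((zeta a b l)\<^sup>2) * S l s) (at s)" for l s
  proof -
    have "((\<lambda>s. cos (zeta a b l * (\<tau> - s))) has_real_derivative (zeta a b l)\<^sup>2 * (sin (zeta a b l * (\<tau> - s)) / zeta a b l)) (at s)"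
      using z[of l] by (auto intro!: derivative_eq_intros simp: power2_eq_square)
    then show ?thesis
      unfolding S_def C_def of_real_mult[symmetric] by (rule has_vector_derivative_of_real)
  qed
  have zk: "of_real ((zeta a b l)\<^sup>2) * k l = of_real (\<epsilon>\<^sup>2) * c l" for l
    using z[of l] by (simp add: k_def)
  have "(\<Sum>l\<in>F. (cmod (H l \<tau> - H l 0))\<^sup>2) \<le> ((\<tau> - 0) * (\<tau> * \<epsilon>\<^sup>2 * D))\<^sup>2"
  proof (rule sum_sq_increment_le)
    show "continuous_on {0..\<tau>} (H l)" for l
      unfolding H_def
      by (intro continuous_intros cont)
         (auto intro!: continuous_at_imp_continuous_on has_vector_derivative_continuous[OF dS]
            has_vector_derivative_continuous[OF dC])
    show "(H l has_vector_derivative H' l s) (at s)" if s: "s \<in> {0<..<\<tau>}" for l s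
    proof -
      have "(H l has_vector_derivative
         (S l s * - (of_real ((zeta a b l)\<^sup>2) * y l s + of_real (\<epsilon>\<^sup>2) * g l s) + (- C l s) * y' l s)
         + (C l s * (y' l s + 0) + (of_real ((zeta a b l)\<^sup>2) * S l s) * (y l s + k l))) (at s)"
        unfolding H_def
        by (intro has_vector_derivative_add has_vector_derivative_mult has_vector_derivative_const
              dS dC der[OF s] der'[OF s])
      also have "(S l s * - (of_real ((zeta a b l)\<^sup>2) * y l s + of_real (\<epsilon>\<^sup>2) * g l s) + (- C l s) * y' l s)
         + (C l s * (y' l s + 0) + (of_real ((zeta a b l)\<^sup>2) * S l s) * (y l s + k l))
         = S l s * (of_real ((zeta a b l)\<^sup>2) * k l - of_real (\<epsilon>\<^sup>2) * g l s)"
        by (simp add: algebra_simps)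
      also have "\<dots> = H' l s"
        unfolding zk H'_def by (simp add: algebra_simps)
      finally show ?thesis .
    qed
    show "(\<Sum>l\<in>F. (cmod (H' l s))\<^sup>2) \<le> (\<tau> * \<epsilon>\<^sup>2 * D)\<^sup>2" if s: "s \<in> {0<..<\<tau>}" for s
    proof -
      have "(cmod (H' l s))\<^sup>2 \<le> (\<tau> * \<epsilon>\<^sup>2)\<^sup>2 * (cmod (g l s - c l))\<^sup>2" for l
      proof -
        have "cmod (S l s) \<le> \<tau> - s"
          using abs_sin_div_le[OF z, of "\<tau> - s" l] s unfolding S_def norm_of_real by simp
        then have "cmod (S l s) \<le> \<tau>" using s by simp
        then have "cmod (H' l s) \<le> \<tau> * (\<epsilon>\<^sup>2 * cmod (g l s - c l))"
          unfolding H'_def norm_minus_cancel norm_mult norm_of_real using \<tau> by (intro mult_mono) auto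
        then have "(cmod (H' l s))\<^sup>2 \<le> (\<tau> * (\<epsilon>\<^sup>2 * cmod (g l s - c l)))\<^sup>2"
          by (intro power_mono) auto
        then show ?thesis by (simp add: power_mult_distrib mult.assoc)
      qed
      then have "(\<Sum>l\<in>F. (cmod (H' l s))\<^sup>2) \<le> (\<Sum>l\<in>F. (\<tau> * \<epsilon>\<^sup>2)\<^sup>2 * (cmod (g l s - c l))\<^sup>2)"
        by (rule sum_mono)
      also have "\<dots> \<le> (\<tau> * \<epsilon>\<^sup>2)\<^sup>2 * D\<^sup>2"
        unfolding sum_distrib_left[symmetric] by (intro mult_left_mono bound s) auto
      finally show ?thesis by (simp add: power_mult_distrib)
    qed
  qed (use \<tau> D in auto)
  moreover have "H l \<tau> - H l 0 = y l \<tau> - p_coef a b \<tau> l * y l 0 - q_coef a b \<tau> l * y' l 0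
            - r_coef a b \<epsilon> \<tau> l * c l" for l
  proof -
    have "S l \<tau> = 0" "C l \<tau> = 1" by (simp_all add: S_def C_def)
    moreover have "S l 0 = q_coef a b \<tau> l" "C l 0 = p_coef a b \<tau> l"
      by (simp_all add: S_def C_def q_coef_def p_coef_def mult.commute)
    moreover have "r_coef a b \<epsilon> \<tau> l * c l = (p_coef a b \<tau> l - 1) * k l"
      by (simp add: r_coef_def p_coef_def k_def)
    ultimately show ?thesis unfolding H_def by (simp add: algebra_simps)
  qed
  ultimately show ?thesis by simp
qed

end

section \<open>Regularity in time and the defect of the integrator\<close>

lemma norm_add_sq_le: "(cmod (x + y))\<^sup>2 \<le> 2 * (cmod x)\<^sup>2 + 2 * (cmod y)\<^sup>2"
proof -
  have "(cmod (x + y))\<^sup>2 \<le> (cmod x + cmod y)\<^sup>2"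
    by (intro power_mono norm_triangle_ineq) auto
  also have "\<dots> \<le> 2 * (cmod x)\<^sup>2 + 2 * (cmod y)\<^sup>2"
    using zero_le_power2[of "cmod x - cmod y"] by (simp add: power2_eq_square algebra_simps)
  finally show ?thesis .
qed

lemma norm_diff_sq_le: "(cmod (x - y))\<^sup>2 \<le> 2 * (cmod x)\<^sup>2 + 2 * (cmod y)\<^sup>2"
  using norm_add_sq_le[of x "- y"] by simp

lemma weighted_norm: "(cmod (of_real (zeta a b l) * z))\<^sup>2 = (zeta a b l)\<^sup>2 * (cmod z)\<^sup>2"
  by (simp add: norm_mult power_mult_distrib)

lemma unweighted_le_weighted: "(\<Sum>l\<in>F. (cmod (c l))\<^sup>2) \<le> (\<Sum>l\<in>F. (zeta a b l)\<^sup>2 * (cmod (c l))\<^sup>2)"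
proof (rule sum_mono)
  fix l have "1 * (cmod (c l))\<^sup>2 \<le> (zeta a b l)\<^sup>2 * (cmod (c l))\<^sup>2"
    by (intro mult_right_mono) (auto simp: zeta_sq)
  then show "(cmod (c l))\<^sup>2 \<le> (zeta a b l)\<^sup>2 * (cmod (c l))\<^sup>2" by simp
qed

lemma deriv_shift:
  assumes "\<And>t. t > 0 \<Longrightarrow> (f has_vector_derivative f' t) (at t)"
  shows "t + s > 0 \<Longrightarrow> ((\<lambda>s. f (t + s)) has_vector_derivative f' (t + s)) (at s)"
    and "t - s > 0 \<Longrightarrow> ((\<lambda>s. f (t - s)) has_vector_derivative - f' (t - s)) (at s)"
proof -
  assume "t + s > 0"
  have "((f \<circ> (\<lambda>s. t + s)) has_vector_derivative (1 *\<^sub>R f' (t + s))) (at s)"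
    by (rule vector_diff_chain_at) (use assms \<open>t + s > 0\<close> in \<open>auto intro!: derivative_eq_intros\<close>)
  then show "((\<lambda>s. f (t + s)) has_vector_derivative f' (t + s)) (at s)" by (simp add: o_def)
next
  assume "t - s > 0"
  have "((f \<circ> (\<lambda>s. t - s)) has_vector_derivative (- 1) *\<^sub>R f' (t - s)) (at s)"
    by (rule vector_diff_chain_at) (use assms \<open>t - s > 0\<close> in \<open>auto intro!: derivative_eq_intros\<close>)
  then show "((\<lambda>s. f (t - s)) has_vector_derivative - f' (t - s)) (at s)" by (simp add: o_def)
qed

lemma cont_shift:
  fixes f :: "real \<Rightarrow> complex"
  assumes "continuous_on {0..} f"
  shows "0 \<le> t \<Longrightarrow> continuous_on {0..\<tau>} (\<lambda>s. f (t + s))"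
    and "\<tau> \<le> t \<Longrightarrow> continuous_on {0..\<tau>} (\<lambda>s. f (t - s))"
  by (auto intro!: continuous_on_compose2[OF assms] continuous_intros)

text \<open>
  With \<open>D = P - A\<close> and \<open>E = Q - A\<close>, the terms linear and cubic in \<open>D, E\<close> contain the factor \<open>D + E\<close>, the second
  difference, and the quadratic ones are products of two first differences.
\<close>

lemma cube_second_increment_pointwise:
  fixes A P Q r k s :: real
  assumes A: "\<bar>A\<bar> \<le> r" and P: "\<bar>P\<bar> \<le> r" and Q: "\<bar>Q\<bar> \<le> r"
    and PA: "\<bar>P - A\<bar> \<le> k * s" and QA: "\<bar>Q - A\<bar> \<le> k * s" and s: "0 \<le> s"
  shows "\<bar>P ^ 3 - 2 * A ^ 3 + Q ^ 3\<bar> \<le> 15 * r\<^sup>2 * \<bar>P - 2 * A + Q\<bar> + 6 * r * k\<^sup>2 * s\<^sup>2"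
proof -
  define D E where "D = P - A" and "E = Q - A"
  have r: "0 \<le> r" using A by linarith
  have DU: "\<bar>D\<bar> \<le> 2 * r" "\<bar>E\<bar> \<le> 2 * r" using A P Q by (auto simp: D_def E_def)
  have "P ^ 3 - 2 * A ^ 3 + Q ^ 3 = (3 * A\<^sup>2 + (D\<^sup>2 - D * E + E\<^sup>2)) * (P - 2 * A + Q) + 3 * A * (D\<^sup>2 + E\<^sup>2)"
    unfolding D_def E_def by algebra
  also have "\<bar>\<dots>\<bar> \<le> \<bar>3 * A\<^sup>2 + (D\<^sup>2 - D * E + E\<^sup>2)\<bar> * \<bar>P - 2 * A + Q\<bar> + 3 * \<bar>A\<bar> * (D\<^sup>2 + E\<^sup>2)"
    by (rule order_trans[OF abs_triangle_ineq]) (simp add: abs_mult)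
  also have "\<dots> \<le> 15 * r\<^sup>2 * \<bar>P - 2 * A + Q\<bar> + 3 * r * ((k * s)\<^sup>2 + (k * s)\<^sup>2)"
  proof (intro add_mono mult_mono)
    have "A\<^sup>2 \<le> r\<^sup>2" "D\<^sup>2 \<le> (2 * r)\<^sup>2" "E\<^sup>2 \<le> (2 * r)\<^sup>2"
      unfolding abs_le_square_iff[symmetric] using A DU r by simp_all
    moreover have "\<bar>D * E\<bar> \<le> (2 * r) * (2 * r)"
      unfolding abs_mult using DU by (intro mult_mono) auto
    moreover have "(2 * r)\<^sup>2 = 4 * r\<^sup>2" "(2 * r) * (2 * r) = 4 * r\<^sup>2"
      by (simp_all add: power2_eq_square)
    ultimately show "\<bar>3 * A\<^sup>2 + (D\<^sup>2 - D * E + E\<^sup>2)\<bar> \<le> 15 * r\<^sup>2"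
      using zero_le_power2[of A] zero_le_power2[of D] zero_le_power2[of E] by linarith
    show "D\<^sup>2 \<le> (k * s)\<^sup>2" "E\<^sup>2 \<le> (k * s)\<^sup>2"
      using PA QA by (auto simp: D_def E_def abs_le_square_iff[symmetric] simp del: power_mult_distrib)
  qed (use A r in auto)
  finally show ?thesis by (simp add: power_mult_distrib algebra_simps)
qed

lemma cube_increment_pointwise:
  fixes A P r k s :: real
  assumes "\<bar>A\<bar> \<le> r" "\<bar>P\<bar> \<le> r" "\<bar>P - A\<bar> \<le> k * s"
  shows "\<bar>P ^ 3 - A ^ 3\<bar> \<le> 3 * r\<^sup>2 * k * s"
proof -
  have r: "0 \<le> r" using assms(1) by linarith
  have "P ^ 3 - A ^ 3 = (P\<^sup>2 + P * A + A\<^sup>2) * (P - A)" by algebra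
  also have "\<bar>\<dots>\<bar> \<le> (3 * r\<^sup>2) * (k * s)"
    unfolding abs_mult
  proof (intro mult_mono assms(3))
    have "P\<^sup>2 \<le> r\<^sup>2" "A\<^sup>2 \<le> r\<^sup>2" "\<bar>P * A\<bar> \<le> r * r"
      unfolding abs_mult using assms r by (auto simp: abs_le_square_iff[symmetric] intro!: mult_mono)
    then show "\<bar>P\<^sup>2 + P * A + A\<^sup>2\<bar> \<le> 3 * r\<^sup>2"
      using zero_le_power2[of A] zero_le_power2[of P] unfolding power2_eq_square by linarith
  qed (use r in auto)
  finally show ?thesis by (simp add: mult.assoc)
qed

text \<open>
  Sobolev bounds on all finite partial sums at every time. The length \<open>\<delta>\<close> fits twice into the time
  interval, so that from each time a step \<open>\<delta>\<close> forwards or backwards stays inside. It is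
  going to be the same for all \<open>\<epsilon>\<close>, which makes the constants below independent of \<open>\<epsilon>\<close>.
\<close>

locale kg_regular = kg_solution +
  fixes T B \<delta> :: real
  assumes \<delta>: "0 < \<delta>" "2 * \<delta> \<le> T" and B: "0 \<le> B"
    and u_H1: "t \<in> {0..T} \<Longrightarrow> finite F \<Longrightarrow> (\<Sum>l\<in>F. (zeta a b l)\<^sup>2 * (cmod (u_hat l t))\<^sup>2) \<le> B\<^sup>2"
    and utt_H1: "t \<in> {0..T} \<Longrightarrow> finite F \<Longrightarrow> (\<Sum>l\<in>F. (zeta a b l)\<^sup>2 * (cmod (utt_hat l t))\<^sup>2) \<le> B\<^sup>2"
begin

lemma weighted_increment_le:
  assumes pq: "p \<le> q" "0 \<le> K"
    and cont: "\<And>l. continuous_on {p..q} (H l)"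
    and der: "\<And>l s. s \<in> {p<..<q} \<Longrightarrow> (H l has_vector_derivative H' l s) (at s)"
    and bound: "\<And>s. s \<in> {p<..<q} \<Longrightarrow> (\<Sum>l\<in>F. (zeta a b l)\<^sup>2 * (cmod (H' l s))\<^sup>2) \<le> K\<^sup>2"
  shows "(\<Sum>l\<in>F. (zeta a b l)\<^sup>2 * (cmod (H l q - H l p))\<^sup>2) \<le> ((q - p) * K)\<^sup>2"
proof -
  have "(\<Sum>l\<in>F. (cmod (of_real (zeta a b l) * H l q - of_real (zeta a b l) * H l p))\<^sup>2) \<le> ((q - p) * K)\<^sup>2"
    using pq bound
    by (intro sum_sq_increment_le[where H'="\<lambda>l s. of_real (zeta a b l) * H' l s"])
       (auto simp: weighted_norm intro!: continuous_intros cont has_vector_derivative_mult_right der)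
  then show ?thesis unfolding right_diff_distrib[symmetric] weighted_norm .
qed

lemma ut_increment:
  assumes "0 \<le> p" "p \<le> q" "q \<le> T" "finite F"
  shows "(\<Sum>l\<in>F. (zeta a b l)\<^sup>2 * (cmod (ut_hat l q - ut_hat l p))\<^sup>2) \<le> ((q - p) * B)\<^sup>2"
proof (rule weighted_increment_le)
  show "continuous_on {p..q} (ut_hat l)" for l
    using assms by (intro continuous_on_subset[OF continuous_on_ut_hat]) auto
  show "(ut_hat l has_vector_derivative utt_hat l s) (at s)" if "s \<in> {p<..<q}" for l s
    using assms that by (intro has_vector_derivative_ut_hat) auto
  show "(\<Sum>l\<in>F. (zeta a b l)\<^sup>2 * (cmod (utt_hat l s))\<^sup>2) \<le> B\<^sup>2" if "s \<in> {p<..<q}" for s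
    using assms that by (intro utt_H1) auto
qed (use assms B in auto)

definition H1_ut :: real where "H1_ut = sqrt ((8 / \<delta>\<^sup>2 + 2 * \<delta>\<^sup>2) * B\<^sup>2)"

lemma H1_ut_sq: "H1_ut\<^sup>2 = (8 / \<delta>\<^sup>2 + 2 * \<delta>\<^sup>2) * B\<^sup>2" and H1_ut_nonneg: "0 \<le> H1_ut"
  using \<delta> by (simp_all add: H1_ut_def)

text \<open>
  From the Taylor remainder at \<open>t' = t + \<sigma>\<close> and the bounds of \<open>u\<close> at both times one solves for \<open>\<sigma> u\<^sub>t\<close>.
\<close>

lemma landau_step:
  assumes t: "t \<in> {0..T}" and t': "t' \<in> {0..T}" and F: "finite F"
    and R: "(\<Sum>l\<in>F. (zeta a b l)\<^sup>2 * (cmod (u_hat l t' - u_hat l t - of_real \<sigma> * ut_hat l t))\<^sup>2) \<le> (\<delta> * (\<delta> * B))\<^sup>2"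
    and \<sigma>: "\<bar>\<sigma>\<bar> = \<delta>"
  shows "(\<Sum>l\<in>F. (zeta a b l)\<^sup>2 * (cmod (ut_hat l t))\<^sup>2) \<le> H1_ut\<^sup>2"
proof -
  have "(zeta a b l)\<^sup>2 * (\<delta>\<^sup>2 * (cmod (ut_hat l t))\<^sup>2) \<le>
      4 * ((zeta a b l)\<^sup>2 * (cmod (u_hat l t'))\<^sup>2) + 4 * ((zeta a b l)\<^sup>2 * (cmod (u_hat l t))\<^sup>2)
      + 2 * ((zeta a b l)\<^sup>2 * (cmod (u_hat l t' - u_hat l t - of_real \<sigma> * ut_hat l t))\<^sup>2)" for l
  proof -
    have "\<delta>\<^sup>2 * (cmod (ut_hat l t))\<^sup>2 = (cmod (of_real \<sigma> * ut_hat l t))\<^sup>2"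
      by (simp add: norm_mult power_mult_distrib flip: \<sigma>)
    also have "\<dots> = (cmod ((u_hat l t' - u_hat l t) - (u_hat l t' - u_hat l t - of_real \<sigma> * ut_hat l t)))\<^sup>2"
      by simp
    also have "\<dots> \<le> 2 * (2 * (cmod (u_hat l t'))\<^sup>2 + 2 * (cmod (u_hat l t))\<^sup>2)
        + 2 * (cmod (u_hat l t' - u_hat l t - of_real \<sigma> * ut_hat l t))\<^sup>2"
      by (rule order_trans[OF norm_diff_sq_le]) (intro add_right_mono mult_left_mono norm_diff_sq_le, simp)
    finally have "(zeta a b l)\<^sup>2 * (\<delta>\<^sup>2 * (cmod (ut_hat l t))\<^sup>2) \<le> (zeta a b l)\<^sup>2 * (2 * (2 * (cmod (u_hat l t'))\<^sup>2 + 2 * (cmod (u_hat l t))\<^sup>2)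
        + 2 * (cmod (u_hat l t' - u_hat l t - of_real \<sigma> * ut_hat l t))\<^sup>2)"
      by (intro mult_left_mono) auto
    then show ?thesis by (simp add: algebra_simps)
  qed
  then have "(\<Sum>l\<in>F. (zeta a b l)\<^sup>2 * (\<delta>\<^sup>2 * (cmod (ut_hat l t))\<^sup>2)) \<le>
      (\<Sum>l\<in>F. 4 * ((zeta a b l)\<^sup>2 * (cmod (u_hat l t'))\<^sup>2) + 4 * ((zeta a b l)\<^sup>2 * (cmod (u_hat l t))\<^sup>2)
      + 2 * ((zeta a b l)\<^sup>2 * (cmod (u_hat l t' - u_hat l t - of_real \<sigma> * ut_hat l t))\<^sup>2))"
    by (rule sum_mono)
  also have "\<dots> \<le> 4 * B\<^sup>2 + 4 * B\<^sup>2 + 2 * (\<delta> * (\<delta> * B))\<^sup>2"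
    unfolding sum.distrib sum_distrib_left[symmetric]
    by (intro add_mono mult_left_mono u_H1 R t t' F) auto
  also have "\<dots> = \<delta>\<^sup>2 * H1_ut\<^sup>2"
    unfolding H1_ut_sq using \<delta> by (simp add: power2_eq_square field_simps)
  finally have "\<delta>\<^sup>2 * (\<Sum>l\<in>F. (zeta a b l)\<^sup>2 * (cmod (ut_hat l t))\<^sup>2) \<le> \<delta>\<^sup>2 * H1_ut\<^sup>2"
    by (simp add: sum_distrib_left mult_ac)
  then show ?thesis using \<delta> by (subst (asm) mult_le_cancel_left_pos) auto
qed

text \<open>
  Landau's inequality: the Taylor remainder over a step of length \<open>\<delta>\<close> is of size \<open>\<delta>\<^sup>2\<close> by the bound on
  \<open>u\<^sub>t\<^sub>t\<close>. The sign \<open>d\<close> keeps the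
  step inside the time interval.
\<close>

lemma ut_H1:
  assumes t: "t \<in> {0..T}" and F: "finite F"
  shows "(\<Sum>l\<in>F. (zeta a b l)\<^sup>2 * (cmod (ut_hat l t))\<^sup>2) \<le> H1_ut\<^sup>2"
proof -
  obtain d :: real where d: "d = 1 \<or> d = - 1" and td: "t + d * \<delta> \<in> {0..T}"
  proof (cases "t \<le> \<delta>")
    case True
    then show ?thesis using t \<delta> by (intro that[of 1]) auto
  next
    case False
    then show ?thesis using t \<delta> by (intro that[of "- 1"]) auto
  qed
  have mem: "t + d * s \<in> {0..T}" if "s \<in> {0..\<delta>}" for s
    using d td t that by auto
  have pos: "0 < t + d * s" if "s \<in> {0<..<\<delta>}" for s
    using d td t that by auto
  let ?H = "\<lambda>l s. u_hat l (t + d * s) - of_real (d * s) * ut_hat l t"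
  let ?H' = "\<lambda>l s. of_real d * ut_hat l (t + d * s) - of_real d * ut_hat l t"
  have "(\<Sum>l\<in>F. (zeta a b l)\<^sup>2 * (cmod (?H l \<delta> - ?H l 0))\<^sup>2) \<le> ((\<delta> - 0) * (\<delta> * B))\<^sup>2"
  proof (rule weighted_increment_le)
    show "continuous_on {0..\<delta>} (?H l)" for l
      using mem by (intro continuous_intros continuous_on_compose2[OF continuous_on_u_hat]) auto
    show "(?H l has_vector_derivative ?H' l s) (at s)" if "s \<in> {0<..<\<delta>}" for l s
    proof -
      have "(u_hat l \<circ> (\<lambda>s. t + d * s) has_vector_derivative (d *\<^sub>R ut_hat l (t + d * s))) (at s)"
        using has_vector_derivative_u_hat[OF pos[OF that]]
        by (intro vector_diff_chain_at) (auto intro!: derivative_eq_intros)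
      moreover have "((\<lambda>s. of_real (d * s) * ut_hat l t) has_vector_derivative of_real d * ut_hat l t) (at s)"
        by (intro has_vector_derivative_mult_left has_vector_derivative_of_real) (auto intro!: derivative_eq_intros)
      ultimately show ?thesis
        by (intro has_vector_derivative_diff) (simp_all add: o_def scaleR_conv_of_real)
    qed
    show "(\<Sum>l\<in>F. (zeta a b l)\<^sup>2 * (cmod (?H' l s))\<^sup>2) \<le> (\<delta> * B)\<^sup>2" if s: "s \<in> {0<..<\<delta>}" for s
    proof -
      have "cmod (?H' l s) = cmod (ut_hat l (max t (t + d * s)) - ut_hat l (min t (t + d * s)))" for l
        using d s by (auto simp: max_def min_def norm_minus_commute)
      then have "(\<Sum>l\<in>F. (zeta a b l)\<^sup>2 * (cmod (?H' l s))\<^sup>2) \<le> ((max t (t + d * s) - min t (t + d * s)) * B)\<^sup>2"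
        using mem[of s] s t F by (simp only:) (intro ut_increment, auto)
      also have "\<dots> \<le> (\<delta> * B)\<^sup>2"
        using d s B by (intro power_mono mult_right_mono) auto
      finally show ?thesis .
    qed
  qed (use \<delta> B in auto)
  moreover have "?H l \<delta> - ?H l 0 = u_hat l (t + d * \<delta>) - u_hat l t - of_real (d * \<delta>) * ut_hat l t" for l
    by simp
  ultimately have "(\<Sum>l\<in>F. (zeta a b l)\<^sup>2 * (cmod (u_hat l (t + d * \<delta>) - u_hat l t - of_real (d * \<delta>) * ut_hat l t))\<^sup>2)
      \<le> (\<delta> * (\<delta> * B))\<^sup>2"
    by (simp only: diff_zero)
  then show ?thesis
    using t td F d \<delta> by (intro landau_step[where t'="t + d * \<delta>" and \<sigma>="d * \<delta>"]) auto
qed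

lemma u_increment:
  assumes "0 \<le> p" "p \<le> q" "q \<le> T" "finite F"
  shows "(\<Sum>l\<in>F. (zeta a b l)\<^sup>2 * (cmod (u_hat l q - u_hat l p))\<^sup>2) \<le> ((q - p) * H1_ut)\<^sup>2"
proof (rule weighted_increment_le)
  show "continuous_on {p..q} (u_hat l)" for l
    using assms by (intro continuous_on_subset[OF continuous_on_u_hat]) auto
  show "(u_hat l has_vector_derivative ut_hat l s) (at s)" if "s \<in> {p<..<q}" for l s
    using assms that by (intro has_vector_derivative_u_hat) auto
  show "(\<Sum>l\<in>F. (zeta a b l)\<^sup>2 * (cmod (ut_hat l s))\<^sup>2) \<le> H1_ut\<^sup>2" if "s \<in> {p<..<q}" for s
    using assms that by (intro ut_H1) auto
qed (use assms H1_ut_nonneg in auto)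

lemma u_second_increment:
  assumes "0 \<le> s" "s \<le> t" "t + s \<le> T" "finite F"
  shows "(\<Sum>l\<in>F. (zeta a b l)\<^sup>2 * (cmod (u_hat l (t + s) - 2 * u_hat l t + u_hat l (t - s)))\<^sup>2) \<le> (2 * B * s\<^sup>2)\<^sup>2"
proof -
  let ?H = "\<lambda>l r. u_hat l (t + r) + u_hat l (t - r)"
  have "(\<Sum>l\<in>F. (zeta a b l)\<^sup>2 * (cmod (?H l s - ?H l 0))\<^sup>2) \<le> ((s - 0) * (2 * s * B))\<^sup>2"
  proof (rule weighted_increment_le)
    show "continuous_on {0..s} (?H l)" for l
      using assms by (intro continuous_intros cont_shift continuous_on_u_hat) auto
    show "(?H l has_vector_derivative ut_hat l (t + r) + - ut_hat l (t - r)) (at r)" if "r \<in> {0<..<s}" for l r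
      using assms that
      by (intro has_vector_derivative_add deriv_shift has_vector_derivative_u_hat) auto
    show "(\<Sum>l\<in>F. (zeta a b l)\<^sup>2 * (cmod (ut_hat l (t + r) + - ut_hat l (t - r)))\<^sup>2) \<le> (2 * s * B)\<^sup>2"
      if r: "r \<in> {0<..<s}" for r
    proof -
      have "(\<Sum>l\<in>F. (zeta a b l)\<^sup>2 * (cmod (ut_hat l (t + r) + - ut_hat l (t - r)))\<^sup>2) \<le> ((t + r - (t - r)) * B)\<^sup>2"
        unfolding add_uminus_conv_diff using assms r by (intro ut_increment) auto
      also have "\<dots> \<le> (2 * s * B)\<^sup>2" using r B by (intro power_mono mult_right_mono) auto
      finally show ?thesis .
    qed
  qed (use assms B in auto)
  moreover have "?H l s - ?H l 0 = u_hat l (t + s) - 2 * u_hat l t + u_hat l (t - s)" for l by simp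
  moreover have "(s - 0) * (2 * s * B) = 2 * B * s\<^sup>2" by (simp add: power2_eq_square)
  ultimately show ?thesis by (simp only:)
qed

lemma in_time_differentiable:
  assumes "x \<in> {a<..<b}" "t \<ge> 0"
  shows "in_time u t differentiable (at x)"
proof -
  have "((\<lambda>y. u y t) has_vector_derivative d_x a b u x t) (at x)"
    using deriv_u_x[of x t] assms at_within_interior[of x "{a..b}"] by auto
  then have "((\<lambda>y. complex_of_real (u y t)) has_vector_derivative of_real (d_x a b u x t)) (at x)"
    by (intro has_vector_derivative_of_real) (simp add: has_real_derivative_iff_has_vector_derivative)
  then show ?thesis
    unfolding in_time_def by (rule differentiableI_vector)
qed

definition sup_u :: real where "sup_u = sqrt sobolev_const * B"
definition sup_ut :: real where "sup_ut = sqrt sobolev_const * H1_ut"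

lemma sup_u_nonneg: "0 \<le> sup_u" and sup_ut_nonneg: "0 \<le> sup_ut"
  using B H1_ut_nonneg sobolev_const_nonneg by (simp_all add: sup_u_def sup_ut_def)

lemma u_sup:
  assumes "x \<in> {a<..<b}" "t \<in> {0..T}"
  shows "\<bar>u x t\<bar> \<le> sup_u"
proof (rule power2_le_imp_le)
  have "(cmod (in_time u t x))\<^sup>2 \<le> sobolev_const * B\<^sup>2"
    using assms u_H1[OF assms(2)] unfolding u_hat_def
    by (intro sobolev_sup_bound cont_in_time in_time_differentiable) auto
  then show "\<bar>u x t\<bar>\<^sup>2 \<le> sup_u\<^sup>2"
    using sobolev_const_nonneg by (simp add: in_time_def sup_u_def power_mult_distrib)
qed (rule sup_u_nonneg)

text \<open>
  The Lipschitz bound is proved for increments of \<open>u\<close> and not for \<open>u\<^sub>t\<close>, because \<open>sobolev_sup_bound\<close> asks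
  for differentiability in \<open>x\<close>, which a classical solution provides for \<open>u\<close> only.
\<close>

lemma u_Lipschitz:
  assumes x: "x \<in> {a<..<b}" and pq: "0 \<le> p" "p \<le> q" "q \<le> T"
  shows "\<bar>u x q - u x p\<bar> \<le> sup_ut * (q - p)"
proof (rule power2_le_imp_le)
  let ?w = "\<lambda>x. in_time u q x - in_time u p x"
  have c: "continuous_on {a..b} (in_time u p)" "continuous_on {a..b} (in_time u q)"
    using pq by (auto intro!: cont_in_time)
  have "(cmod (?w x))\<^sup>2 \<le> sobolev_const * ((q - p) * H1_ut)\<^sup>2"
  proof (rule sobolev_sup_bound)
    show "(\<Sum>l\<in>F. (zeta a b l)\<^sup>2 * (cmod (fcoeff a b ?w l))\<^sup>2) \<le> ((q - p) * H1_ut)\<^sup>2" if "finite F" for F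
      using u_increment[OF pq that] by (simp add: fcoeff_diff[OF c(2,1)] u_hat_def)
  qed (use x pq c in \<open>auto intro!: continuous_intros differentiable_diff in_time_differentiable\<close>)
  then show "\<bar>u x q - u x p\<bar>\<^sup>2 \<le> (sup_ut * (q - p))\<^sup>2"
    using sobolev_const_nonneg
    by (simp add: in_time_def sup_ut_def power_mult_distrib mult_ac flip: of_real_diff)
qed (use sup_ut_nonneg pq in auto)

definition cube_rate :: real where "cube_rate = 3 * sup_u\<^sup>2 * sup_ut"
definition cube_curvature :: real where "cube_curvature = sqrt (450 * sup_u ^ 4 * (2 * B)\<^sup>2 + 72 * sup_u\<^sup>2 * sup_ut ^ 4)"

lemma cube_rate_nonneg: "0 \<le> cube_rate" and cube_curvature_nonneg: "0 \<le> cube_curvature"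
  and cube_curvature_sq: "cube_curvature\<^sup>2 = 450 * sup_u ^ 4 * (2 * B)\<^sup>2 + 72 * sup_u\<^sup>2 * sup_ut ^ 4"
  using sup_u_nonneg sup_ut_nonneg B by (simp_all add: cube_rate_def cube_curvature_def)

lemma cont_cube: "t \<ge> 0 \<Longrightarrow> continuous_on {a..b} (\<lambda>x. in_time u t x ^ 3)"
  by (intro continuous_intros cont_in_time)

lemma cube_hat_increment:
  assumes "0 \<le> s" "s \<le> T" "finite F"
  shows "(\<Sum>l\<in>F. (cmod (cube_hat l s - cube_hat l 0))\<^sup>2) \<le> (cube_rate * s)\<^sup>2"
proof -
  let ?w = "\<lambda>x. in_time u s x ^ 3 - in_time u 0 x ^ 3"
  have w: "continuous_on {a..b} ?w" using assms by (intro continuous_on_diff cont_cube) auto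
  have "(\<Sum>l\<in>F. (cmod (fcoeff a b ?w l))\<^sup>2) \<le> mean_sq a b ?w"
    by (rule bessel[OF w assms(3)])
  also have "\<dots> \<le> 0 * mean_sq a b ?w + (cube_rate * s)\<^sup>2"
  proof (rule mean_sq_mono[OF w w])
    fix x assume x: "x \<in> {a<..<b}"
    have "\<bar>u x s ^ 3 - u x 0 ^ 3\<bar> \<le> 3 * sup_u\<^sup>2 * sup_ut * s"
      using u_Lipschitz[OF x, of 0 s] assms \<delta> x by (intro cube_increment_pointwise u_sup) auto
    then have "(cmod (?w x))\<^sup>2 \<le> (cube_rate * s)\<^sup>2"
      unfolding cube_rate_def by (intro power_mono) (simp_all add: in_time_def flip: of_real_power of_real_diff)
    then show "(cmod (?w x))\<^sup>2 \<le> 0 * (cmod (?w x))\<^sup>2 + (cube_rate * s)\<^sup>2" by simp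
  qed
  finally show ?thesis
    using assms by (simp add: fcoeff_diff cont_cube cube_hat_def)
qed

text \<open>
  This is where second order in time comes from: the mean square of the second difference of \<open>u\<^sup>3\<close> is
  controlled by that of \<open>u\<close>, for which Parseval's upper bound and the bound on \<open>u\<^sub>t\<^sub>t\<close> give \<open>s\<^sup>4\<close>.
\<close>

lemma cube_hat_second_increment:
  assumes st: "0 \<le> s" "s \<le> t" "t + s \<le> T" and F: "finite F"
  shows "(\<Sum>l\<in>F. (cmod (cube_hat l (t + s) + cube_hat l (t - s) - 2 * cube_hat l t))\<^sup>2) \<le> (cube_curvature * s\<^sup>2)\<^sup>2"
proof -
  let ?w = "\<lambda>x. (in_time u (t + s) x ^ 3 - in_time u t x ^ 3) - (in_time u t x ^ 3 - in_time u (t - s) x ^ 3)"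
  let ?v = "\<lambda>x. (in_time u (t + s) x - in_time u t x) - (in_time u t x - in_time u (t - s) x)"
  have w: "continuous_on {a..b} ?w" using st by (intro continuous_on_diff cont_cube) auto
  have v: "continuous_on {a..b} ?v" using st by (intro continuous_on_diff cont_in_time) auto
  have vhat: "fcoeff a b ?v l = u_hat l (t + s) - 2 * u_hat l t + u_hat l (t - s)" for l
  proof -
    have c: "continuous_on {a..b} (in_time u (t + s))" "continuous_on {a..b} (in_time u t)"
      "continuous_on {a..b} (in_time u (t - s))"
      using st by (auto intro!: cont_in_time)
    have "fcoeff a b ?v l = (u_hat l (t + s) - u_hat l t) - (u_hat l t - u_hat l (t - s))"
      unfolding u_hat_def fcoeff_diff[OF continuous_on_diff[OF c(1,2)] continuous_on_diff[OF c(2,3)]]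
        fcoeff_diff[OF c(1,2)] fcoeff_diff[OF c(2,3)] ..
    then show ?thesis by simp
  qed
  have what: "fcoeff a b ?w l = cube_hat l (t + s) + cube_hat l (t - s) - 2 * cube_hat l t" for l
  proof -
    have c: "continuous_on {a..b} (\<lambda>x. in_time u (t + s) x ^ 3)" "continuous_on {a..b} (\<lambda>x. in_time u t x ^ 3)"
      "continuous_on {a..b} (\<lambda>x. in_time u (t - s) x ^ 3)"
      using st by (auto intro!: cont_cube)
    have "fcoeff a b ?w l = (cube_hat l (t + s) - cube_hat l t) - (cube_hat l t - cube_hat l (t - s))"
      unfolding cube_hat_def fcoeff_diff[OF continuous_on_diff[OF c(1,2)] continuous_on_diff[OF c(2,3)]]
        fcoeff_diff[OF c(1,2)] fcoeff_diff[OF c(2,3)] ..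
    then show ?thesis by simp
  qed
  have mv: "mean_sq a b ?v \<le> (2 * B * s\<^sup>2)\<^sup>2"
  proof (rule mean_sq_le_fourier[OF v])
    show "?v differentiable (at x)" if "x \<in> {a<..<b}" for x
      using that st by (intro differentiable_diff in_time_differentiable) auto
    show Q: "(\<Sum>l\<in>F. (zeta a b l)\<^sup>2 * (cmod (fcoeff a b ?v l))\<^sup>2) \<le> (2 * B * s\<^sup>2)\<^sup>2" if "finite F" for F
      unfolding vhat by (rule u_second_increment[OF st that])
    show "(\<Sum>l\<in>F. (cmod (fcoeff a b ?v l))\<^sup>2) \<le> (2 * B * s\<^sup>2)\<^sup>2" if "finite F" for F
      by (rule order_trans[OF unweighted_le_weighted Q[OF that]])
  qed
  have "(\<Sum>l\<in>F. (cmod (fcoeff a b ?w l))\<^sup>2) \<le> mean_sq a b ?w"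
    by (rule bessel[OF w F])
  also have "\<dots> \<le> 450 * sup_u ^ 4 * mean_sq a b ?v + 72 * sup_u\<^sup>2 * sup_ut ^ 4 * s ^ 4"
  proof (rule mean_sq_mono[OF w v])
    fix x assume x: "x \<in> {a<..<b}"
    define d where "d = \<bar>u x (t + s) - 2 * u x t + u x (t - s)\<bar>"
    have "\<bar>u x (t + s) ^ 3 - 2 * u x t ^ 3 + u x (t - s) ^ 3\<bar> \<le> 15 * sup_u\<^sup>2 * d + 6 * sup_u * sup_ut\<^sup>2 * s\<^sup>2"
      using u_Lipschitz[OF x, of t "t + s"] u_Lipschitz[OF x, of "t - s" t] st x unfolding d_def
      by (intro cube_second_increment_pointwise u_sup) (auto simp: abs_minus_commute)
    moreover have "cmod (?w x) = \<bar>u x (t + s) ^ 3 - 2 * u x t ^ 3 + u x (t - s) ^ 3\<bar>"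
      unfolding in_time_def of_real_power[symmetric] of_real_diff[symmetric] norm_of_real by (simp add: algebra_simps)
    moreover have vd: "cmod (?v x) = d"
      unfolding d_def in_time_def of_real_diff[symmetric] norm_of_real by (simp add: algebra_simps)
    ultimately have "(cmod (?w x))\<^sup>2 \<le> (15 * sup_u\<^sup>2 * d + 6 * sup_u * sup_ut\<^sup>2 * s\<^sup>2)\<^sup>2"
      by (intro power_mono) auto
    also have "\<dots> \<le> 2 * (15 * sup_u\<^sup>2 * d)\<^sup>2 + 2 * (6 * sup_u * sup_ut\<^sup>2 * s\<^sup>2)\<^sup>2"
      using zero_le_power2[of "15 * sup_u\<^sup>2 * d - 6 * sup_u * sup_ut\<^sup>2 * s\<^sup>2"] unfolding power2_sum power2_diff by linarith
    also have "\<dots> = 450 * sup_u ^ 4 * d\<^sup>2 + 72 * sup_u\<^sup>2 * sup_ut ^ 4 * s ^ 4"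
      by (simp add: power_mult_distrib flip: power_mult)
    finally show "(cmod (?w x))\<^sup>2 \<le> 450 * sup_u ^ 4 * (cmod (?v x))\<^sup>2 + 72 * sup_u\<^sup>2 * sup_ut ^ 4 * s ^ 4"
      unfolding vd .
  qed
  also have "\<dots> \<le> 450 * sup_u ^ 4 * (2 * B * s\<^sup>2)\<^sup>2 + 72 * sup_u\<^sup>2 * sup_ut ^ 4 * s ^ 4"
    by (intro add_right_mono mult_left_mono mv) auto
  also have "\<dots> = (cube_curvature * s\<^sup>2)\<^sup>2"
    unfolding power_mult_distrib cube_curvature_sq by (simp add: distrib_right flip: power_mult)
  finally show ?thesis by (simp only: what)
qed

text \<open>
  The amount by which the exact coefficients miss the first step and the general step of the scheme.
\<close>

definition initial_defect :: "real \<Rightarrow> int \<Rightarrow> complex" where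
  "initial_defect \<tau> l = u_hat l \<tau> - p_coef a b \<tau> l * u_hat l 0 - q_coef a b \<tau> l * ut_hat l 0
     - r_coef a b \<epsilon> \<tau> l * cube_hat l 0"

definition step_defect :: "real \<Rightarrow> real \<Rightarrow> int \<Rightarrow> complex" where
  "step_defect \<tau> t l = u_hat l (t + \<tau>) + u_hat l (t - \<tau>) - 2 * p_coef a b \<tau> l * u_hat l t
     - 2 * r_coef a b \<epsilon> \<tau> l * cube_hat l t"

lemma initial_defect_le:
  assumes "0 < \<tau>" "\<tau> \<le> T" "finite F"
  shows "(\<Sum>l\<in>F. (cmod (initial_defect \<tau> l))\<^sup>2) \<le> (\<epsilon>\<^sup>2 * cube_rate * \<tau> ^ 3)\<^sup>2"
proof -
  have "(\<Sum>l\<in>F. (cmod (initial_defect \<tau> l))\<^sup>2) \<le> (\<tau> * (\<tau> * \<epsilon>\<^sup>2 * (cube_rate * \<tau>)))\<^sup>2"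
    unfolding initial_defect_def
  proof (rule duhamel_l2)
    show "(u_hat l has_vector_derivative ut_hat l s) (at s)" if "s \<in> {0<..<\<tau>}" for l s
      using that by (intro has_vector_derivative_u_hat) auto
    show "(ut_hat l has_vector_derivative - (of_real ((zeta a b l)\<^sup>2) * u_hat l s + of_real (\<epsilon>\<^sup>2) * cube_hat l s)) (at s)"
      if "s \<in> {0<..<\<tau>}" for l s
      using that has_vector_derivative_ut_hat[of s l] unfolding utt_hat_def by auto
    show "(\<Sum>l\<in>F. (cmod (cube_hat l s - cube_hat l 0))\<^sup>2) \<le> (cube_rate * \<tau>)\<^sup>2" if "s \<in> {0<..<\<tau>}" for s
    proof -
      have "(\<Sum>l\<in>F. (cmod (cube_hat l s - cube_hat l 0))\<^sup>2) \<le> (cube_rate * s)\<^sup>2"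
        using that assms by (intro cube_hat_increment) auto
      also have "\<dots> \<le> (cube_rate * \<tau>)\<^sup>2"
        using that assms cube_rate_nonneg by (intro power_mono mult_left_mono) auto
      finally show ?thesis .
    qed
  qed (use assms cube_rate_nonneg in \<open>auto intro!: continuous_on_subset[OF continuous_on_u_hat] continuous_on_subset[OF continuous_on_ut_hat]\<close>)
  also have "\<tau> * (\<tau> * \<epsilon>\<^sup>2 * (cube_rate * \<tau>)) = \<epsilon>\<^sup>2 * cube_rate * \<tau> ^ 3" by (simp add: power3_eq_cube)
  finally show ?thesis .
qed

lemma step_defect_le:
  assumes "0 < \<tau>" "\<tau> \<le> t" "t + \<tau> \<le> T" "finite F"
  shows "(\<Sum>l\<in>F. (cmod (step_defect \<tau> t l))\<^sup>2) \<le> (\<epsilon>\<^sup>2 * cube_curvature * \<tau> ^ 4)\<^sup>2"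
proof -
  let ?y = "\<lambda>l s. u_hat l (t + s) + u_hat l (t - s)"
  let ?y' = "\<lambda>l s. ut_hat l (t + s) + - ut_hat l (t - s)"
  let ?g = "\<lambda>l s. cube_hat l (t + s) + cube_hat l (t - s)"
  have "(\<Sum>l\<in>F. (cmod (?y l \<tau> - p_coef a b \<tau> l * ?y l 0 - q_coef a b \<tau> l * ?y' l 0
       - r_coef a b \<epsilon> \<tau> l * (2 * cube_hat l t)))\<^sup>2) \<le> (\<tau> * (\<tau> * \<epsilon>\<^sup>2 * (cube_curvature * \<tau>\<^sup>2)))\<^sup>2"
  proof (rule duhamel_l2)
    show "(?y l has_vector_derivative ?y' l s) (at s)" if "s \<in> {0<..<\<tau>}" for l s
      using that assms
      by (intro has_vector_derivative_add deriv_shift has_vector_derivative_u_hat) auto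
    show "(?y' l has_vector_derivative - (of_real ((zeta a b l)\<^sup>2) * ?y l s + of_real (\<epsilon>\<^sup>2) * ?g l s)) (at s)"
      if "s \<in> {0<..<\<tau>}" for l s
    proof -
      have "(?y' l has_vector_derivative utt_hat l (t + s) + - (- utt_hat l (t - s))) (at s)"
        using that assms
        by (intro has_vector_derivative_add has_vector_derivative_minus deriv_shift has_vector_derivative_ut_hat) auto
      then show ?thesis by (simp add: utt_hat_def algebra_simps)
    qed
    show "(\<Sum>l\<in>F. (cmod (?g l s - 2 * cube_hat l t))\<^sup>2) \<le> (cube_curvature * \<tau>\<^sup>2)\<^sup>2" if "s \<in> {0<..<\<tau>}" for s
    proof -
      have "(\<Sum>l\<in>F. (cmod (?g l s - 2 * cube_hat l t))\<^sup>2) \<le> (cube_curvature * s\<^sup>2)\<^sup>2"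
        using that assms by (intro cube_hat_second_increment) auto
      also have "\<dots> \<le> (cube_curvature * \<tau>\<^sup>2)\<^sup>2"
        using that assms cube_curvature_nonneg by (intro power_mono mult_left_mono) auto
      finally show ?thesis .
    qed
  qed (use assms cube_curvature_nonneg in \<open>auto intro!: continuous_intros cont_shift continuous_on_u_hat continuous_on_ut_hat\<close>)
  moreover have "?y l \<tau> - p_coef a b \<tau> l * ?y l 0 - q_coef a b \<tau> l * ?y' l 0
       - r_coef a b \<epsilon> \<tau> l * (2 * cube_hat l t) = step_defect \<tau> t l" for l
    by (simp add: step_defect_def algebra_simps)
  moreover have "\<tau> * (\<tau> * \<epsilon>\<^sup>2 * (cube_curvature * \<tau>\<^sup>2)) = \<epsilon>\<^sup>2 * cube_curvature * \<tau> ^ 4" by (simp add: power2_eq_square power4_eq_xxxx)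
  ultimately show ?thesis by simp
qed

end

section \<open>Discrete energy estimate\<close>

text \<open>
  Both sides satisfy the same recursion, as \<open>sin (x + \<theta>) = 2 cos \<theta> sin x - sin (x - \<theta>)\<close>. The factor \<open>sin \<theta>\<close> is kept on
  the left so that no division is needed.
\<close>

lemma oscillator_variation_of_constants:
  fixes e \<eta> :: "nat \<Rightarrow> complex"
  assumes e0: "e 0 = 0" and e1: "e 1 = \<eta> 0"
    and rec: "\<And>n. e (Suc (Suc n)) = 2 * of_real (cos \<theta>) * e (Suc n) - e n + \<eta> (Suc n)"
  shows "of_real (sin \<theta>) * e n = (\<Sum>k<n. of_real (sin ((real n - real k) * \<theta>)) * \<eta> k)"
proof (induction n rule: induct_nat_012)
  case 0
  show ?case by (simp add: e0)
next
  case 1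
  show ?case using e1 by simp
next
  case (ge2 n)
  let ?s = "\<lambda>n k. complex_of_real (sin ((real n - real k) * \<theta>))"
  have step: "?s (Suc (Suc n)) k = 2 * of_real (cos \<theta>) * ?s (Suc n) k - ?s n k" for k
  proof -
    define x where "x = (real n + 1 - real k) * \<theta>"
    have "sin (x + \<theta>) = 2 * cos \<theta> * sin x - sin (x - \<theta>)"
      by (simp add: sin_add sin_diff)
    moreover have "x + \<theta> = (real (Suc (Suc n)) - real k) * \<theta>" "x - \<theta> = (real n - real k) * \<theta>"
      "x = (real (Suc n) - real k) * \<theta>"
      by (simp_all add: x_def algebra_simps)
    ultimately have "sin ((real (Suc (Suc n)) - real k) * \<theta>)
        = 2 * cos \<theta> * sin ((real (Suc n) - real k) * \<theta>) - sin ((real n - real k) * \<theta>)"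
      by simp
    then show ?thesis by (simp only: of_real_diff of_real_mult of_real_numeral)
  qed
  have "(\<Sum>k<Suc (Suc n). ?s (Suc (Suc n)) k * \<eta> k)
      = (\<Sum>k<Suc n. 2 * of_real (cos \<theta>) * (?s (Suc n) k * \<eta> k) - ?s n k * \<eta> k) + of_real (sin \<theta>) * \<eta> (Suc n)"
    unfolding sum.lessThan_Suc[of _ "Suc n"] step by (simp add: algebra_simps)
  also have "\<dots> = 2 * of_real (cos \<theta>) * (\<Sum>k<Suc n. ?s (Suc n) k * \<eta> k) - (\<Sum>k<n. ?s n k * \<eta> k) + of_real (sin \<theta>) * \<eta> (Suc n)"
    unfolding sum_subtractf sum_distrib_left[symmetric] sum.lessThan_Suc[of "\<lambda>k. ?s n k * \<eta> k" n] by simp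
  also have "\<dots> = of_real (sin \<theta>) * (2 * of_real (cos \<theta>) * e (Suc n) - e n + \<eta> (Suc n))"
    unfolding ge2[symmetric] by (simp add: algebra_simps)
  finally show ?case by (simp only: rec)
qed

lemma sin_ge_half:
  assumes "0 \<le> \<theta>" "\<theta> \<le> pi / 3"
  shows "\<theta> / 2 \<le> sin (\<theta>::real)"
proof -
  have mono: "(\<lambda>x. sin x - x / 2) 0 \<le> (\<lambda>x. sin x - x / 2) \<theta>"
  proof (rule DERIV_nonneg_imp_nondecreasing[OF assms(1)])
    fix x assume x: "0 \<le> x" "x \<le> \<theta>"
    have "cos (pi / 3) \<le> cos x"
      using x assms(2) by (intro cos_monotone_0_pi_le) auto
    then have "0 \<le> cos x - 1 / 2" by (simp add: cos_60)
    moreover have "((\<lambda>x. sin x - x / 2) has_real_derivative cos x - 1 / 2) (at x)"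
      by (auto intro!: derivative_eq_intros)
    ultimately show "\<exists>y. ((\<lambda>x. sin x - x / 2) has_real_derivative y) (at x) \<and> 0 \<le> y" by blast
  qed
  then show ?thesis by simp
qed

lemma one_minus_cos_le: "1 - cos (\<theta>::real) \<le> \<theta>\<^sup>2 / 2"
proof -
  have "1 - cos \<theta> = 2 * (sin (\<theta> / 2))\<^sup>2"
    using cos_double_sin[of "\<theta> / 2"] by simp
  also have "\<dots> \<le> 2 * (\<theta> / 2)\<^sup>2"
    using abs_sin_x_le_abs_x[of "\<theta> / 2"] unfolding abs_le_square_iff by (rule mult_left_mono) simp
  finally show ?thesis by (simp add: power2_eq_square)
qed

lemma discrete_gronwall:
  fixes E :: "nat \<Rightarrow> real"
  assumes g: "0 \<le> g" and le: "\<And>n. n \<le> N \<Longrightarrow> E n \<le> A + g * (\<Sum>k<n. E k)"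
  shows "n \<le> N \<Longrightarrow> E n \<le> A * (1 + g) ^ n"
proof (induction n rule: less_induct)
  case (less n)
  have "E n \<le> A + g * (\<Sum>k<n. E k)" by (rule le[OF less.prems])
  also have "\<dots> \<le> A + g * (\<Sum>k<n. A * (1 + g) ^ k)"
    using less g by (intro add_left_mono mult_left_mono sum_mono) auto
  also have "\<dots> = A + A * (g * (\<Sum>k<n. (1 + g) ^ k))"
    by (simp add: sum_distrib_left mult_ac)
  also have "g * (\<Sum>k<n. (1 + g) ^ k) = (1 + g) ^ n - 1"
    using power_diff_1_eq[of "1 + g" n] by simp
  finally show ?case by (simp add: algebra_simps)
qed

lemma finite_modes [simp]: "finite (modes M)"
  by (simp add: modes_def)

lemma modes_abs_le: "l \<in> modes M \<Longrightarrow> \<bar>real_of_int l\<bar> \<le> real M / 2"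
  unfolding modes_def by auto

lemma not_modes_abs_ge: "even M \<Longrightarrow> l \<notin> modes M \<Longrightarrow> real M / 2 \<le> \<bar>real_of_int l\<bar>"
  unfolding modes_def by (auto elim!: evenE)

context real_interval
begin

lemma abs_freq: "\<bar>freq a b l\<bar> = (2 * pi / (b - a)) * \<bar>real_of_int l\<bar>"
  using ab by (simp add: freq_def abs_mult)

lemma zeta_le_modes:
  assumes "M > 0" "l \<in> modes M" and h: "h = (b - a) / real M"
  shows "zeta a b l \<le> sqrt (pi\<^sup>2 + h\<^sup>2) / h"
proof -
  have h0: "h > 0" using assms ab by simp
  have "\<bar>freq a b l\<bar> \<le> (2 * pi / (b - a)) * (real M / 2)"
    unfolding abs_freq using ab modes_abs_le[OF assms(2)] by (intro mult_left_mono) auto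
  also have "\<dots> = pi / h" unfolding h using ab assms(1) by (simp add: divide_simps)
  finally have "(freq a b l)\<^sup>2 \<le> (pi / h)\<^sup>2"
    using h0 by (simp add: abs_le_square_iff[symmetric])
  then have "zeta a b l \<le> sqrt (1 + (pi / h)\<^sup>2)" by (simp add: zeta_def)
  also have "1 + (pi / h)\<^sup>2 = (pi\<^sup>2 + h\<^sup>2) / h\<^sup>2" using h0 by (simp add: power_divide field_simps)
  finally show ?thesis using h0 by (simp add: real_sqrt_divide)
qed

text \<open>
  The discarded modes have frequency at least \<open>\<pi> / h\<close>; the number \<open>M\<close> has to be even for the
  index \<open>M div 2\<close> to be \<open>M / 2\<close>.
\<close>

lemma zeta_ge_not_modes:
  assumes "M > 0" "even M" "l \<notin> modes M" and h: "h = (b - a) / real M"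
  shows "1 \<le> zeta a b l * h"
proof -
  have h0: "h > 0" using assms ab by simp
  have "pi / h = (2 * pi / (b - a)) * (real M / 2)" unfolding h using ab assms(1) by (simp add: divide_simps)
  also have "\<dots> \<le> \<bar>freq a b l\<bar>"
    unfolding abs_freq using ab not_modes_abs_ge[OF assms(2,3)] by (intro mult_left_mono) auto
  also have "\<dots> \<le> zeta a b l"
    unfolding zeta_def by (rule real_le_rsqrt) simp
  finally have "pi \<le> zeta a b l * h" using h0 by (simp add: field_simps)
  then show ?thesis using pi_gt3 by linarith
qed

lemma fcoeff_trig_sum: "fcoeff a b (trig_sum a b M c) l = (if l \<in> modes M then c l else 0)"
  unfolding trig_sum_def[abs_def] by (rule fcoeff_fmode_sum) simp

lemma continuous_on_trig_sum: "continuous_on S (trig_sum a b M c)"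
  unfolding trig_sum_def[abs_def] by (intro continuous_intros)

lemma trig_sum_differentiable: "trig_sum a b M c differentiable (at x)"
proof -
  have "(trig_sum a b M c has_vector_derivative
      (\<Sum>l\<in>modes M. c l * (\<i> * of_real (freq a b l) * fmode a b l x))) (at x)"
    unfolding trig_sum_def[abs_def]
    by (intro has_vector_derivative_sum has_vector_derivative_mult_right has_vector_derivative_fmode)
  then show ?thesis by (rule differentiableI_vector)
qed

end

lemma norm_cube_diff_le:
  assumes "cmod v \<le> \<rho>" "cmod w \<le> \<rho>"
  shows "cmod (v ^ 3 - w ^ 3) \<le> 3 * \<rho>\<^sup>2 * cmod (v - w)"
proof -
  have "v ^ 3 - w ^ 3 = (v * v + v * w + w * w) * (v - w)" by algebra
  also have "cmod \<dots> \<le> (\<rho> * \<rho> + \<rho> * \<rho> + \<rho> * \<rho>) * cmod (v - w)"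
    unfolding norm_mult
  proof (intro mult_right_mono norm_ge_zero)
    have \<rho>: "0 \<le> \<rho>" using assms(1) norm_ge_zero[of v] by linarith
    have "cmod (v * v) \<le> \<rho> * \<rho>" "cmod (v * w) \<le> \<rho> * \<rho>" "cmod (w * w) \<le> \<rho> * \<rho>"
      unfolding norm_mult using assms \<rho> by (auto intro!: mult_mono)
    then show "cmod (v * v + v * w + w * w) \<le> \<rho> * \<rho> + \<rho> * \<rho> + \<rho> * \<rho>"
      by (intro norm_triangle_le add_mono) auto
  qed
  finally show ?thesis by (simp add: power2_eq_square)
qed

text \<open>
  The condition on \<open>\<tau> \<zeta>\<^sub>l\<close> is what the time step restriction says about the modes that are kept.
\<close>

locale kg_scheme = kg_regular +
  fixes m0 M :: nat and \<tau> h :: real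
  assumes m0: "1 \<le> m0" and M: "M > 0" "even M" and h: "h = (b - a) / real M" and \<tau>: "\<tau> > 0"
    and cfl: "l \<in> modes M \<Longrightarrow> \<tau> * zeta a b l \<le> pi / 3"
    and u_Hm: "t \<in> {0..T} \<Longrightarrow> finite F \<Longrightarrow>
      (\<Sum>l\<in>F. ((zeta a b l)\<^sup>2) ^ m0 * (cmod (u_hat l t))\<^sup>2) \<le> B\<^sup>2"
begin

lemma h_pos: "h > 0" using M ab by (simp add: h)

definition num :: "nat \<Rightarrow> real \<Rightarrow> complex" where "num n = ewi_fs a b \<epsilon> \<tau> M \<phi> \<gamma> n"
definition num_hat :: "nat \<Rightarrow> int \<Rightarrow> complex" where "num_hat n l = fcoeff a b (num n) l"
definition num_cube_hat :: "nat \<Rightarrow> int \<Rightarrow> complex" where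
  "num_cube_hat n l = fcoeff a b (\<lambda>x. num n x ^ 3) l"
definition err_hat :: "nat \<Rightarrow> int \<Rightarrow> complex" where
  "err_hat n l = u_hat l (real n * \<tau>) - num_hat n l"
definition energy :: "nat \<Rightarrow> real" where
  "energy n = (\<Sum>l\<in>modes M. (zeta a b l)\<^sup>2 * (cmod (err_hat n l))\<^sup>2)"

lemma num_trig_sum: "\<exists>c. num n = trig_sum a b M c"
  unfolding num_def by (induction n rule: induct_nat_012) (auto simp: proj_def)

lemma cont_num: "continuous_on S (num n)" and num_differentiable: "num n differentiable (at x)"
  and num_hat_outside: "l \<notin> modes M \<Longrightarrow> num_hat n l = 0"
  using num_trig_sum[of n]
  by (auto simp: continuous_on_trig_sum trig_sum_differentiable num_hat_def fcoeff_trig_sum)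

lemma fcoeff_init:
  "fcoeff a b (\<lambda>x. of_real (\<phi> x)) l = u_hat l 0"
  "fcoeff a b (\<lambda>x. of_real (\<gamma> x)) l = ut_hat l 0"
  "fcoeff a b (\<lambda>x. of_real (\<phi> x) ^ 3) l = cube_hat l 0"
  unfolding u_hat_def ut_hat_def cube_hat_def
  by (rule fcoeff_cong; simp add: in_time_def u_init ut_init)+

lemma num_hat_0: "l \<in> modes M \<Longrightarrow> num_hat 0 l = u_hat l 0"
  by (simp add: num_hat_def num_def proj_def fcoeff_trig_sum fcoeff_init)

lemma num_hat_1: "l \<in> modes M \<Longrightarrow> num_hat (Suc 0) l =
    p_coef a b \<tau> l * u_hat l 0 + q_coef a b \<tau> l * ut_hat l 0 + r_coef a b \<epsilon> \<tau> l * cube_hat l 0"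
  by (simp add: num_hat_def num_def fcoeff_trig_sum fcoeff_init)

lemma num_hat_step: "l \<in> modes M \<Longrightarrow> num_hat (Suc (Suc n)) l =
    - num_hat n l + 2 * p_coef a b \<tau> l * num_hat (Suc n) l + 2 * r_coef a b \<epsilon> \<tau> l * num_cube_hat (Suc n) l"
  by (simp add: num_hat_def num_cube_hat_def num_def fcoeff_trig_sum)

text \<open>
  The right-hand side of the error recursion: the defect of the exact solution and the error of the
  nonlinear term. The first step starts from exact data, so the latter is absent there.
\<close>

definition forcing :: "nat \<Rightarrow> int \<Rightarrow> complex" where
  "forcing k l = (if k = 0 then initial_defect \<tau> l else
     step_defect \<tau> (real k * \<tau>) l
      + 2 * r_coef a b \<epsilon> \<tau> l * (cube_hat l (real k * \<tau>) - num_cube_hat k l))"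

lemma err_hat_formula:
  assumes l: "l \<in> modes M"
  shows "of_real (sin (\<tau> * zeta a b l)) * err_hat n l
    = (\<Sum>k<n. of_real (sin ((real n - real k) * (\<tau> * zeta a b l))) * forcing k l)"
proof (rule oscillator_variation_of_constants)
  show "err_hat 0 l = 0" using l by (simp add: err_hat_def num_hat_0)
  show "err_hat 1 l = forcing 0 l"
    using l by (simp add: err_hat_def num_hat_1 forcing_def initial_defect_def)
  show "err_hat (Suc (Suc n)) l = 2 * of_real (cos (\<tau> * zeta a b l)) * err_hat (Suc n) l - err_hat n l + forcing (Suc n) l" for n
  proof -
    have t: "real (Suc (Suc n)) * \<tau> = real (Suc n) * \<tau> + \<tau>" "real n * \<tau> = real (Suc n) * \<tau> - \<tau>"
      by (simp_all add: algebra_simps)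
    show ?thesis
      unfolding err_hat_def num_hat_step[OF l] forcing_def step_defect_def p_coef_def[symmetric] t
      by (simp add: algebra_simps)
  qed
qed

text \<open>
  Dividing by \<open>sin \<theta> \<ge> \<theta> / 2\<close> is the step that gains the factor \<open>\<zeta>\<^sub>l\<close>.
\<close>

lemma zeta_err_hat_le:
  assumes l: "l \<in> modes M"
  shows "\<tau> * zeta a b l * cmod (err_hat n l) \<le> 2 * (\<Sum>k<n. cmod (forcing k l))"
proof -
  let ?\<theta> = "\<tau> * zeta a b l"
  have \<theta>: "0 \<le> ?\<theta>" "?\<theta> \<le> pi / 3" using \<tau> zeta_pos[of a b l] cfl[OF l] by auto
  have "?\<theta> / 2 * cmod (err_hat n l) \<le> \<bar>sin ?\<theta>\<bar> * cmod (err_hat n l)"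
    using sin_ge_half[OF \<theta>] by (intro mult_right_mono) auto
  also have "\<dots> = cmod (\<Sum>k<n. of_real (sin ((real n - real k) * ?\<theta>)) * forcing k l)"
    unfolding err_hat_formula[OF l, symmetric] norm_mult norm_of_real ..
  also have "\<dots> \<le> (\<Sum>k<n. 1 * cmod (forcing k l))"
    by (rule order_trans[OF norm_sum]) (intro sum_mono, unfold norm_mult norm_of_real,
      intro mult_right_mono abs_sin_le_one norm_ge_zero)
  finally show ?thesis by simp
qed

text \<open>
  The initial forcing is split off before the Cauchy-Schwarz inequality over the steps. It is of size \<open>\<tau>\<^sup>3\<close>, one power of
  \<open>\<tau>\<close> short of the others, and could not afford the factor \<open>n\<close>.
\<close>

lemma energy_le_forcing:
  "\<tau>\<^sup>2 * energy n \<le> 8 * (\<Sum>l\<in>modes M. (cmod (forcing 0 l))\<^sup>2)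
     + 8 * real n * (\<Sum>k\<in>{1..<n}. \<Sum>l\<in>modes M. (cmod (forcing k l))\<^sup>2)"
proof -
  have "\<tau>\<^sup>2 * ((zeta a b l)\<^sup>2 * (cmod (err_hat n l))\<^sup>2) \<le> 8 * (cmod (forcing 0 l))\<^sup>2
     + 8 * real n * (\<Sum>k\<in>{1..<n}. (cmod (forcing k l))\<^sup>2)" if l: "l \<in> modes M" for l
  proof -
    let ?s = "\<Sum>k\<in>{1..<n}. cmod (forcing k l)"
    have "(\<Sum>k<n. cmod (forcing k l)) \<le> cmod (forcing 0 l) + ?s"
    proof (cases n)
      case (Suc m)
      then show ?thesis by (simp add: lessThan_atLeast0 sum.atLeast_Suc_lessThan)
    qed simp
    then have "\<tau> * zeta a b l * cmod (err_hat n l) \<le> 2 * (cmod (forcing 0 l) + ?s)"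
      by (intro order_trans[OF zeta_err_hat_le[OF l, of n]] mult_left_mono) auto
    then have "(\<tau> * zeta a b l * cmod (err_hat n l))\<^sup>2 \<le> (2 * (cmod (forcing 0 l) + ?s))\<^sup>2"
      using \<tau> zeta_pos[of a b l] by (intro power_mono) auto
    also have "\<dots> \<le> 8 * (cmod (forcing 0 l))\<^sup>2 + 8 * ?s\<^sup>2"
      using zero_le_power2[of "cmod (forcing 0 l) - ?s"] unfolding power_mult_distrib power2_sum power2_diff by simp
    also have "?s\<^sup>2 \<le> real n * (\<Sum>k\<in>{1..<n}. (cmod (forcing k l))\<^sup>2)"
    proof -
      have "(\<Sum>k\<in>{1..<n}. 1 * cmod (forcing k l))\<^sup>2 \<le> (\<Sum>k\<in>{1..<n}. 1\<^sup>2) * (\<Sum>k\<in>{1..<n}. (cmod (forcing k l))\<^sup>2)"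
        by (rule Cauchy_Schwarz_ineq_sum)
      also have "\<dots> \<le> real n * (\<Sum>k\<in>{1..<n}. (cmod (forcing k l))\<^sup>2)"
        by (intro mult_right_mono sum_nonneg) auto
      finally show ?thesis by simp
    qed
    finally show ?thesis by (simp add: power_mult_distrib mult.assoc)
  qed
  then have "(\<Sum>l\<in>modes M. \<tau>\<^sup>2 * ((zeta a b l)\<^sup>2 * (cmod (err_hat n l))\<^sup>2)) \<le>
      (\<Sum>l\<in>modes M. 8 * (cmod (forcing 0 l))\<^sup>2 + 8 * real n * (\<Sum>k\<in>{1..<n}. (cmod (forcing k l))\<^sup>2))"
    by (rule sum_mono)
  also have "\<dots> = 8 * (\<Sum>l\<in>modes M. (cmod (forcing 0 l))\<^sup>2)
     + 8 * real n * (\<Sum>l\<in>modes M. \<Sum>k\<in>{1..<n}. (cmod (forcing k l))\<^sup>2)"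
    unfolding sum.distrib sum_distrib_left[symmetric] ..
  also have "(\<Sum>l\<in>modes M. \<Sum>k\<in>{1..<n}. (cmod (forcing k l))\<^sup>2) = (\<Sum>k\<in>{1..<n}. \<Sum>l\<in>modes M. (cmod (forcing k l))\<^sup>2)"
    by (rule sum.swap)
  finally show ?thesis
    unfolding energy_def sum_distrib_left[symmetric] .
qed

definition err :: "nat \<Rightarrow> real \<Rightarrow> complex" where
  "err n x = in_time u (real n * \<tau>) x - num n x"

lemma cont_err: "continuous_on {a..b} (err n)"
  unfolding err_def[abs_def] using \<tau> by (intro continuous_on_diff cont_in_time cont_num) auto

lemma err_differentiable: "x \<in> {a<..<b} \<Longrightarrow> err n differentiable (at x)"
  unfolding err_def[abs_def] using \<tau>
  by (intro differentiable_diff in_time_differentiable num_differentiable) auto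

lemma fcoeff_err: "fcoeff a b (err n) l = err_hat n l"
  unfolding err_def[abs_def] err_hat_def u_hat_def num_hat_def
  using \<tau> by (intro fcoeff_diff cont_in_time cont_num) auto

lemma tail_weight_le:
  assumes l: "l \<notin> modes M" and k: "k \<le> m0"
  shows "((zeta a b l)\<^sup>2) ^ k \<le> (h ^ (m0 - k))\<^sup>2 * ((zeta a b l)\<^sup>2) ^ m0"
proof -
  have "1 \<le> (zeta a b l * h)\<^sup>2"
    using zeta_ge_not_modes[OF M l h] by simp
  then have "1 \<le> ((zeta a b l * h)\<^sup>2) ^ (m0 - k)" by (rule one_le_power)
  then have "((zeta a b l)\<^sup>2) ^ k * 1 \<le> ((zeta a b l)\<^sup>2) ^ k * ((zeta a b l * h)\<^sup>2) ^ (m0 - k)"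
    by (intro mult_left_mono) auto
  also have "\<dots> = (h ^ (m0 - k))\<^sup>2 * (((zeta a b l)\<^sup>2) ^ k * ((zeta a b l)\<^sup>2) ^ (m0 - k))"
    by (simp add: power_mult_distrib power2_eq_square)
  also have "((zeta a b l)\<^sup>2) ^ k * ((zeta a b l)\<^sup>2) ^ (m0 - k) = ((zeta a b l)\<^sup>2) ^ m0"
    using k by (simp flip: power_add)
  finally show ?thesis by simp
qed

text \<open>
  The modes that are kept contribute the energy, since \<open>\<zeta>\<^sub>l \<ge> 1\<close>, and the discarded ones the
  projection error of the exact solution.
\<close>

lemma err_Hk:
  assumes n: "real n * \<tau> \<le> T" and k: "k \<le> 1" and F: "finite F"
  shows "(\<Sum>l\<in>F. ((zeta a b l)\<^sup>2) ^ k * (cmod (fcoeff a b (err n) l))\<^sup>2) \<le> energy n + (h ^ (m0 - k) * B)\<^sup>2"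
proof -
  let ?f = "\<lambda>l. ((zeta a b l)\<^sup>2) ^ k * (cmod (err_hat n l))\<^sup>2"
  have t: "real n * \<tau> \<in> {0..T}" using n \<tau> by auto
  have split: "(\<Sum>l\<in>F. ?f l) = (\<Sum>l\<in>F \<inter> modes M. ?f l) + (\<Sum>l\<in>F - modes M. ?f l)"
    using F by (rule sum.Int_Diff)
  have "(\<Sum>l\<in>F \<inter> modes M. ?f l) \<le> (\<Sum>l\<in>modes M. ?f l)"
    by (rule sum_mono2) auto
  also have "\<dots> \<le> energy n"
    unfolding energy_def
  proof (intro sum_mono mult_right_mono)
    fix l
    have "((zeta a b l)\<^sup>2) ^ k \<le> ((zeta a b l)\<^sup>2) ^ 1"
      using k by (intro power_increasing) (auto simp: zeta_sq)
    then show "((zeta a b l)\<^sup>2) ^ k \<le> (zeta a b l)\<^sup>2" by simp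
  qed simp
  finally have low: "(\<Sum>l\<in>F \<inter> modes M. ?f l) \<le> energy n" .
  have "(\<Sum>l\<in>F - modes M. ?f l) \<le> (\<Sum>l\<in>F - modes M. (h ^ (m0 - k))\<^sup>2 * (((zeta a b l)\<^sup>2) ^ m0 * (cmod (u_hat l (real n * \<tau>)))\<^sup>2))"
  proof (rule sum_mono)
    fix l assume l: "l \<in> F - modes M"
    then have e: "err_hat n l = u_hat l (real n * \<tau>)" by (simp add: err_hat_def num_hat_outside)
    have "((zeta a b l)\<^sup>2) ^ k \<le> (h ^ (m0 - k))\<^sup>2 * ((zeta a b l)\<^sup>2) ^ m0"
      using l k m0 by (intro tail_weight_le) auto
    from mult_right_mono[OF this zero_le_power2[of "cmod (u_hat l (real n * \<tau>))"]]
    show "?f l \<le> (h ^ (m0 - k))\<^sup>2 * (((zeta a b l)\<^sup>2) ^ m0 * (cmod (u_hat l (real n * \<tau>)))\<^sup>2)"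
      unfolding e by (simp only: mult.assoc)
  qed
  also have "\<dots> \<le> (h ^ (m0 - k))\<^sup>2 * B\<^sup>2"
    unfolding sum_distrib_left[symmetric] using F by (intro mult_left_mono u_Hm t) auto
  finally show ?thesis
    unfolding fcoeff_err split power_mult_distrib by (intro add_mono low)
qed

lemma energy_nonneg: "0 \<le> energy n"
  by (simp add: energy_def sum_nonneg)

lemma mean_sq_err_le:
  assumes n: "real n * \<tau> \<le> T"
  shows "mean_sq a b (err n) \<le> energy n + (h ^ m0 * B)\<^sup>2"
proof (rule mean_sq_le_fourier[OF cont_err err_differentiable])
  show "(\<Sum>l\<in>F. (cmod (fcoeff a b (err n) l))\<^sup>2) \<le> energy n + (h ^ m0 * B)\<^sup>2" if "finite F" for F
    using err_Hk[OF n _ that, of 0] by simp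
  show "(\<Sum>l\<in>F. (zeta a b l)\<^sup>2 * (cmod (fcoeff a b (err n) l))\<^sup>2) \<le> energy n + (h ^ (m0 - 1) * B)\<^sup>2" if "finite F" for F
    using err_Hk[OF n _ that, of 1] by simp
qed

text \<open>
  The cube is Lipschitz on the ball of radius \<open>\<rho>\<close>; Bessel's inequality and Parseval's upper bound
  translate between coefficients and functions.
\<close>

lemma cube_hat_error_le:
  assumes n: "real n * \<tau> \<le> T" and F: "finite F"
    and u: "\<And>x. x \<in> {a<..<b} \<Longrightarrow> \<bar>u x (real n * \<tau>)\<bar> \<le> \<rho>"
    and v: "\<And>x. x \<in> {a<..<b} \<Longrightarrow> cmod (num n x) \<le> \<rho>"
  shows "(\<Sum>l\<in>F. (cmod (cube_hat l (real n * \<tau>) - num_cube_hat n l))\<^sup>2)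
    \<le> 9 * \<rho> ^ 4 * (energy n + (h ^ m0 * B)\<^sup>2)"
proof -
  let ?w = "\<lambda>x. in_time u (real n * \<tau>) x ^ 3 - num n x ^ 3"
  have "continuous_on {a..b} (\<lambda>x. in_time u (real n * \<tau>) x ^ 3)"
    by (rule cont_cube) (use \<tau> in simp)
  moreover have "continuous_on {a..b} (\<lambda>x. num n x ^ 3)"
    by (intro continuous_on_power cont_num)
  ultimately have c: "continuous_on {a..b} (\<lambda>x. in_time u (real n * \<tau>) x ^ 3)" "continuous_on {a..b} (\<lambda>x. num n x ^ 3)" .
  have w: "continuous_on {a..b} ?w" by (intro continuous_on_diff c)
  have "(\<Sum>l\<in>F. (cmod (fcoeff a b ?w l))\<^sup>2) \<le> mean_sq a b ?w"
    by (rule bessel[OF w F])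
  also have "\<dots> \<le> 9 * \<rho> ^ 4 * mean_sq a b (err n) + 0"
  proof (rule mean_sq_mono[OF w cont_err])
    fix x assume x: "x \<in> {a<..<b}"
    have "cmod (?w x) \<le> 3 * \<rho>\<^sup>2 * cmod (err n x)"
      unfolding err_def using u[OF x] v[OF x] by (intro norm_cube_diff_le) (auto simp: in_time_def)
    then have "(cmod (?w x))\<^sup>2 \<le> (3 * \<rho>\<^sup>2 * cmod (err n x))\<^sup>2" by (intro power_mono) auto
    then show "(cmod (?w x))\<^sup>2 \<le> 9 * \<rho> ^ 4 * (cmod (err n x))\<^sup>2 + 0"
      by (simp add: power_mult_distrib flip: power_mult)
  qed
  also have "\<dots> \<le> 9 * \<rho> ^ 4 * (energy n + (h ^ m0 * B)\<^sup>2)"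
    using mean_sq_err_le[OF n] by (auto intro!: mult_left_mono)
  finally show ?thesis
    unfolding fcoeff_diff[OF c] cube_hat_def num_cube_hat_def .
qed

lemma norm_r_coef_le: "cmod (2 * r_coef a b \<epsilon> \<tau> l) \<le> \<epsilon>\<^sup>2 * \<tau>\<^sup>2"
proof -
  have z: "zeta a b l > 0" by (rule zeta_pos)
  have "cmod (2 * r_coef a b \<epsilon> \<tau> l) = 2 * (\<epsilon>\<^sup>2 * (1 - cos (\<tau> * zeta a b l)) / (zeta a b l)\<^sup>2)"
    unfolding r_coef_def norm_mult norm_of_real by (simp add: abs_mult)
  also have "\<dots> \<le> 2 * (\<epsilon>\<^sup>2 * ((\<tau> * zeta a b l)\<^sup>2 / 2) / (zeta a b l)\<^sup>2)"
    by (intro mult_left_mono divide_right_mono one_minus_cos_le) auto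
  also have "\<dots> = \<epsilon>\<^sup>2 * \<tau>\<^sup>2" using z by (simp add: power_mult_distrib)
  finally show ?thesis .
qed

lemma forcing_le:
  assumes k: "1 \<le> k" "real (Suc k) * \<tau> \<le> T"
    and u: "\<And>x. x \<in> {a<..<b} \<Longrightarrow> \<bar>u x (real k * \<tau>)\<bar> \<le> \<rho>"
    and v: "\<And>x. x \<in> {a<..<b} \<Longrightarrow> cmod (num k x) \<le> \<rho>"
  shows "(\<Sum>l\<in>modes M. (cmod (forcing k l))\<^sup>2) \<le>
    2 * (\<epsilon>\<^sup>2 * cube_curvature * \<tau> ^ 4)\<^sup>2 + 2 * ((\<epsilon>\<^sup>2 * \<tau>\<^sup>2)\<^sup>2 * (9 * \<rho> ^ 4 * (energy k + (h ^ m0 * B)\<^sup>2)))"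
proof -
  let ?t = "real k * \<tau>"
  have t: "\<tau> \<le> ?t" "?t + \<tau> \<le> T" "?t \<le> T"
    using k \<tau> mult_right_mono[of 1 "real k" \<tau>] by (auto simp: algebra_simps)
  have "(cmod (forcing k l))\<^sup>2 \<le> 2 * (cmod (step_defect \<tau> ?t l))\<^sup>2
      + 2 * ((\<epsilon>\<^sup>2 * \<tau>\<^sup>2)\<^sup>2 * (cmod (cube_hat l ?t - num_cube_hat k l))\<^sup>2)" for l
  proof -
    have "forcing k l = step_defect \<tau> ?t l + 2 * r_coef a b \<epsilon> \<tau> l * (cube_hat l ?t - num_cube_hat k l)"
      using k(1) by (simp add: forcing_def)
    then have "(cmod (forcing k l))\<^sup>2 \<le> 2 * (cmod (step_defect \<tau> ?t l))\<^sup>2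
        + 2 * (cmod (2 * r_coef a b \<epsilon> \<tau> l * (cube_hat l ?t - num_cube_hat k l)))\<^sup>2"
      by (simp only: norm_add_sq_le)
    also have "(cmod (2 * r_coef a b \<epsilon> \<tau> l * (cube_hat l ?t - num_cube_hat k l)))\<^sup>2
        \<le> (\<epsilon>\<^sup>2 * \<tau>\<^sup>2)\<^sup>2 * (cmod (cube_hat l ?t - num_cube_hat k l))\<^sup>2"
      unfolding norm_mult[of "2 * r_coef a b \<epsilon> \<tau> l"] power_mult_distrib[of "cmod (2 * r_coef a b \<epsilon> \<tau> l)"]
      by (intro mult_right_mono power_mono norm_r_coef_le) auto
    finally show ?thesis by simp
  qed
  then have "(\<Sum>l\<in>modes M. (cmod (forcing k l))\<^sup>2) \<le> (\<Sum>l\<in>modes M. 2 * (cmod (step_defect \<tau> ?t l))\<^sup>2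
      + 2 * ((\<epsilon>\<^sup>2 * \<tau>\<^sup>2)\<^sup>2 * (cmod (cube_hat l ?t - num_cube_hat k l))\<^sup>2))"
    by (rule sum_mono)
  also have "\<dots> \<le> 2 * (\<epsilon>\<^sup>2 * cube_curvature * \<tau> ^ 4)\<^sup>2 + 2 * ((\<epsilon>\<^sup>2 * \<tau>\<^sup>2)\<^sup>2 * (9 * \<rho> ^ 4 * (energy k + (h ^ m0 * B)\<^sup>2)))"
    unfolding sum.distrib sum_distrib_left[symmetric]
    by (intro add_mono mult_left_mono step_defect_le \<tau> t cube_hat_error_le u v finite_modes) auto
  finally show ?thesis .
qed

text \<open>
  The size of the nonlinearity accumulated over the whole time interval. For \<open>T = T\<^sub>0 \<epsilon>\<^sup>-\<^sup>\<beta>\<close> this is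
  \<open>T\<^sub>0 \<epsilon>\<^sup>2\<^sup>-\<^sup>\<beta>\<close>.
\<close>

definition kappa :: real where "kappa = \<epsilon>\<^sup>2 * T"

definition source :: "real \<Rightarrow> real" where
  "source \<rho> = (8 * (\<epsilon>\<^sup>2 * cube_rate)\<^sup>2 + 16 * (kappa * cube_curvature)\<^sup>2) * \<tau> ^ 4 + 144 * \<rho> ^ 4 * (kappa * (h ^ m0 * B))\<^sup>2"

text \<open>
  Each factor \<open>n\<close> is paired with a factor \<open>\<tau>\<close> and replaced by \<open>T\<close>.
\<close>

lemma energy_recursion:
  assumes n: "real n * \<tau> \<le> T"
    and u: "\<And>x t. x \<in> {a<..<b} \<Longrightarrow> t \<in> {0..T} \<Longrightarrow> \<bar>u x t\<bar> \<le> \<rho>"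
    and v: "\<And>k x. k < n \<Longrightarrow> x \<in> {a<..<b} \<Longrightarrow> cmod (num k x) \<le> \<rho>"
  shows "energy n \<le> source \<rho> + 144 * \<rho> ^ 4 * \<epsilon>\<^sup>2 * kappa * \<tau> * (\<Sum>k<n. energy k)"
proof (cases "n = 0")
  case True
  have "energy 0 = 0" by (simp add: energy_def err_hat_def num_hat_0)
  then show ?thesis using True by (simp add: source_def)
next
  case False
  define G where "G = 2 * (\<epsilon>\<^sup>2 * cube_curvature * \<tau> ^ 4)\<^sup>2 + 2 * ((\<epsilon>\<^sup>2 * \<tau>\<^sup>2)\<^sup>2 * (9 * \<rho> ^ 4 * (h ^ m0 * B)\<^sup>2))"
  define g where "g = 18 * \<rho> ^ 4 * (\<epsilon>\<^sup>2 * \<tau>\<^sup>2)\<^sup>2"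
  have G0: "0 \<le> G" and g0: "0 \<le> g" by (simp_all add: G_def g_def)
  have "1 * \<tau> \<le> real n * \<tau>" using False \<tau> by (intro mult_right_mono) auto
  then have "\<tau> \<le> T" using n by simp
  then have I: "(\<Sum>l\<in>modes M. (cmod (forcing 0 l))\<^sup>2) \<le> (\<epsilon>\<^sup>2 * cube_rate * \<tau> ^ 3)\<^sup>2"
    using initial_defect_le[of \<tau> "modes M"] \<tau> by (simp add: forcing_def)
  have "(\<Sum>k\<in>{1..<n}. \<Sum>l\<in>modes M. (cmod (forcing k l))\<^sup>2) \<le> (\<Sum>k\<in>{1..<n}. G + g * energy k)"
  proof (rule sum_mono)
    fix k assume k: "k \<in> {1..<n}"
    have "real (Suc k) * \<tau> \<le> real n * \<tau>" using k \<tau> by (intro mult_right_mono) auto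
    then have kT: "real (Suc k) * \<tau> \<le> T" using n by linarith
    then have kT': "real k * \<tau> \<in> {0..T}" using \<tau> by (auto simp: algebra_simps)
    have "(\<Sum>l\<in>modes M. (cmod (forcing k l))\<^sup>2) \<le>
      2 * (\<epsilon>\<^sup>2 * cube_curvature * \<tau> ^ 4)\<^sup>2 + 2 * ((\<epsilon>\<^sup>2 * \<tau>\<^sup>2)\<^sup>2 * (9 * \<rho> ^ 4 * (energy k + (h ^ m0 * B)\<^sup>2)))"
      using k by (intro forcing_le kT u kT' v) auto
    also have "\<dots> = G + g * energy k" by (simp add: G_def g_def distrib_left)
    finally show "(\<Sum>l\<in>modes M. (cmod (forcing k l))\<^sup>2) \<le> G + g * energy k" .
  qed
  also have "\<dots> \<le> (\<Sum>k<n. G + g * energy k)"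
    using G0 g0 energy_nonneg by (intro sum_mono2) auto
  also have "\<dots> = real n * G + g * (\<Sum>k<n. energy k)"
    by (simp add: sum.distrib sum_distrib_left)
  finally have J: "(\<Sum>k\<in>{1..<n}. \<Sum>l\<in>modes M. (cmod (forcing k l))\<^sup>2) \<le> real n * G + g * (\<Sum>k<n. energy k)" .
  have "\<tau>\<^sup>2 * energy n \<le> 8 * (\<epsilon>\<^sup>2 * cube_rate * \<tau> ^ 3)\<^sup>2 + 8 * real n * (real n * G + g * (\<Sum>k<n. energy k))"
    by (rule order_trans[OF energy_le_forcing]) (intro add_mono mult_left_mono I J, simp_all)
  also have "\<dots> = 8 * (\<epsilon>\<^sup>2 * cube_rate * \<tau> ^ 3)\<^sup>2 + 8 * (real n)\<^sup>2 * G + 8 * real n * g * (\<Sum>k<n. energy k)"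
    by (simp add: algebra_simps power2_eq_square)
  also have "\<dots> = \<tau>\<^sup>2 * (8 * (\<epsilon>\<^sup>2 * cube_rate)\<^sup>2 * \<tau> ^ 4
      + (real n * \<tau>)\<^sup>2 * (16 * (\<epsilon>\<^sup>2 * cube_curvature)\<^sup>2 * \<tau> ^ 4 + 144 * \<rho> ^ 4 * (\<epsilon>\<^sup>2 * (h ^ m0 * B))\<^sup>2)
      + 144 * \<rho> ^ 4 * (\<epsilon>\<^sup>2)\<^sup>2 * \<tau> * (real n * \<tau>) * (\<Sum>k<n. energy k))"
    unfolding G_def g_def by algebra
  finally have "energy n \<le> 8 * (\<epsilon>\<^sup>2 * cube_rate)\<^sup>2 * \<tau> ^ 4
      + (real n * \<tau>)\<^sup>2 * (16 * (\<epsilon>\<^sup>2 * cube_curvature)\<^sup>2 * \<tau> ^ 4 + 144 * \<rho> ^ 4 * (\<epsilon>\<^sup>2 * (h ^ m0 * B))\<^sup>2)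
      + 144 * \<rho> ^ 4 * (\<epsilon>\<^sup>2)\<^sup>2 * \<tau> * (real n * \<tau>) * (\<Sum>k<n. energy k)"
    using \<tau> by (subst (asm) mult_le_cancel_left_pos) auto
  also have "\<dots> \<le> 8 * (\<epsilon>\<^sup>2 * cube_rate)\<^sup>2 * \<tau> ^ 4
      + T\<^sup>2 * (16 * (\<epsilon>\<^sup>2 * cube_curvature)\<^sup>2 * \<tau> ^ 4 + 144 * \<rho> ^ 4 * (\<epsilon>\<^sup>2 * (h ^ m0 * B))\<^sup>2)
      + 144 * \<rho> ^ 4 * (\<epsilon>\<^sup>2)\<^sup>2 * \<tau> * T * (\<Sum>k<n. energy k)"
    using \<tau> n by (intro add_mono mult_right_mono mult_left_mono power_mono order_refl sum_nonneg energy_nonneg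
        add_nonneg_nonneg mult_nonneg_nonneg) auto
  also have "\<dots> = source \<rho> + 144 * \<rho> ^ 4 * \<epsilon>\<^sup>2 * kappa * \<tau> * (\<Sum>k<n. energy k)"
    unfolding source_def kappa_def by algebra
  finally show ?thesis .
qed

lemma energy_bound:
  assumes n: "real n * \<tau> \<le> T"
    and u: "\<And>x t. x \<in> {a<..<b} \<Longrightarrow> t \<in> {0..T} \<Longrightarrow> \<bar>u x t\<bar> \<le> \<rho>"
    and v: "\<And>k x. k < n \<Longrightarrow> x \<in> {a<..<b} \<Longrightarrow> cmod (num k x) \<le> \<rho>"
  shows "energy n \<le> source \<rho> * exp (144 * \<rho> ^ 4 * kappa\<^sup>2)"
proof -
  define g where "g = 144 * \<rho> ^ 4 * \<epsilon>\<^sup>2 * kappa * \<tau>"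
  have T: "0 < T" using \<delta> by linarith
  have k0: "0 \<le> kappa" using T by (simp add: kappa_def)
  have g0: "0 \<le> g" using \<tau> k0 by (simp add: g_def)
  have S0: "0 \<le> source \<rho>" by (simp add: source_def)
  have "energy n \<le> source \<rho> * (1 + g) ^ n"
  proof (rule discrete_gronwall[OF g0 _ order_refl])
    fix m assume m: "m \<le> n"
    then have "real m * \<tau> \<le> real n * \<tau>" using \<tau> by (intro mult_right_mono) auto
    then show "energy m \<le> source \<rho> + g * (\<Sum>k<m. energy k)"
      unfolding g_def using n m by (intro energy_recursion u v) auto
  qed
  also have "(1 + g) ^ n \<le> exp g ^ n"
    using g0 by (intro power_mono) auto
  also have "exp g ^ n = exp (144 * \<rho> ^ 4 * \<epsilon>\<^sup>2 * kappa * (real n * \<tau>))"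
    by (simp add: exp_of_nat_mult[symmetric] g_def mult_ac)
  also have "\<dots> \<le> exp (144 * \<rho> ^ 4 * \<epsilon>\<^sup>2 * kappa * T)"
    using n k0 by (auto intro!: mult_left_mono)
  also have "144 * \<rho> ^ 4 * \<epsilon>\<^sup>2 * kappa * T = 144 * \<rho> ^ 4 * kappa\<^sup>2"
    by (simp add: kappa_def power2_eq_square)
  finally show ?thesis using S0 by (simp add: mult_left_mono)
qed

end

section \<open>Essential suprema and norms\<close>

lemma emeasure_Ioo_nonzero: "p < q \<Longrightarrow> emeasure (lebesgue_on {p<..<q::real}) (space (lebesgue_on {p<..<q})) \<noteq> 0"
  by (simp add: space_restrict_space emeasure_restrict_space)

lemma emeasure_Icc_nonzero: "p < q \<Longrightarrow> emeasure (lebesgue_on {p..q::real}) (space (lebesgue_on {p..q})) \<noteq> 0"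
  by (simp add: space_restrict_space emeasure_restrict_space)

text \<open>
  The set where the inequality holds is closed and of full measure, hence everything.
\<close>

lemma AE_le_imp_le:
  fixes g :: "real \<Rightarrow> real"
  assumes pq: "p < q" and g: "continuous_on {p..q} g"
    and ae: "AE x in lebesgue_on {p<..<q}. g x \<le> c"
    and x: "x \<in> {p..q}"
  shows "g x \<le> c"
proof -
  let ?C = "{x \<in> {p..q}. g x \<le> c}"
  have C: "closed ?C"
    using continuous_closed_preimage[OF g, of "{..c}"] by (simp add: vimage_def Int_def conj_commute)
  have "AE x \<in> {p<..<q} in lebesgue. x \<in> ?C"
  proof -
    have "AE x in lebesgue. x \<in> {p<..<q} \<longrightarrow> g x \<le> c"
      using ae by (subst (asm) AE_restrict_space_iff) auto
    then show ?thesis by (rule AE_mp) (auto intro!: AE_I2)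
  qed
  then have "{p<..<q} \<subseteq> ?C"
    using mem_closed_if_AE_lebesgue_open[OF open_greaterThanLessThan C] by blast
  then have "closure {p<..<q} \<subseteq> ?C"
    using C by (rule closure_minimal)
  then show ?thesis using x pq by auto
qed

lemma AE_lebesgue_on_Icc_imp_Ioo:
  assumes "AE x in lebesgue_on {p..q::real}. P x"
  shows "AE x in lebesgue_on {p<..<q}. P x"
proof -
  have "AE x in lebesgue. x \<in> {p..q} \<longrightarrow> P x"
    using assms by (subst (asm) AE_restrict_space_iff) auto
  then have "AE x in lebesgue. x \<in> {p<..<q} \<longrightarrow> P x"
    by (rule AE_mp) (auto intro!: AE_I2)
  then show ?thesis by (subst AE_restrict_space_iff) auto
qed

lemma esssup_le_imp_AE: "esssup N f \<le> c \<Longrightarrow> AE x in N. f x \<le> (c :: ereal)"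
  using esssup_AE[of f N] by (auto elim: eventually_mono)

lemma esssup_nonneg:
  fixes f :: "'a \<Rightarrow> ereal"
  assumes "emeasure N (space N) \<noteq> 0" "\<And>x. 0 \<le> f x"
  shows "0 \<le> esssup N f"
proof -
  have "esssup N (\<lambda>x. 0 :: ereal) \<le> esssup N f"
    using assms(2) by (intro esssup_mono) auto
  then show ?thesis using esssup_const[OF assms(1), of "0 :: ereal"] by simp
qed

context real_interval
begin

lemma H_norm_le_imp:
  assumes "H_norm a b m z \<le> ereal C"
  shows "in_Lp a b 2 z"
    and "finite F \<Longrightarrow> (\<Sum>l\<in>F. ((zeta a b l)\<^sup>2) ^ m * (cmod (fcoeff a b z l))\<^sup>2) \<le> C\<^sup>2"
proof -
  let ?f = "\<lambda>l. (1 + (freq a b l)\<^sup>2) ^ m * (cmod (fcoeff a b z l))\<^sup>2"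
  have fin: "in_Lp a b 2 z" "?f summable_on UNIV"
    using assms unfolding H_norm_def by (auto split: if_splits)
  then have le: "sqrt (\<Sum>\<^sub>\<infinity>l. ?f l) \<le> C"
    using assms unfolding H_norm_def by simp
  show "in_Lp a b 2 z" by (rule fin)
  assume "finite F"
  then have "sum ?f F \<le> (\<Sum>\<^sub>\<infinity>l. ?f l)"
    using fin(2) by (intro finite_sum_le_infsum) auto
  also have "\<dots> \<le> C\<^sup>2"
    by (rule sqrt_le_D[OF le])
  finally show "(\<Sum>l\<in>F. ((zeta a b l)\<^sup>2) ^ m * (cmod (fcoeff a b z l))\<^sup>2) \<le> C\<^sup>2"
    by (simp add: zeta_sq)
qed

lemma H_norm_leI:
  assumes z: "continuous_on {a..b} z" and C: "0 \<le> C"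
    and le: "\<And>F. finite F \<Longrightarrow> (\<Sum>l\<in>F. ((zeta a b l)\<^sup>2) ^ m * (cmod (fcoeff a b z l))\<^sup>2) \<le> C\<^sup>2"
  shows "H_norm a b m z \<le> ereal C"
proof -
  let ?f = "\<lambda>l. (1 + (freq a b l)\<^sup>2) ^ m * (cmod (fcoeff a b z l))\<^sup>2"
  have le': "sum ?f F \<le> C\<^sup>2" if "finite F" for F
    using le[OF that] by (simp add: zeta_sq)
  have "?f summable_on UNIV"
    using le' by (intro nonneg_bdd_above_summable_on) (auto simp: bdd_above_def)
  moreover from this have "(\<Sum>\<^sub>\<infinity>l. ?f l) \<le> C\<^sup>2"
    by (rule infsum_le_finite_sums) (rule le')
  then have "sqrt (\<Sum>\<^sub>\<infinity>l. ?f l) \<le> C"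
    using C by (intro real_le_lsqrt) (auto intro: infsum_nonneg)
  moreover have "in_Lp a b 2 z"
    unfolding in_Lp_def
    by (intro conjI integrable_lebesgue_on_Ioo continuous_intros z
          continuous_imp_measurable_on_sets_lebesgue continuous_on_subset[OF z]) auto
  ultimately show ?thesis by (simp add: H_norm_def)
qed

lemma in_L2_imp_integrable:
  assumes "in_Lp a b 2 w"
  shows "integrable (lebesgue_on {a<..<b}) w"
proof (rule Bochner_Integration.integrable_bound)
  show "integrable (lebesgue_on {a<..<b}) (\<lambda>x. 1 + (cmod (w x))\<^sup>2)"
  proof (rule Bochner_Integration.integrable_add)
    show "integrable (lebesgue_on {a<..<b}) (\<lambda>x. 1 :: real)"
      by (rule integrable_lebesgue_on_Ioo) auto
  qed (use assms in \<open>simp add: in_Lp_def\<close>)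
  show "w \<in> borel_measurable (lebesgue_on {a<..<b})"
    using assms by (simp add: in_Lp_def)
  have "y \<le> 1 + y\<^sup>2" for y :: real
  proof -
    have "0 \<le> (y - 1)\<^sup>2" by simp
    then have "2 * y \<le> y\<^sup>2 + 1" unfolding power2_diff by simp
    with zero_le_power2[of y] show ?thesis by linarith
  qed
  then show "AE x in lebesgue_on {a<..<b}. norm (w x) \<le> norm (1 + (cmod (w x))\<^sup>2)"
    by (intro AE_I2) simp
qed

text \<open>
  The essential supremum of a continuous function is its supremum. The lower estimate tests with real
  upper bounds \<open>c\<close>, so that \<open>AE_le_imp_le\<close> applies.
\<close>

lemma Linf_norm_eq_SUP:
  assumes w: "continuous_on {a..b} w"
  shows "Linf_norm a b w = (SUP x\<in>{a<..<b}. ereal (cmod (w x)))"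
proof (rule antisym)
  have cw: "continuous_on {a<..<b} w" by (rule continuous_on_subset[OF w]) auto
  have "(\<lambda>x. cmod (w x)) \<in> borel_measurable (lebesgue_on {a<..<b})"
    by (intro continuous_imp_measurable_on_sets_lebesgue continuous_intros cw) auto
  then have meas: "(\<lambda>x. ereal (cmod (w x))) \<in> borel_measurable (lebesgue_on {a<..<b})"
    by measurable
  show "Linf_norm a b w \<le> (SUP x\<in>{a<..<b}. ereal (cmod (w x)))"
    unfolding Linf_norm_def
    by (rule esssup_I[OF meas]) (auto simp: space_restrict_space intro!: AE_I2 SUP_upper)
  show "(SUP x\<in>{a<..<b}. ereal (cmod (w x))) \<le> Linf_norm a b w"
  proof (rule SUP_least)
    fix x assume x: "x \<in> {a<..<b}"
    have ae: "AE y in lebesgue_on {a<..<b}. ereal (cmod (w y)) \<le> Linf_norm a b w"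
      unfolding Linf_norm_def by (rule esssup_AE)
    show "ereal (cmod (w x)) \<le> Linf_norm a b w"
    proof (rule ereal_le_real)
      fix c assume c: "Linf_norm a b w \<le> ereal c"
      have "AE y in lebesgue_on {a<..<b}. cmod (w y) \<le> c"
        using ae by (rule eventually_mono) (use c in \<open>auto dest: order_trans\<close>)
      then have "cmod (w x) \<le> c"
        using x by (intro AE_le_imp_le[OF ab, of "\<lambda>x. cmod (w x)"] continuous_intros w) auto
      then show "ereal (cmod (w x)) \<le> ereal c" by simp
    qed
  qed
qed

text \<open>
  The norm is a supremum of continuous functions of \<open>t\<close>, so its superlevel sets are open. Measurability
  matters because \<^const>\<open>esssup\<close> is infinite on functions that are not measurable.
\<close>

lemma Linf_norm_measurable:
  assumes w: "continuous_on ({a..b} \<times> {0..}) (\<lambda>(x, t). w x t)"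
  shows "(\<lambda>t. Linf_norm a b (\<lambda>x. w x t)) \<in> borel_measurable (lebesgue_on {0..T})"
proof (rule borel_measurableI_greater)
  fix y :: ereal
  have eq: "Linf_norm a b (\<lambda>x. w x t) = (SUP x\<in>{a<..<b}. ereal (cmod (w x t)))" if "t \<in> {0..T}" for t
    using that by (intro Linf_norm_eq_SUP continuous_on_slice[OF w]) auto
  have "{t \<in> {0..T}. y < Linf_norm a b (\<lambda>x. w x t)} = (\<Union>x\<in>{a<..<b}. {t \<in> {0..T}. y < ereal (cmod (w x t))})"
    by (auto simp: eq less_SUP_iff) (metis greaterThanLessThan_iff)
  moreover have "openin (top_of_set {0..T}) (\<Union>x\<in>{a<..<b}. {t \<in> {0..T}. y < ereal (cmod (w x t))})"
  proof (intro openin_Union, clarsimp)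
    fix x assume x: "a < x" "x < b"
    have "continuous_on {0..T} (\<lambda>t. (\<lambda>(t, x). w x t) (t, x))"
      by (rule continuous_on_compose2[OF continuous_on_swap_args[OF w]])
         (use x in \<open>auto intro!: continuous_intros\<close>)
    then have "continuous_on {0..T} (\<lambda>t. ereal (cmod (w x t)))"
      by (intro continuous_on_ereal continuous_intros) simp
    from continuous_openin_preimage_gen[OF this, of "{y<..}"]
    show "openin (top_of_set {0..T}) {t. 0 \<le> t \<and> t \<le> T \<and> y < ereal (cmod (w x t))}"
      by (simp add: vimage_def Int_def)
  qed
  ultimately obtain G where "open G" "{t \<in> {0..T}. y < Linf_norm a b (\<lambda>x. w x t)} = {0..T} \<inter> G"
    by (auto simp: openin_open)
  then show "{t \<in> space (lebesgue_on {0..T}). y < Linf_norm a b (\<lambda>x. w x t)} \<in> sets (lebesgue_on {0..T})"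
    by (auto simp: space_restrict_space sets_restrict_space intro!: image_eqI[where x=G])
qed

lemma Linf_time_norm_leI:
  assumes w: "continuous_on ({a..b} \<times> {0..}) (\<lambda>(x, t). w x t)"
    and le: "\<And>x t. x \<in> {a<..<b} \<Longrightarrow> t \<in> {0..T} \<Longrightarrow> \<bar>w x t\<bar> \<le> K"
  shows "Linf_time_norm T (Linf_norm a b) (in_time w) \<le> ereal K"
proof -
  have cw: "continuous_on ({a..b} \<times> {0..}) (\<lambda>(x, t). complex_of_real (w x t))"
    using w by (auto simp: case_prod_unfold intro!: continuous_intros)
  show ?thesis
    unfolding Linf_time_norm_def in_time_def
  proof (rule esssup_I[OF Linf_norm_measurable[OF cw]], rule AE_I2)
    fix t assume "t \<in> space (lebesgue_on {0..T})"
    then have t: "t \<in> {0..T}" by (simp add: space_restrict_space)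
    then have "continuous_on {a..b} (\<lambda>x. complex_of_real (w x t))"
      by (intro continuous_on_slice[OF cw]) auto
    from Linf_norm_eq_SUP[OF this] show "Linf_norm a b (\<lambda>x. complex_of_real (w x t)) \<le> ereal K"
      using le t by (auto intro!: SUP_least)
  qed
qed

lemma Linf_time_norm_leD:
  assumes w: "continuous_on ({a..b} \<times> {0..}) (\<lambda>(x, t). w x t)" and T: "0 < T"
    and le: "Linf_time_norm T (Linf_norm a b) (in_time w) \<le> ereal K"
    and x: "x \<in> {a<..<b}" and t: "t \<in> {0..T}"
  shows "\<bar>w x t\<bar> \<le> K"
proof -
  have "AE t in lebesgue_on {0..T}. Linf_norm a b (in_time w t) \<le> ereal K"
    using le unfolding Linf_time_norm_def by (rule esssup_le_imp_AE)
  from AE_lebesgue_on_Icc_imp_Ioo[OF this]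
  have "AE t in lebesgue_on {0<..<T}. \<bar>w x t\<bar> \<le> K"
  proof (rule AE_mp, intro AE_I2 impI)
    fix t assume "t \<in> space (lebesgue_on {0<..<T})" and n: "Linf_norm a b (in_time w t) \<le> ereal K"
    then have "t \<ge> 0" by (simp add: space_restrict_space)
    then have "continuous_on {a..b} (in_time w t)"
      unfolding in_time_def by (intro continuous_intros continuous_on_slice[OF w]) auto
    from Linf_norm_eq_SUP[OF this] n have "(SUP x\<in>{a<..<b}. ereal (cmod (in_time w t x))) \<le> ereal K" by simp
    then have "ereal (cmod (in_time w t x)) \<le> ereal K" using x by (simp add: SUP_le_iff)
    then show "\<bar>w x t\<bar> \<le> K" by (simp add: in_time_def)
  qed
  moreover have "continuous_on {0..T} (\<lambda>t. \<bar>w x t\<bar>)"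
  proof -
    have "continuous_on {0..T} (\<lambda>t. (\<lambda>(t, x). w x t) (t, x))"
      by (rule continuous_on_compose2[OF continuous_on_swap_args[OF w]])
         (use x in \<open>auto intro!: continuous_intros\<close>)
    then show ?thesis by (intro continuous_intros) simp
  qed
  ultimately show ?thesis
    using AE_le_imp_le[OF T, of "\<lambda>t. \<bar>w x t\<bar>" K t] t by auto
qed

lemma Linf_time_norm_nonneg:
  assumes "0 < T"
  shows "0 \<le> Linf_time_norm T (Linf_norm a b) v"
  unfolding Linf_time_norm_def
proof (rule esssup_nonneg)
  show "0 \<le> Linf_norm a b (v t)" for t
    unfolding Linf_norm_def by (rule esssup_nonneg[OF emeasure_Ioo_nonzero[OF ab]]) auto
qed (rule emeasure_Icc_nonzero[OF assms])

end

section \<open>Sobolev bounds as bounds of Fourier coefficients\<close>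

context kg_solution
begin

text \<open>
  Finite sums of coefficients are continuous in time, so a bound for almost every time holds for every
  time.
\<close>

lemma u_hat_bound_of_H_norm:
  assumes T: "0 < T" and le: "Linf_time_norm T (H_norm a b m) (in_time u) \<le> ereal C"
    and t: "t \<in> {0..T}" and F: "finite F"
  shows "(\<Sum>l\<in>F. ((zeta a b l)\<^sup>2) ^ m * (cmod (u_hat l t))\<^sup>2) \<le> C\<^sup>2"
proof -
  have "AE t in lebesgue_on {0..T}. H_norm a b m (in_time u t) \<le> ereal C"
    using le unfolding Linf_time_norm_def by (rule esssup_le_imp_AE)
  from AE_lebesgue_on_Icc_imp_Ioo[OF this]
  have "AE t in lebesgue_on {0<..<T}. (\<Sum>l\<in>F. ((zeta a b l)\<^sup>2) ^ m * (cmod (u_hat l t))\<^sup>2) \<le> C\<^sup>2"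
    by (rule AE_mp) (auto intro!: AE_I2 simp: u_hat_def H_norm_le_imp(2)[OF _ F])
  then show ?thesis
    using t by (intro AE_le_imp_le[OF T, of "\<lambda>t. \<Sum>l\<in>F. ((zeta a b l)\<^sup>2) ^ m * (cmod (u_hat l t))\<^sup>2"]
        continuous_intros continuous_on_subset[OF continuous_on_u_hat]) auto
qed

lemma utt_hat_bound_of_H_norm:
  assumes T: "0 < T" and le: "Linf_time_norm T (H_norm a b m) (in_time (d_t (d_t u))) \<le> ereal C"
    and t: "t \<in> {0..T}" and F: "finite F"
  shows "(\<Sum>l\<in>F. ((zeta a b l)\<^sup>2) ^ m * (cmod (utt_hat l t))\<^sup>2) \<le> C\<^sup>2"
proof -
  have "AE t in lebesgue_on {0..T}. H_norm a b m (in_time (d_t (d_t u)) t) \<le> ereal C"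
    using le unfolding Linf_time_norm_def by (rule esssup_le_imp_AE)
  from AE_lebesgue_on_Icc_imp_Ioo[OF this]
  have "AE t in lebesgue_on {0<..<T}. (\<Sum>l\<in>F. ((zeta a b l)\<^sup>2) ^ m * (cmod (utt_hat l t))\<^sup>2) \<le> C\<^sup>2"
  proof (rule AE_mp, intro AE_I2 impI)
    fix t assume "t \<in> space (lebesgue_on {0<..<T})"
      and n: "H_norm a b m (in_time (d_t (d_t u)) t) \<le> ereal C"
    then have t: "t > 0" by (simp add: space_restrict_space)
    show "(\<Sum>l\<in>F. ((zeta a b l)\<^sup>2) ^ m * (cmod (utt_hat l t))\<^sup>2) \<le> C\<^sup>2"
      using H_norm_le_imp(2)[OF n F]
      unfolding fcoeff_utt[OF t in_L2_imp_integrable[OF H_norm_le_imp(1)[OF n]]] .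
  qed
  then show ?thesis
    using t by (intro AE_le_imp_le[OF T, of "\<lambda>t. \<Sum>l\<in>F. ((zeta a b l)\<^sup>2) ^ m * (cmod (utt_hat l t))\<^sup>2"]
        continuous_intros continuous_on_subset[OF continuous_on_utt_hat]) auto
qed

lemma kg_regularI:
  assumes \<delta>: "0 < \<delta>" "2 * \<delta> \<le> T" and C: "0 \<le> C" "0 \<le> C'" and m: "1 \<le> m"
    and u: "Linf_time_norm T (H_norm a b m) (in_time u) \<le> ereal C"
    and utt: "Linf_time_norm T (H_norm a b 1) (in_time (d_t (d_t u))) \<le> ereal C'"
  shows "kg_regular a b \<epsilon> \<phi> \<gamma> u T (C + C') \<delta>"
proof unfold_locales
  have T: "0 < T" using \<delta> by linarith
  have CC: "C\<^sup>2 \<le> (C + C')\<^sup>2" "C'\<^sup>2 \<le> (C + C')\<^sup>2"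
    using C by (auto intro!: power_mono)
  show "(\<Sum>l\<in>F. (zeta a b l)\<^sup>2 * (cmod (u_hat l t))\<^sup>2) \<le> (C + C')\<^sup>2" if "t \<in> {0..T}" "finite F" for t F
  proof -
    have "(\<Sum>l\<in>F. (zeta a b l)\<^sup>2 * (cmod (u_hat l t))\<^sup>2) \<le> (\<Sum>l\<in>F. ((zeta a b l)\<^sup>2) ^ m * (cmod (u_hat l t))\<^sup>2)"
    proof (intro sum_mono mult_right_mono)
      fix l have "((zeta a b l)\<^sup>2) ^ 1 \<le> ((zeta a b l)\<^sup>2) ^ m"
        using m by (intro power_increasing) (auto simp: zeta_sq)
      then show "(zeta a b l)\<^sup>2 \<le> ((zeta a b l)\<^sup>2) ^ m" by simp
    qed simp
    also note u_hat_bound_of_H_norm[OF T u that]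
    also note CC(1)
    finally show ?thesis .
  qed
  show "(\<Sum>l\<in>F. (zeta a b l)\<^sup>2 * (cmod (utt_hat l t))\<^sup>2) \<le> (C + C')\<^sup>2" if "t \<in> {0..T}" "finite F" for t F
    using utt_hat_bound_of_H_norm[OF T utt that] CC(2) by simp
qed (use \<delta> C in auto)

end

context kg_regular
begin

text \<open>
  The limit of the difference quotients that \<open>u_Lipschitz\<close> bounds.
\<close>

lemma ut_sup:
  assumes x: "x \<in> {a<..<b}" and t: "t \<in> {0..T}"
  shows "\<bar>d_t u x t\<bar> \<le> sup_ut"
proof (rule tendsto_upperbound)
  have T: "0 < T" using \<delta> by linarith
  \<comment> \<open>At \<open>t = 0\<close> and \<open>t = T\<close> the limit is one-sided.\<close>
  show "at t within {0..T} \<noteq> bot"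
    using t T by (simp add: trivial_limit_within islimpt_Icc)
  have "((\<lambda>s. u x s) has_real_derivative d_t u x t) (at t within {0..T})"
    using has_vector_derivative_within_subset[OF deriv_u_t[of x t], of "{0..T}"] x t
    by (auto simp: has_real_derivative_iff_has_vector_derivative)
  then show "((\<lambda>s. \<bar>(u x s - u x t) / (s - t)\<bar>) \<longlongrightarrow> \<bar>d_t u x t\<bar>) (at t within {0..T})"
    by (intro tendsto_rabs) (simp add: has_field_derivative_iff)
  show "\<forall>\<^sub>F s in at t within {0..T}. \<bar>(u x s - u x t) / (s - t)\<bar> \<le> sup_ut"
  proof -
    have "\<bar>(u x s - u x t) / (s - t)\<bar> \<le> sup_ut" if s: "s \<in> {0..T}" "s \<noteq> t" for s
    proof -
      have "\<bar>u x s - u x t\<bar> \<le> sup_ut * \<bar>s - t\<bar>"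
        using u_Lipschitz[OF x, of s t] u_Lipschitz[OF x, of t s] s t
        by (cases "s \<le> t") (auto simp: abs_minus_commute)
      then show ?thesis using s by (simp add: abs_divide divide_le_eq)
    qed
    then show ?thesis by (auto simp: eventually_at_filter)
  qed
qed

end

section \<open>The error bound\<close>

context kg_scheme
begin

lemma source_le:
  assumes \<eta>: "0 \<le> \<eta>" "\<eta> \<le> 1" "\<epsilon>\<^sup>2 \<le> \<eta>" "kappa \<le> T0 * \<eta>" and T0: "0 \<le> T0"
  shows "source \<rho> \<le> (8 * cube_rate\<^sup>2 + 16 * (T0 * cube_curvature)\<^sup>2 + 144 * \<rho> ^ 4 * (T0 * B)\<^sup>2) * ((\<eta> * \<tau>\<^sup>2)\<^sup>2 + (h ^ m0)\<^sup>2)"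
proof -
  have k0: "0 \<le> kappa" using \<delta> by (simp add: kappa_def)
  have a: "(\<epsilon>\<^sup>2 * cube_rate)\<^sup>2 \<le> (\<eta> * cube_rate)\<^sup>2"
    using \<eta> cube_rate_nonneg by (intro power_mono mult_right_mono) auto
  have b: "(kappa * cube_curvature)\<^sup>2 \<le> (T0 * \<eta> * cube_curvature)\<^sup>2"
    using \<eta> cube_curvature_nonneg k0 by (intro power_mono mult_right_mono) auto
  have "T0 * \<eta> \<le> T0 * 1" using \<eta> T0 by (intro mult_left_mono) auto
  then have "kappa \<le> T0" using \<eta> by simp
  then have c: "(kappa * (h ^ m0 * B))\<^sup>2 \<le> (T0 * (h ^ m0 * B))\<^sup>2"
    using k0 h_pos B by (intro power_mono mult_right_mono) auto
  have "source \<rho> \<le> (8 * (\<eta> * cube_rate)\<^sup>2 + 16 * (T0 * \<eta> * cube_curvature)\<^sup>2) * \<tau> ^ 4 + 144 * \<rho> ^ 4 * (T0 * (h ^ m0 * B))\<^sup>2"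
    unfolding source_def by (intro add_mono mult_right_mono mult_left_mono a b c) auto
  also have "\<dots> = (8 * cube_rate\<^sup>2 + 16 * (T0 * cube_curvature)\<^sup>2) * (\<eta> * \<tau>\<^sup>2)\<^sup>2 + (144 * \<rho> ^ 4 * (T0 * B)\<^sup>2) * (h ^ m0)\<^sup>2"
    by algebra
  also have "\<dots> \<le> (8 * cube_rate\<^sup>2 + 16 * (T0 * cube_curvature)\<^sup>2 + 144 * \<rho> ^ 4 * (T0 * B)\<^sup>2) * ((\<eta> * \<tau>\<^sup>2)\<^sup>2 + (h ^ m0)\<^sup>2)"
    unfolding distrib_left by (rule add_mono; rule mult_right_mono) auto
  finally show ?thesis .
qed

text \<open>
  Strong induction on \<open>n\<close>: if all earlier steps are bounded by \<open>1 + m\<close>, the energy estimate holds up to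
  \<open>n\<close>, and the smallness condition makes the sup-norm of the error at step \<open>n\<close> at most \<open>1\<close>.
\<close>

lemma scheme_error:
  assumes \<eta>: "0 \<le> \<eta>" "\<eta> \<le> 1" "\<epsilon>\<^sup>2 \<le> \<eta>" "kappa \<le> T0 * \<eta>" and T0: "0 \<le> T0" and h1: "h \<le> 1"
    and u: "\<And>x t. x \<in> {a<..<b} \<Longrightarrow> t \<in> {0..T} \<Longrightarrow> \<bar>u x t\<bar> \<le> m"
    and K: "0 \<le> K" "(8 * cube_rate\<^sup>2 + 16 * (T0 * cube_curvature)\<^sup>2 + 144 * (1 + m) ^ 4 * (T0 * B)\<^sup>2)
          * exp (144 * (1 + m) ^ 4 * T0\<^sup>2) + B\<^sup>2 \<le> K\<^sup>2"
    and small: "sqrt sobolev_const * (K * (h ^ (m0 - 1) + \<eta> * \<tau>\<^sup>2)) \<le> 1"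
    and n: "real n * \<tau> \<le> T"
  shows "k \<le> 1 \<Longrightarrow> finite F \<Longrightarrow>
      (\<Sum>l\<in>F. ((zeta a b l)\<^sup>2) ^ k * (cmod (fcoeff a b (err n) l))\<^sup>2) \<le> (K * (h ^ (m0 - k) + \<eta> * \<tau>\<^sup>2))\<^sup>2"
    and "x \<in> {a<..<b} \<Longrightarrow> cmod (num n x) \<le> 1 + m"
proof -
  define Q where "Q = 8 * cube_rate\<^sup>2 + 16 * (T0 * cube_curvature)\<^sup>2 + 144 * (1 + m) ^ 4 * (T0 * B)\<^sup>2"
  define P where "P = exp (144 * (1 + m) ^ 4 * T0\<^sup>2)"
  have Q: "0 \<le> Q" and P: "0 \<le> P" by (simp_all add: Q_def P_def)
  have QP: "0 \<le> Q * P" using Q P by simp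
  have KQ: "Q * P + B\<^sup>2 \<le> K\<^sup>2" using K by (simp add: Q_def P_def)
  have k0: "0 \<le> kappa" using \<delta> by (simp add: kappa_def)
  have "T0 * \<eta> \<le> T0 * 1" using \<eta> T0 by (intro mult_left_mono) auto
  then have kT: "kappa \<le> T0" using \<eta> by simp
  have h0: "0 \<le> h" using h_pos by simp
  have s0: "0 \<le> \<eta> * \<tau>\<^sup>2" using \<eta> by simp
  have ex: "exp (144 * (1 + m) ^ 4 * kappa\<^sup>2) \<le> P"
    unfolding P_def using k0 kT by (auto intro!: mult_left_mono power_mono)
  have main: "(\<Sum>l\<in>F. ((zeta a b l)\<^sup>2) ^ k * (cmod (fcoeff a b (err n) l))\<^sup>2) \<le> (K * (h ^ (m0 - k) + \<eta> * \<tau>\<^sup>2))\<^sup>2"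
    if n: "real n * \<tau> \<le> T" and v: "\<And>k x. k < n \<Longrightarrow> x \<in> {a<..<b} \<Longrightarrow> cmod (num k x) \<le> 1 + m"
      and k: "k \<le> 1" and F: "finite F" for n k F
  proof -
    have "energy n \<le> source (1 + m) * exp (144 * (1 + m) ^ 4 * kappa\<^sup>2)"
    proof (rule energy_bound[OF n _ v])
      show "\<bar>u x t\<bar> \<le> 1 + m" if "x \<in> {a<..<b}" "t \<in> {0..T}" for x t
        using u[OF that] by linarith
    qed
    also have "\<dots> \<le> (Q * ((\<eta> * \<tau>\<^sup>2)\<^sup>2 + (h ^ m0)\<^sup>2)) * P"
      unfolding Q_def
      by (intro mult_mono ex source_le \<eta> T0) (auto simp: Q_def[symmetric] Q)
    finally have "(\<Sum>l\<in>F. ((zeta a b l)\<^sup>2) ^ k * (cmod (fcoeff a b (err n) l))\<^sup>2)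
        \<le> Q * P * ((\<eta> * \<tau>\<^sup>2)\<^sup>2 + (h ^ m0)\<^sup>2) + (h ^ (m0 - k) * B)\<^sup>2"
      using err_Hk[OF n k F] by (simp add: mult_ac)
    also have "\<dots> \<le> Q * P * ((\<eta> * \<tau>\<^sup>2)\<^sup>2 + (h ^ (m0 - k))\<^sup>2) + (h ^ (m0 - k) * B)\<^sup>2"
    proof -
      have "h ^ m0 \<le> h ^ (m0 - k)" using h0 h1 by (intro power_decreasing) auto
      then have "(h ^ m0)\<^sup>2 \<le> (h ^ (m0 - k))\<^sup>2" using h0 by (intro power_mono) auto
      then show ?thesis using QP by (intro add_right_mono mult_left_mono) auto
    qed
    also have "\<dots> \<le> (Q * P + B\<^sup>2) * ((\<eta> * \<tau>\<^sup>2)\<^sup>2 + (h ^ (m0 - k))\<^sup>2)"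
      by (simp add: power_mult_distrib algebra_simps)
    also have "\<dots> \<le> K\<^sup>2 * (h ^ (m0 - k) + \<eta> * \<tau>\<^sup>2)\<^sup>2"
    proof (rule mult_mono[OF KQ])
      have "0 \<le> 2 * h ^ (m0 - k) * (\<eta> * \<tau>\<^sup>2)" using h0 \<eta>(1) by simp
      then show "(\<eta> * \<tau>\<^sup>2)\<^sup>2 + (h ^ (m0 - k))\<^sup>2 \<le> (h ^ (m0 - k) + \<eta> * \<tau>\<^sup>2)\<^sup>2"
        unfolding power2_sum by linarith
    qed auto
    finally show ?thesis by (simp add: power_mult_distrib)
  qed
  have sup: "\<forall>x\<in>{a<..<b}. cmod (num n x) \<le> 1 + m" if "real n * \<tau> \<le> T" for n
    using that
  proof (induction n rule: less_induct)
    case (less n)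
    have v: "cmod (num k x) \<le> 1 + m" if k: "k < n" and x: "x \<in> {a<..<b}" for k x
    proof -
      have "real k * \<tau> \<le> real n * \<tau>" using k \<tau> by (intro mult_right_mono) auto
      then show ?thesis using less k x by auto
    qed
    show ?case
    proof
      fix x assume x: "x \<in> {a<..<b}"
      have "(cmod (err n x))\<^sup>2 \<le> sobolev_const * (K * (h ^ (m0 - 1) + \<eta> * \<tau>\<^sup>2))\<^sup>2"
        using main[OF less.prems v, of 1] by (intro sobolev_sup_bound cont_err x err_differentiable) auto
      also have "\<dots> = (sqrt sobolev_const * (K * (h ^ (m0 - 1) + \<eta> * \<tau>\<^sup>2)))\<^sup>2"
        using sobolev_const_nonneg by (simp add: power_mult_distrib)
      also have "\<dots> \<le> 1\<^sup>2"
        using small K h0 \<eta>(1) sobolev_const_nonneg by (intro power_mono) auto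
      finally have "cmod (err n x) \<le> 1" by (rule power2_le_imp_le) simp
      moreover have "cmod (in_time u (real n * \<tau>) x) \<le> m"
        using u[OF x, of "real n * \<tau>"] less.prems \<tau> by (simp add: in_time_def)
      moreover have "num n x = in_time u (real n * \<tau>) x - err n x" by (simp add: err_def)
      ultimately show "cmod (num n x) \<le> 1 + m"
        using norm_triangle_ineq4[of "in_time u (real n * \<tau>) x" "err n x"] by simp
    qed
  qed
  show "x \<in> {a<..<b} \<Longrightarrow> cmod (num n x) \<le> 1 + m"
    using sup[OF n] by blast
  assume k: "k \<le> 1" and F: "finite F"
  show "(\<Sum>l\<in>F. ((zeta a b l)\<^sup>2) ^ k * (cmod (fcoeff a b (err n) l))\<^sup>2) \<le> (K * (h ^ (m0 - k) + \<eta> * \<tau>\<^sup>2))\<^sup>2"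
  proof (rule main[OF n _ k F])
    fix j x assume j: "j < n" and x: "x \<in> {a<..<b}"
    have "real j * \<tau> \<le> real n * \<tau>" using j \<tau> by (intro mult_right_mono) auto
    then show "cmod (num j x) \<le> 1 + m" using sup[of j] n x by auto
  qed
qed

end

text \<open>
  The largest \<open>\<zeta>\<^sub>l\<close> among the kept modes is at most \<open>sqrt (\<pi>\<^sup>2 + h\<^sup>2) / h\<close>, and the nonnegative term \<open>q\<close> only strengthens the
  restriction.
\<close>

lemma (in real_interval) zeta_cfl:
  assumes M: "M > 0" "l \<in> modes M" and h: "h = (b - a) / real M" and q: "0 \<le> q" and \<tau>0: "0 < \<tau>"
    and \<tau>: "\<tau> \<le> pi * h / (3 * sqrt (pi\<^sup>2 + h\<^sup>2 * (1 + q)))"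
  shows "\<tau> * zeta a b l \<le> pi / 3"
proof -
  define s r where "s = sqrt (pi\<^sup>2 + h\<^sup>2)" and "r = sqrt (pi\<^sup>2 + h\<^sup>2 * (1 + q))"
  have h0: "h > 0" using M ab by (simp add: h)
  have s0: "0 < s" unfolding s_def using pi_gt_zero by (intro real_sqrt_gt_zero add_pos_nonneg) auto
  have sr: "s \<le> r" unfolding s_def r_def using q by (simp add: distrib_left)
  have "\<tau> * zeta a b l \<le> (pi * h / (3 * r)) * (s / h)"
    using \<tau> \<tau>0 zeta_le_modes[OF M h] zeta_pos[of a b l] s0 sr h0 unfolding r_def[symmetric] s_def[symmetric]
    by (intro mult_mono) auto
  also have "\<dots> = pi / 3 * (s / r)" using h0 by simp
  also have "\<dots> \<le> pi / 3 * 1" using s0 sr by (intro mult_left_mono) (auto simp: divide_le_eq)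
  finally show ?thesis by simp
qed

lemma M2_const_nonneg:
  assumes "0 \<le> m"
  shows "0 \<le> M2_const m"
proof -
  let ?S = "{v::real. v \<noteq> 0 \<and> \<bar>v\<bar> \<le> 1 + m}"
  have "\<bar>1::real\<bar>\<^sup>2 \<le> (SUP v\<in>?S. \<bar>v\<bar>\<^sup>2)"
  proof (rule cSUP_upper)
    show "bdd_above ((\<lambda>v. \<bar>v\<bar>\<^sup>2) ` ?S)"
    proof (rule bdd_aboveI2)
      show "\<bar>v\<bar>\<^sup>2 \<le> (1 + m)\<^sup>2" if "v \<in> ?S" for v
        using that by (intro power_mono) auto
    qed
  qed (use assms in auto)
  then show ?thesis by (simp add: M2_const_def)
qed

text \<open>
  The constant \<open>M\<^sub>1\<close> is the real part of an extended real supremum; it bounds the norm of \<open>u\<close> once that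
  supremum is known to be finite.
\<close>

lemma real_of_ereal_SUP_sum:
  fixes A A' :: "'i \<Rightarrow> ereal"
  assumes "E \<noteq> {}" and A: "\<And>i. i \<in> E \<Longrightarrow> 0 \<le> A i" "\<And>i. i \<in> E \<Longrightarrow> A i \<le> ereal p"
    and A': "\<And>i. i \<in> E \<Longrightarrow> 0 \<le> A' i" "\<And>i. i \<in> E \<Longrightarrow> A' i \<le> ereal q"
  defines "s \<equiv> SUP i\<in>E. A i + A' i"
  shows "0 \<le> real_of_ereal s" and "i \<in> E \<Longrightarrow> A i \<le> ereal (real_of_ereal s)"
proof -
  have up: "A i \<le> s" if "i \<in> E" for i
  proof -
    have "A i + 0 \<le> A i + A' i" using A'(1)[OF that] by (intro add_left_mono)
    also have "\<dots> \<le> s" unfolding s_def using that by (rule SUP_upper)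
    finally show ?thesis by simp
  qed
  have "s \<le> ereal p + ereal q"
    unfolding s_def by (intro SUP_least add_mono A A')
  moreover obtain j where "j \<in> E" using assms(1) by blast
  then have s0: "0 \<le> s" using A(1) up order_trans by blast
  ultimately have "\<bar>s\<bar> \<noteq> \<infinity>" by auto
  then have "ereal (real_of_ereal s) = s" by (rule ereal_real')
  with up show "i \<in> E \<Longrightarrow> A i \<le> ereal (real_of_ereal s)" by simp
  show "0 \<le> real_of_ereal s" using s0 by (rule real_of_ereal_pos)
qed

theorem theorem3p1:
  fixes a b T0 \<beta> :: real and m0 :: nat
    and \<phi> \<gamma> :: "real \<Rightarrow> real"
    and u :: "real \<Rightarrow> real \<Rightarrow> real \<Rightarrow> real"
  assumes "a < b" and "T0 > 0" and "0 \<le> \<beta>" and "\<beta> \<le> 2" and "m0 \<ge> 2"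
    and solution: "\<forall>\<epsilon>\<in>{0<..1}. nkge_solution a b \<epsilon> \<phi> \<gamma> (u \<epsilon>)"
    and regular_u: "\<forall>\<epsilon>\<in>{0<..1}.
      in_time (u \<epsilon>) \<in> Linf_time (T_eps T0 \<beta> \<epsilon>) (Hp_space a b m0) (H_norm a b m0)"
    and regular_ut: "\<forall>\<epsilon>\<in>{0<..1}.
      in_time (d_t (u \<epsilon>)) \<in> Linf_time (T_eps T0 \<beta> \<epsilon>) (W14_space a b) (W14_norm a b)"
    and regular_utt: "\<forall>\<epsilon>\<in>{0<..1}.
      in_time (d_t (d_t (u \<epsilon>))) \<in> Linf_time (T_eps T0 \<beta> \<epsilon>) (H_space a b 1) (H_norm a b 1)"
    and bound_u: "\<exists>C>0. \<forall>\<epsilon>\<in>{0<..1}.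
      Linf_time_norm (T_eps T0 \<beta> \<epsilon>) (H_norm a b m0) (in_time (u \<epsilon>)) \<le> ereal C"
    and bound_ut: "\<exists>C>0. \<forall>\<epsilon>\<in>{0<..1}.
      Linf_time_norm (T_eps T0 \<beta> \<epsilon>) (W14_norm a b) (in_time (d_t (u \<epsilon>))) \<le> ereal C"
    and bound_utt: "\<exists>C>0. \<forall>\<epsilon>\<in>{0<..1}.
      Linf_time_norm (T_eps T0 \<beta> \<epsilon>) (H_norm a b 1) (in_time (d_t (d_t (u \<epsilon>)))) \<le> ereal C"
  shows "\<exists>h0>0. \<exists>\<tau>0>0. \<exists>C>0. \<forall>\<epsilon>\<in>{0<..1}. \<forall>(M::nat) (h::real) (\<tau>::real).
    even M \<longrightarrow> M > 0 \<longrightarrow> h = (b - a) / real M \<longrightarrow> h \<le> h0 \<longrightarrow> 0 < \<tau> \<longrightarrow> \<tau> \<le> \<tau>0 \<longrightarrow>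
    \<tau> \<le> 2 * h / sqrt (pi\<^sup>2 + h\<^sup>2 * (1 + \<epsilon>\<^sup>2 * sigma_max a b T0 \<beta> \<epsilon> \<tau> M \<phi> \<gamma>)) \<longrightarrow>
    \<tau> \<le> min (1 / 8) (pi * h / (3 * sqrt (pi\<^sup>2 + h\<^sup>2 * (1 + \<epsilon>\<^sup>2 * M2_const (M1_const a b T0 \<beta> u))))) \<longrightarrow>
    (\<forall>n::nat. real n \<le> T_eps T0 \<beta> \<epsilon> / \<tau> \<longrightarrow>
      (\<forall>k\<in>{0, 1}.
        H_norm a b k (\<lambda>x. of_real (u \<epsilon> x (real n * \<tau>)) - ewi_fs a b \<epsilon> \<tau> M \<phi> \<gamma> n x)
          \<le> ereal (C * (h ^ (m0 - k) + \<epsilon> powr (2 - \<beta>) * \<tau>\<^sup>2))) \<and>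
      Linf_norm a b (ewi_fs a b \<epsilon> \<tau> M \<phi> \<gamma> n) \<le> ereal (1 + M1_const a b T0 \<beta> u))"
proof -
  interpret real_interval a b by unfold_locales fact
  obtain C1 where C1: "C1 > 0" "\<And>\<epsilon>. \<epsilon> \<in> {0<..1} \<Longrightarrow>
      Linf_time_norm (T_eps T0 \<beta> \<epsilon>) (H_norm a b m0) (in_time (u \<epsilon>)) \<le> ereal C1"
    using bound_u by blast
  obtain C2 where C2: "C2 > 0" "\<And>\<epsilon>. \<epsilon> \<in> {0<..1} \<Longrightarrow>
      Linf_time_norm (T_eps T0 \<beta> \<epsilon>) (H_norm a b 1) (in_time (d_t (d_t (u \<epsilon>)))) \<le> ereal C2"
    using bound_utt by blast
  define B where "B = C1 + C2"
  \<comment> \<open>All times \<open>T_eps T0 \<beta> \<epsilon>\<close> are at least \<open>T0\<close>, so this choice serves every \<open>\<epsilon>\<close>.\<close>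
  define \<delta> where "\<delta> = T0 / 2"
  have T: "T0 \<le> T_eps T0 \<beta> \<epsilon>" if "\<epsilon> \<in> {0<..1}" for \<epsilon>
  proof -
    have "\<epsilon> powr \<beta> \<le> 1" using that \<open>0 \<le> \<beta>\<close> by (intro powr_le1) auto
    then show ?thesis using that \<open>T0 > 0\<close> by (simp add: T_eps_def le_divide_eq)
  qed
  have sol: "kg_solution a b \<epsilon> \<phi> \<gamma> (u \<epsilon>)" if "\<epsilon> \<in> {0<..1}" for \<epsilon>
    by unfold_locales (use solution that in blast)
  have reg: "kg_regular a b \<epsilon> \<phi> \<gamma> (u \<epsilon>) (T_eps T0 \<beta> \<epsilon>) B \<delta>" if \<epsilon>: "\<epsilon> \<in> {0<..1}" for \<epsilon>
    unfolding B_def using C1 C2 \<epsilon> \<open>T0 > 0\<close> T[OF \<epsilon>] \<open>m0 \<ge> 2\<close>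
    by (intro kg_solution.kg_regularI[OF sol[OF \<epsilon>], where m=m0]) (auto simp: \<delta>_def)
  define m where "m = M1_const a b T0 \<beta> u"
  define E1 E2 where "E1 = kg_regular.cube_rate a b B \<delta>" and "E2 = kg_regular.cube_curvature a b B \<delta>"
  have M1: "0 \<le> m"
    "\<And>\<epsilon>. \<epsilon> \<in> {0<..1} \<Longrightarrow> Linf_time_norm (T_eps T0 \<beta> \<epsilon>) (Linf_norm a b) (in_time (u \<epsilon>)) \<le> ereal m"
  proof -
    have nonneg: "0 \<le> Linf_time_norm (T_eps T0 \<beta> \<epsilon>) (Linf_norm a b) v" if "\<epsilon> \<in> {0<..1}" for \<epsilon> v
      using T[OF that] \<open>T0 > 0\<close> by (intro Linf_time_norm_nonneg) auto
    have uU: "Linf_time_norm (T_eps T0 \<beta> \<epsilon>) (Linf_norm a b) (in_time (u \<epsilon>)) \<le> ereal (kg_regular.sup_u a b B)" if "\<epsilon> \<in> {0<..1}" for \<epsilon>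
    proof -
      interpret kg_regular a b \<epsilon> \<phi> \<gamma> "u \<epsilon>" "T_eps T0 \<beta> \<epsilon>" B \<delta> by (rule reg[OF that])
      show ?thesis by (rule Linf_time_norm_leI[OF cont_u u_sup])
    qed
    have utW: "Linf_time_norm (T_eps T0 \<beta> \<epsilon>) (Linf_norm a b) (in_time (d_t (u \<epsilon>))) \<le> ereal (kg_regular.sup_ut a b B \<delta>)" if "\<epsilon> \<in> {0<..1}" for \<epsilon>
    proof -
      interpret kg_regular a b \<epsilon> \<phi> \<gamma> "u \<epsilon>" "T_eps T0 \<beta> \<epsilon>" B \<delta> by (rule reg[OF that])
      show ?thesis by (rule Linf_time_norm_leI[OF cont_ut ut_sup])
    qed
    have "(1::real) \<in> {0<..1}" by simp
    then have ne: "{0<..1::real} \<noteq> {}" by blast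
    show "0 \<le> m"
      unfolding m_def M1_const_def
      by (rule real_of_ereal_SUP_sum(1)[OF ne nonneg uU nonneg utW])
    show "Linf_time_norm (T_eps T0 \<beta> \<epsilon>) (Linf_norm a b) (in_time (u \<epsilon>)) \<le> ereal m" if "\<epsilon> \<in> {0<..1}" for \<epsilon>
      unfolding m_def M1_const_def
      by (rule real_of_ereal_SUP_sum(2)[OF ne nonneg uU nonneg utW that])
  qed
  define K where "K = sqrt ((8 * E1\<^sup>2 + 16 * (T0 * E2)\<^sup>2 + 144 * (1 + m) ^ 4 * (T0 * B)\<^sup>2)
          * exp (144 * (1 + m) ^ 4 * T0\<^sup>2) + B\<^sup>2)"
  have B0: "B > 0" using C1(1) C2(1) by (simp add: B_def)
  have K2: "(8 * E1\<^sup>2 + 16 * (T0 * E2)\<^sup>2 + 144 * (1 + m) ^ 4 * (T0 * B)\<^sup>2)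
          * exp (144 * (1 + m) ^ 4 * T0\<^sup>2) + B\<^sup>2 \<le> K\<^sup>2"
    unfolding K_def by (subst real_sqrt_pow2) (auto intro!: add_nonneg_nonneg mult_nonneg_nonneg)
  have K0: "0 < K"
    unfolding K_def using B0 by (intro real_sqrt_gt_zero add_nonneg_pos mult_nonneg_nonneg add_nonneg_nonneg) auto
  \<comment> \<open>Adding \<open>1\<close> makes the bound \<open>h0\<close> below at most \<open>1\<close>.\<close>
  define c where "c = sqrt sobolev_const * K + 1"
  have c: "1 \<le> c" "sqrt sobolev_const * K \<le> c" using K0 sobolev_const_nonneg by (auto simp: c_def)
  \<comment> \<open>With \<open>h, \<tau> \<le> h0\<close> each of the two error terms contributes at most \<open>1 / 2\<close> to the sup-norm.\<close>
  define h0 where "h0 = 1 / (2 * c)"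
  have h0: "0 < h0" "h0 \<le> 1" "c * h0 = 1 / 2" using c by (auto simp: h0_def divide_le_eq)
  show ?thesis
  proof (rule exI[of _ h0], intro conjI h0(1), rule exI[of _ h0], intro conjI h0(1),
      rule exI[of _ K], intro conjI K0 ballI allI impI)
    fix \<epsilon> \<tau> h :: real and M n :: nat
    assume \<epsilon>: "\<epsilon> \<in> {0<..1}" and M_pos: "even M" "M > 0" and h_eq: "h = (b - a) / real M" and h_le: "h \<le> h0"
      and \<tau>_pos: "0 < \<tau>" and \<tau>_le: "\<tau> \<le> h0"
      and cfl: "\<tau> \<le> min (1 / 8) (pi * h / (3 * sqrt (pi\<^sup>2 + h\<^sup>2 * (1 + \<epsilon>\<^sup>2 * M2_const (M1_const a b T0 \<beta> u)))))"
      and n: "real n \<le> T_eps T0 \<beta> \<epsilon> / \<tau>"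
    define T where "T = T_eps T0 \<beta> \<epsilon>"
    define \<eta> where "\<eta> = \<epsilon> powr (2 - \<beta>)"
    interpret R: kg_regular a b \<epsilon> \<phi> \<gamma> "u \<epsilon>" T B \<delta> unfolding T_def by (rule reg[OF \<epsilon>])
    have T0: "0 < T" using T[OF \<epsilon>] \<open>T0 > 0\<close> by (simp add: T_def)
    interpret kg_scheme a b \<epsilon> \<phi> \<gamma> "u \<epsilon>" T B \<delta> m0 M \<tau> h
    proof unfold_locales
      show "\<tau> * zeta a b l \<le> pi / 3" if "l \<in> modes M" for l
        using cfl M2_const_nonneg[OF M1(1)]
        by (intro zeta_cfl[OF M_pos(2) that h_eq _ \<tau>_pos, of "\<epsilon>\<^sup>2 * M2_const m"]) (auto simp: m_def)
      show "(\<Sum>l\<in>F. ((zeta a b l)\<^sup>2) ^ m0 * (cmod (R.u_hat l t))\<^sup>2) \<le> B\<^sup>2" if "t \<in> {0..T}" "finite F" for t F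
      proof -
        have "(\<Sum>l\<in>F. ((zeta a b l)\<^sup>2) ^ m0 * (cmod (R.u_hat l t))\<^sup>2) \<le> C1\<^sup>2"
          using C1(2)[OF \<epsilon>] that unfolding T_def[symmetric] by (intro R.u_hat_bound_of_H_norm[OF T0])
        also have "C1\<^sup>2 \<le> B\<^sup>2" using C1(1) C2(1) by (intro power_mono) (auto simp: B_def)
        finally show ?thesis .
      qed
    qed (use M_pos h_eq \<tau>_pos \<open>m0 \<ge> 2\<close> in auto)
    have \<eta>: "0 \<le> \<eta>" "\<eta> \<le> 1"
      using \<epsilon> \<open>\<beta> \<le> 2\<close> by (auto simp: \<eta>_def intro!: powr_le1)
    have \<epsilon>2: "\<epsilon>\<^sup>2 = \<eta> * \<epsilon> powr \<beta>"
      using \<epsilon> by (simp add: \<eta>_def powr_add[symmetric] powr_numeral)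
    have e1: "\<epsilon> powr \<beta> \<le> 1" using \<epsilon> \<open>0 \<le> \<beta>\<close> by (intro powr_le1) auto
    have \<eta>2: "\<epsilon>\<^sup>2 \<le> \<eta>"
      using mult_left_mono[OF e1 \<eta>(1)] by (simp add: \<epsilon>2)
    have \<kappa>: "kappa \<le> T0 * \<eta>"
      unfolding kappa_def unfolding \<epsilon>2 T_def T_eps_def using \<epsilon> by simp
    have u: "\<bar>u \<epsilon> x t\<bar> \<le> m" if "x \<in> {a<..<b}" "t \<in> {0..T}" for x t
      using M1(2)[OF \<epsilon>] that unfolding T_def[symmetric] by (intro Linf_time_norm_leD[OF R.cont_u T0])
    have hh: "0 \<le> h" "h \<le> 1" using h_pos h_le h0(2) by linarith+
    have small: "sqrt sobolev_const * (K * (h ^ (m0 - 1) + \<eta> * \<tau>\<^sup>2)) \<le> 1"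
    proof -
      have "h ^ (m0 - 1) \<le> h ^ 1" using hh \<open>m0 \<ge> 2\<close> by (intro power_decreasing) auto
      moreover have "\<eta> * \<tau>\<^sup>2 \<le> 1 * (1 * \<tau>)"
        unfolding power2_eq_square using \<eta> \<tau>_pos \<tau>_le h0(2) by (intro mult_mono) auto
      ultimately have "h ^ (m0 - 1) + \<eta> * \<tau>\<^sup>2 \<le> h0 + h0" using h_le \<tau>_le by simp
      moreover have "0 \<le> h ^ (m0 - 1) + \<eta> * \<tau>\<^sup>2" using hh \<eta> by simp
      ultimately have "(sqrt sobolev_const * K) * (h ^ (m0 - 1) + \<eta> * \<tau>\<^sup>2) \<le> c * (h0 + h0)"
        using c by (intro mult_mono) auto
      then show ?thesis using h0(3) by (simp add: mult.assoc)
    qed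
    have nT: "real n * \<tau> \<le> T" using n \<tau>_pos by (simp add: T_def le_divide_eq)
    note main = scheme_error[OF \<eta> \<eta>2 \<kappa> less_imp_le[OF \<open>T0 > 0\<close>] hh(2) u less_imp_le[OF K0]
        K2[unfolded E1_def E2_def] small nT]
    have err_eq: "err n = (\<lambda>x. of_real (u \<epsilon> x (real n * \<tau>)) - ewi_fs a b \<epsilon> \<tau> M \<phi> \<gamma> n x)"
      by (rule ext) (simp add: err_def in_time_def num_def)
    {
      fix k :: nat assume "k \<in> {0, 1}"
      then have k: "k \<le> 1" by auto
      have "H_norm a b k (err n) \<le> ereal (K * (h ^ (m0 - k) + \<eta> * \<tau>\<^sup>2))"
        using K0 hh \<eta> by (intro H_norm_leI cont_err main(1)[OF _ _ k]) auto
      then show "H_norm a b k (\<lambda>x. of_real (u \<epsilon> x (real n * \<tau>)) - ewi_fs a b \<epsilon> \<tau> M \<phi> \<gamma> n x)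
          \<le> ereal (K * (h ^ (m0 - k) + \<epsilon> powr (2 - \<beta>) * \<tau>\<^sup>2))"
        unfolding err_eq \<eta>_def .
    }
    have "Linf_norm a b (num n) \<le> ereal (1 + m)"
      unfolding Linf_norm_eq_SUP[OF cont_num] using main(2) by (auto intro!: SUP_least)
    then show "Linf_norm a b (ewi_fs a b \<epsilon> \<tau> M \<phi> \<gamma> n) \<le> ereal (1 + M1_const a b T0 \<beta> u)"
      unfolding m_def num_def .
  qed
qed

end
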